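(* Let $(d(n))_{n=1}^{\infty}$ be a sequence of natural numbers with $d(n)=o(n)$, and let $\beta>0$. Then there are integers $c$ and $n_0$ such that the following holds. Let $p$ be a prime, let $A\subset \mathbb{Z}_p$ with $n_0\le |A|=n \le (1 - \beta)p/2$, and let $\mathcal{F} \subset A \times A$ have degree $d=d(n)$. Then there is a set $B'\subset A$ with $|B'|\le c$ such that $$|A+_{\mathcal{F}} B'|\ge 2n-1-2d.$$
   Context: $\mathbb{Z}_p$ is the cyclic group of prime order $p$. For $\mathcal{F}\subset A\times A$ (the set of forbidden pairs) and $B'\subset A$, the $\mathcal{F}$-restricted sum is $A+_{\mathcal{F}}B'=\{a+b : a\in A,\ b\in B',\ (a,b)\notin\mathcal{F}\}$. For $b\in A$ (viewed in the second factor), the degree of $b$ is $|\{a\in A : (a,b)\in\mathcal{F}\}|$, and the degree of $\mathcal{F}$ is the maximum of the degrees of all $b\in A$. *)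

theory Defs
  imports
    Complex_Main
    "HOL-Number_Theory.Residues"
    "HOL-Library.Landau_Symbols"
begin

text \<open>
  The additive group is that of an arbitrary ring record so that it can be instantiated with
  \<^term>\<open>residue_ring (int p)\<close>. This is needed because \<^term>\<open>p\<close> is quantified inside the theorem
  and so cannot be fixed by a type.
\<close>

definition restricted_sum ::
    "('a, 'm) ring_scheme \<Rightarrow> ('a \<times> 'a) set \<Rightarrow> 'a set \<Rightarrow> 'a set \<Rightarrow> 'a set" where
  "restricted_sum R F A B = {a \<oplus>\<^bsub>R\<^esub> b | a b. a \<in> A \<and> b \<in> B \<and> (a, b) \<notin> F}"

definition forbidden_vertex_degree :: "'a set \<Rightarrow> ('a \<times> 'a) set \<Rightarrow> 'a \<Rightarrow> nat" where
  "forbidden_vertex_degree A F b = card {a \<in> A. (a, b) \<in> F}"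

text \<open>The value is meaningful only for finite nonempty \<^term>\<open>A\<close>.\<close>

definition forbidden_degree :: "'a set \<Rightarrow> ('a \<times> 'a) set \<Rightarrow> nat" where
  "forbidden_degree A F = Max (forbidden_vertex_degree A F ` A)"

end

theory Submission imports Defs begin

text \<open>
  Write \<open>n = |A|\<close>. Adding elements of \<open>A\<close> to \<open>B\<close> greedily, either boundedly many of them give
  \<open>|A + B| \<ge> (2 + \<epsilon>) n\<close>, and the forbidden pairs destroy only \<open>O(d(n)) = o(n)\<close> of these sums, or there
  is a set \<open>S\<close> with \<open>|S| < (2 + \<epsilon>) n\<close> containing all but \<open>\<epsilon> n\<close> elements of every translate \<open>a + A\<close>
  with \<open>a \<in> A\<close>. In the second case a dilate of \<open>A\<close> lies in an interval of length less than \<open>p / 2\<close>; then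
  \<open>A\<close> translated by its two extreme elements has at least \<open>2 n - 1\<close> elements, and at most \<open>2 d\<close> of them
  are lost.

  For the structural claim, put \<open>\<phi>(e) = |(A + e) - A|\<close>, which is subadditive in \<open>e\<close>. Replacing a set \<open>X\<close>
  (initially \<open>A\<close>) repeatedly by some \<open>X \<inter> (X - e)\<close>, and \<open>S\<close> by \<open>S \<inter> (S - e)\<close>, keeps
  \<open>|S| \<le> |A| + |X| + o(n)\<close> by Pollard's theorem and leads to a small \<open>X\<close> for which \<open>\<phi>\<close> is essentially at most
  \<open>|X|\<close> on \<open>X - X\<close>. By the Cauchy-Davenport theorem and the identity \<open>\<Sum>e. n - \<phi>(e) = n\<^sup>2\<close>, the set
  \<open>{e. \<phi>(e) \<le> T}\<close> therefore has about \<open>2 T\<close> elements for all \<open>T \<le> n / 2\<close>. Averaging against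
  the squared Fourier coefficients of \<open>A\<close> shows that for small \<open>T\<close> this set concentrates, after a dilation,
  near \<open>0\<close>, and its linear growth makes it almost an arithmetic progression. After another dilation
  \<open>\<phi>\<close> is small on a short interval \<open>[0, l]\<close> and \<open>\<phi>(l)\<close> is at most about \<open>l\<close>. Then the average of the
  indicator of \<open>A\<close> over windows of length \<open>l\<close> has total variation about \<open>2\<close>, which forces \<open>A\<close> to be close to a
  single arc; elements of \<open>A\<close> far from the arc would make \<open>S\<close> too large.
\<close>

section \<open>Pollard's theorem and the Cauchy-Davenport theorem\<close>

text \<open>Cauchy-Davenport is unstable here: a sum counts even if it is represented only once, so
  the few pairs that leave \<open>S\<close> could account for many sums. Pollard's theorem counts
  sums with multiplicity up to \<open>t\<close>; with \<open>t\<close> near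
  \<open>sqrt \<epsilon> * n\<close> the exceptional pairs cost only
  \<open>O(sqrt \<epsilon> * n)\<close>. Each replacement of \<open>X\<close> thus turns the error
  into a multiple of its square root, which is affordable because the number of replacements is
  bounded independently of the group. The descent to small \<open>X\<close> is what makes
  \<open>\<phi>\<close> informative: on \<open>A - A\<close> the bound
  \<open>\<phi> \<le> |A|\<close> is trivial. Sumsets of \<open>X - X\<close> give only lower bounds
  for the sets of near periods; the matching upper bounds follow because the exact total leaves no
  room for an excess. When \<open>n\<close> is close to \<open>p / 2\<close>, a large Fourier
  coefficient of \<open>A\<close> does not by itself confine \<open>A\<close> to an arc. Near
  periods behave better: only a proportion \<open>O(T / n)\<close> of those of level
  \<open>T\<close> can stay outside a short arc, and inside it they are integers, to which order and
  residues apply.\<close>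

definition rep_count :: "'a::ab_group_add set \<Rightarrow> 'a set \<Rightarrow> 'a \<Rightarrow> nat" where
  "rep_count X Y z = card {x \<in> X. z - x \<in> Y}"

definition autocorr :: "'a::ab_group_add set \<Rightarrow> 'a \<Rightarrow> nat" where
  "autocorr X e = card {x \<in> X. x + e \<in> X}"

definition escape :: "'a::ab_group_add set \<Rightarrow> 'a \<Rightarrow> nat" where
  "escape X e = card {x \<in> X. x + e \<notin> X}"

lemma autocorr_add_escape:
  assumes "finite X" shows "autocorr X e + escape X e = card X"
proof -
  have "card ({x \<in> X. x + e \<in> X} \<union> {x \<in> X. x + e \<notin> X}) = autocorr X e + escape X e"
    unfolding autocorr_def escape_def using assms by (intro card_Un_disjoint) auto
  moreover have "{x \<in> X. x + e \<in> X} \<union> {x \<in> X. x + e \<notin> X} = X" by auto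
  ultimately show ?thesis by simp
qed

lemma autocorr_uminus: "autocorr X (- e) = autocorr X e"
proof -
  have "bij_betw (\<lambda>x. x + e) {x \<in> X. x + e \<in> X} {x \<in> X. x + - e \<in> X}"
    by (rule bij_betwI[where g = "\<lambda>x. x - e"]) auto
  from bij_betw_same_card[OF this] show ?thesis unfolding autocorr_def by simp
qed

lemma escape_uminus:
  assumes "finite X" shows "escape X (- e) = escape X e"
  using autocorr_add_escape[OF assms, of e] autocorr_add_escape[OF assms, of "- e"]
    autocorr_uminus[of X e] by linarith

lemma escape_0 [simp]: "escape X 0 = 0"
  by (simp add: escape_def)

lemma escape_le_card: "finite X \<Longrightarrow> escape X e \<le> card X"
  unfolding escape_def by (rule card_mono) auto

lemma escape_add:
  assumes "finite X" shows "escape X (e + f) \<le> escape X e + escape X f"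
proof -
  let ?A = "{x \<in> X. x + e \<notin> X}" and ?B = "{x \<in> X. x + e \<in> X \<and> x + e + f \<notin> X}"
  have "escape X (e + f) \<le> card (?A \<union> ?B)"
    unfolding escape_def using assms by (intro card_mono) (auto simp: add.assoc)
  also have "\<dots> \<le> card ?A + card ?B" by (rule card_Un_le)
  also have "card ?B \<le> card {x \<in> X. x + f \<notin> X}"
    using assms by (intro card_inj_on_le[where f = "\<lambda>x. x + e"]) (auto simp: inj_on_def)
  finally show ?thesis unfolding escape_def by simp
qed

lemma sum_card_eq_card_Sigma:
  assumes "finite X" "\<And>x. x \<in> X \<Longrightarrow> finite (B x)"
  shows "(\<Sum>x\<in>X. card (B x)) = card (SIGMA x:X. B x)"
  using assms by (simp add: card_SigmaI)

lemma sum_rep_count: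
  assumes "finite X" "finite Y" "finite Z"
  shows "(\<Sum>z\<in>Z. rep_count X Y z) = (\<Sum>x\<in>X. card {y \<in> Y. x + y \<in> Z})"
proof -
  have "(\<Sum>z\<in>Z. rep_count X Y z) = card (SIGMA z:Z. {x \<in> X. z - x \<in> Y})"
    unfolding rep_count_def using assms by (intro sum_card_eq_card_Sigma) auto
  also have "\<dots> = card (SIGMA x:X. {y \<in> Y. x + y \<in> Z})"
    by (rule bij_betw_same_card[of "\<lambda>(z, x). (x, z - x)"],
        rule bij_betwI[where g = "\<lambda>(x, y). (x + y, x)"]) auto
  also have "\<dots> = (\<Sum>x\<in>X. card {y \<in> Y. x + y \<in> Z})"
    using assms by (intro sum_card_eq_card_Sigma[symmetric]) auto
  finally show ?thesis .
qed

lemma rep_count_le: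
  assumes "finite X" "finite Y"
  shows "rep_count X Y z \<le> card X" "rep_count X Y z \<le> card Y"
proof -
  show "rep_count X Y z \<le> card X"
    unfolding rep_count_def using assms by (intro card_mono) auto
  show "rep_count X Y z \<le> card Y" unfolding rep_count_def
    using assms by (intro card_inj_on_le[where f = "\<lambda>x. z - x"]) (auto simp: inj_on_def)
qed

lemma rep_count_Un_left:
  assumes "finite X" "finite X'" "X \<inter> X' = {}"
  shows "rep_count (X \<union> X') Y z = rep_count X Y z + rep_count X' Y z"
proof -
  have "{x \<in> X \<union> X'. z - x \<in> Y} = {x \<in> X. z - x \<in> Y} \<union> {x \<in> X'. z - x \<in> Y}" by auto
  then show ?thesis unfolding rep_count_def using assms by (simp, intro card_Un_disjoint) auto
qed

lemma rep_count_Un_right: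
  assumes "finite X" "Y \<inter> Y' = {}"
  shows "rep_count X (Y \<union> Y') z = rep_count X Y z + rep_count X Y' z"
proof -
  have "{x \<in> X. z - x \<in> Y \<union> Y'} = {x \<in> X. z - x \<in> Y} \<union> {x \<in> X. z - x \<in> Y'}" by auto
  then show ?thesis unfolding rep_count_def using assms by (simp, intro card_Un_disjoint) auto
qed

lemma rep_count_commute: "rep_count X Y z = rep_count Y X z"
proof -
  have "bij_betw (\<lambda>x. z - x) {x \<in> X. z - x \<in> Y} {y \<in> Y. z - y \<in> X}"
    by (rule bij_betwI[where g = "\<lambda>x. z - x"]) auto
  from bij_betw_same_card[OF this] show ?thesis unfolding rep_count_def by simp
qed

text \<open>The Dyson transform in counted form: with \<open>P = X - Y\<close>,
  \<open>Q = Y - X\<close> and \<open>I = X \<inter> Y\<close>, both sides expand to the counts for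
  the pairs \<open>P Q\<close>, \<open>P I\<close>, \<open>I Q\<close> and \<open>I I\<close>.
  Passing from \<open>Y\<close> to the smaller \<open>I\<close> drives the induction in
  \<open>pollard\<close>.\<close>

lemma rep_count_Int_Un:
  assumes "finite X" "finite Y"
  shows "rep_count X Y z = rep_count (X - Y) (Y - X) z + rep_count (X \<union> Y) (X \<inter> Y) z"
proof -
  let ?P = "X - Y" and ?Q = "Y - X" and ?I = "X \<inter> Y"
  have X: "X = ?P \<union> ?I" and Y: "Y = ?Q \<union> ?I" by auto
  have "rep_count X Y z = rep_count (?P \<union> ?I) (?Q \<union> ?I) z" using X Y by simp
  also have "\<dots> = rep_count ?P (?Q \<union> ?I) z + rep_count ?I (?Q \<union> ?I) z"
    using assms by (intro rep_count_Un_left) auto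
  also have "\<dots> = rep_count ?P ?Q z + rep_count ?P ?I z + (rep_count ?I ?Q z + rep_count ?I ?I z)"
    using assms by (subst (1 2) rep_count_Un_right) auto
  finally have 1: "rep_count X Y z = \<dots>" .
  have "rep_count (X \<union> Y) ?I z = rep_count (?P \<union> (?Q \<union> ?I)) ?I z" by (rule arg_cong[where f = "\<lambda>V. rep_count V ?I z"]) auto
  also have "\<dots> = rep_count ?P ?I z + (rep_count ?Q ?I z + rep_count ?I ?I z)"
    using assms by (subst rep_count_Un_left, force, force, force, subst rep_count_Un_left) auto
  finally show ?thesis using 1 rep_count_commute[of ?I ?Q z] by simp
qed

lemma rep_count_shift: "rep_count ((\<lambda>x. x + e) ` X) Y z = rep_count X Y (z - e)"
proof -
  have "bij_betw (\<lambda>x. x + e) {x \<in> X. z - e - x \<in> Y} {x \<in> (\<lambda>x. x + e) ` X. z - x \<in> Y}"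
    by (rule bij_betwI[where g = "\<lambda>x. x - e"]) (auto simp: algebra_simps)
  from bij_betw_same_card[OF this] show ?thesis unfolding rep_count_def by simp
qed

text \<open>A group of prime order is presented by a homomorphism from the integers with kernel
  \<open>p\<int>\<close>; replacing \<open>\<iota>\<close> by \<open>\<lambda>k. \<iota> (m * k)\<close> is then a dilation of the same group.\<close>

locale prime_cyclic =
  fixes p :: nat and \<iota> :: "int \<Rightarrow> 'a::ab_group_add"
  assumes prime: "prime p"
    and hom_add: "\<And>j k. \<iota> (j + k) = \<iota> j + \<iota> k"
    and ker: "\<And>k. \<iota> k = 0 \<longleftrightarrow> int p dvd k"
begin

definition H :: "'a set" where "H = range \<iota>"

lemma hom_in_H [simp]: "\<iota> k \<in> H" by (simp add: H_def)

lemma H_cases: assumes "x \<in> H" obtains k where "x = \<iota> k" using assms by (auto simp: H_def)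

lemma p_pos: "p > 0" using prime by (simp add: prime_gt_0_nat)

lemma hom_0 [simp]: "\<iota> 0 = 0" using ker by simp

lemma hom_uminus: "\<iota> (- k) = - \<iota> k"
  using hom_add[of k "- k"] by (simp add: eq_neg_iff_add_eq_0 add.commute)

lemma hom_diff: "\<iota> (j - k) = \<iota> j - \<iota> k"
  using hom_add[of j "- k"] hom_uminus by simp

lemma hom_eq_iff: "\<iota> j = \<iota> k \<longleftrightarrow> int p dvd j - k"
  using ker[of "j - k"] hom_diff by simp

lemma hom_mod: "\<iota> (k mod int p) = \<iota> k"
  by (simp add: hom_eq_iff mod_eq_dvd_iff[symmetric])

lemma inj_on_hom:
  assumes "\<And>j k. j \<in> K \<Longrightarrow> k \<in> K \<Longrightarrow> \<bar>j - k\<bar> < int p" shows "inj_on \<iota> K"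
proof (rule inj_onI)
  fix j k assume "j \<in> K" "k \<in> K" "\<iota> j = \<iota> k"
  then have "int p dvd j - k" "\<bar>j - k\<bar> < int p" using hom_eq_iff assms by auto
  then show "j = k" using dvd_imp_le_int[of "j - k" "int p"] by auto
qed

lemma bij_betw_hom: "bij_betw \<iota> {0..<int p} H"
  unfolding bij_betw_def
proof
  show "inj_on \<iota> {0..<int p}" by (rule inj_on_hom) auto
  have "\<iota> k \<in> \<iota> ` {0..<int p}" for k
    using p_pos hom_mod[of k] by (intro image_eqI[where x = "k mod int p"]) auto
  then show "\<iota> ` {0..<int p} = H" by (auto simp: H_def)
qed

lemma finite_H [simp]: "finite H" using bij_betw_hom bij_betw_finite by blast

lemma card_H [simp]: "card H = p" using bij_betw_same_card[OF bij_betw_hom] by simp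

lemma finite_subset_H: "X \<subseteq> H \<Longrightarrow> finite X" using finite_H finite_subset by blast

lemma card_le_p: "X \<subseteq> H \<Longrightarrow> card X \<le> p" using card_mono[OF finite_H] by simp

lemma H_add: "x \<in> H \<Longrightarrow> y \<in> H \<Longrightarrow> x + y \<in> H" by (metis H_cases hom_add hom_in_H)
lemma H_diff: "x \<in> H \<Longrightarrow> y \<in> H \<Longrightarrow> x - y \<in> H" by (metis H_cases hom_diff hom_in_H)
lemma H_uminus: "x \<in> H \<Longrightarrow> - x \<in> H" by (metis H_cases hom_uminus hom_in_H)
lemma H_0: "0 \<in> H" using hom_0 by (metis hom_in_H)

text \<open>Primality makes \<open>k\<close> invertible modulo \<open>p\<close> when
  \<open>e = \<iota> k\<close> is nonzero, so the multiples of \<open>e\<close> lead from one point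
  of \<open>X\<close> to every element.\<close>

lemma shift_stable_eq_H:
  assumes "X \<subseteq> H" "X \<noteq> {}" "e \<in> H" "e \<noteq> 0" "\<And>x. x \<in> X \<Longrightarrow> x + e \<in> X"
  shows "X = H"
proof -
  obtain x where x: "x \<in> X" using assms by auto
  obtain a where a: "x = \<iota> a" using x assms by (blast elim: H_cases)
  obtain k where k: "e = \<iota> k" using assms by (blast elim: H_cases)
  have step: "\<iota> (a + int j * k) \<in> X" for j
  proof (induction j)
    case 0 then show ?case using x a by simp
  next
    case (Suc j)
    have "\<iota> (a + int (Suc j) * k) = \<iota> (a + int j * k) + e"
      by (simp add: k hom_add[symmetric] algebra_simps)
    then show ?case using assms Suc by simp
  qed
  have "\<not> int p dvd k" using assms k ker by auto
  then have "coprime k (int p)" using prime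
    by (metis coprime_commute prime_imp_coprime prime_nat_int_transfer)
  then obtain l where l: "[k * l = 1] (mod int p)" using cong_solve_coprime_int by blast
  have "\<iota> b \<in> X" for b
  proof -
    define j where "j = nat ((l * (b - a)) mod int p)"
    have "int j = (l * (b - a)) mod int p" using p_pos by (simp add: j_def)
    then have "[int j = l * (b - a)] (mod int p)" by (simp add: cong_def)
    then have "[int j * k = l * (b - a) * k] (mod int p)" by (rule cong_scalar_right)
    moreover have "[(k * l) * (b - a) = 1 * (b - a)] (mod int p)"
      using l by (rule cong_scalar_right)
    ultimately have "[int j * k = b - a] (mod int p)"
      by (metis (no_types, opaque_lifting) cong_trans mult.assoc mult.commute mult_1)
    then have "int p dvd (a + int j * k) - b"
      by (simp add: cong_iff_dvd_diff algebra_simps)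
    then show ?thesis using step[of j] hom_eq_iff by metis
  qed
  then show ?thesis using assms(1) by (auto elim!: H_cases)
qed

lemma sum_shift_H:
  assumes "e \<in> H" shows "(\<Sum>z\<in>H. f (z - e)) = (\<Sum>z\<in>H. f z)"
  by (rule sum.reindex_bij_betw, rule bij_betwI[where g = "\<lambda>z. z + e"])
     (use assms in \<open>auto intro: H_add H_diff\<close>)

text \<open>Otherwise every translate of \<open>X\<close> that meets \<open>Y\<close> contains
  \<open>Y\<close>. For distinct \<open>y\<close>, \<open>y'\<close> in \<open>Y\<close> the
  translate taking \<open>x\<close> to \<open>y\<close> then contains \<open>y'\<close>, so
  \<open>X\<close> is stable under \<open>y' - y\<close> and fills the group.\<close>

lemma ex_proper_shift_overlap:
  assumes "X \<subseteq> H" "X \<noteq> {}" "X \<noteq> H" "Y \<subseteq> H" "card Y \<ge> 2"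
  shows "\<exists>e\<in>H. (\<lambda>x. x + e) ` X \<inter> Y \<noteq> {} \<and> (\<lambda>x. x + e) ` X \<inter> Y \<noteq> Y"
proof (rule ccontr)
  assume "\<not> ?thesis"
  then have *: "Y \<subseteq> (\<lambda>x. x + e) ` X" if "e \<in> H" "(\<lambda>x. x + e) ` X \<inter> Y \<noteq> {}" for e
    using that by blast
  obtain y y' where y: "y \<in> Y" "y' \<in> Y" "y \<noteq> y'"
    using assms(5) by (metis card_le_Suc0_iff_eq card.infinite not_less_eq_eq numeral_2_eq_2 zero_le)
  have "x + (y' - y) \<in> X" if "x \<in> X" for x
  proof -
    have "y - x \<in> H" using y that assms by (auto intro: H_diff)
    moreover have "y \<in> (\<lambda>z. z + (y - x)) ` X" using that by (auto intro!: image_eqI[of _ _ x])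
    ultimately have "y' \<in> (\<lambda>z. z + (y - x)) ` X" using * y by blast
    then obtain z where "z \<in> X" "y' = z + (y - x)" by auto
    then show ?thesis by (simp add: algebra_simps)
  qed
  moreover have "y' - y \<in> H" using y assms by (auto intro: H_diff)
  ultimately show False using shift_stable_eq_H[of X "y' - y"] y assms by auto
qed

lemma sum_rep_count_H:
  assumes "X \<subseteq> H" "Y \<subseteq> H" shows "(\<Sum>z\<in>H. rep_count X Y z) = card X * card Y"
proof -
  have "(\<Sum>z\<in>H. rep_count X Y z) = (\<Sum>x\<in>X. card {y \<in> Y. x + y \<in> H})"
    using assms by (intro sum_rep_count finite_subset_H finite_H)
  also have "\<dots> = (\<Sum>x\<in>X. card Y)"
    by (intro sum.cong refl arg_cong[of _ _ card]) (use assms in \<open>auto intro: H_add\<close>)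
  finally show ?thesis by simp
qed

text \<open>Induction on the size of \<open>Y\<close>. A translate \<open>Z\<close> of
  \<open>X\<close> meeting \<open>Y\<close> in a proper nonempty part of size \<open>s\<close>
  splits the representations into those by \<open>Z \<union> Y\<close> and
  \<open>Z \<inter> Y\<close> and those by the two differences. If \<open>t \<le> s\<close>, the
  first pair alone suffices; otherwise the cap \<open>t\<close> is shared out as \<open>s\<close>
  and \<open>t - s\<close>.\<close>

theorem pollard:
  assumes "X \<subseteq> H" "Y \<subseteq> H" "t \<le> card X" "t \<le> card Y" "card X + card Y \<le> p + t"
  shows "t * (card X + card Y - t) \<le> (\<Sum>z\<in>H. min t (rep_count X Y z))"
  using assms
proof (induction "card Y" arbitrary: X Y t rule: less_induct)
  case less
  note fin = finite_subset_H[OF less.prems(1)] finite_subset_H[OF less.prems(2)]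
  show ?case
  proof (cases "card Y = t")
    case True
    have "(\<Sum>z\<in>H. min t (rep_count X Y z)) = (\<Sum>z\<in>H. rep_count X Y z)"
      using rep_count_le(2)[OF fin] True by (intro sum.cong) (auto simp: min_def le_antisym)
    also have "\<dots> = card X * card Y" using less.prems by (intro sum_rep_count_H)
    finally show ?thesis using True by simp
  next
    case False
    show ?thesis
    proof (cases "t = 0")
      case True then show ?thesis by simp
    next
      case t: False
      have "card X < p" using less.prems False by linarith
      then have 1: "X \<noteq> H" by auto
      have 2: "X \<noteq> {}" using less.prems t by auto
      have 3: "card Y \<ge> 2" using False t less.prems by linarith
      obtain e where e: "e \<in> H" "(\<lambda>x. x + e) ` X \<inter> Y \<noteq> {}" "(\<lambda>x. x + e) ` X \<inter> Y \<noteq> Y"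
        using ex_proper_shift_overlap[OF less.prems(1) 2 1 less.prems(2) 3] by blast
      define Z where "Z = (\<lambda>x. x + e) ` X"
      have cZ: "card Z = card X" unfolding Z_def by (intro card_image) (auto simp: inj_on_def)
      have ZH: "Z \<subseteq> H" using e less.prems unfolding Z_def by (auto intro!: H_add)
      note finZ = finite_subset_H[OF ZH]
      have "(\<Sum>z\<in>H. min t (rep_count X Y z)) = (\<Sum>z\<in>H. min t (rep_count X Y (z - e)))"
        by (rule sum_shift_H[OF e(1), of "\<lambda>z. min t (rep_count X Y z)", symmetric])
      also have "\<dots> = (\<Sum>z\<in>H. min t (rep_count Z Y z))"
        unfolding Z_def rep_count_shift ..
      finally have shift: "(\<Sum>z\<in>H. min t (rep_count X Y z)) = (\<Sum>z\<in>H. min t (rep_count Z Y z))" .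
      define I U where "I = Z \<inter> Y" and "U = Z \<union> Y"
      define s where "s = card I"
      have s: "0 < s" "s < card Y"
        unfolding s_def I_def using e fin by (auto simp: card_gt_0_iff Z_def intro!: psubset_card_mono)
      have UI: "card U + card I = card X + card Y"
        unfolding U_def I_def using card_Un_Int[OF finZ fin(2)] cZ by simp
      have sub: "U \<subseteq> H" "I \<subseteq> H" "Z - Y \<subseteq> H" "Y - Z \<subseteq> H"
        using ZH less.prems by (auto simp: U_def I_def)
      have rep: "rep_count Z Y z = rep_count (Z - Y) (Y - Z) z + rep_count U I z" for z
        unfolding U_def I_def by (rule rep_count_Int_Un[OF finZ fin(2)])
      show ?thesis
      proof (cases "t \<le> s")
        case True
        have "t * (card U + card I - t) \<le> (\<Sum>z\<in>H. min t (rep_count U I z))"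
          using less.hyps[of I U t] s sub True UI less.prems by (auto simp: s_def)
        also have "\<dots> \<le> (\<Sum>z\<in>H. min t (rep_count Z Y z))"
          by (intro sum_mono) (auto simp: rep)
        finally show ?thesis using UI shift by simp
      next
        case False
        have c1: "card (Z - Y) = card X - s"
          using card_Diff_subset_Int[of Z Y] finZ cZ by (simp add: s_def I_def)
        have c2: "card (Y - Z) = card Y - s"
          using card_Diff_subset_Int[of Y Z] fin by (simp add: s_def I_def Int_commute)
        have "(t - s) * (card (Z - Y) + card (Y - Z) - (t - s))
            \<le> (\<Sum>z\<in>H. min (t - s) (rep_count (Z - Y) (Y - Z) z))"
          using s False less.prems by (intro less.hyps sub) (auto simp: c1 c2)
        \<comment> \<open>\<open>I\<close> has only \<open>s\<close> elements, so the cap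
          \<open>s\<close> never bites and the exact total is available.\<close>
        moreover have "s * (card U + card I - s) = (\<Sum>z\<in>H. min s (rep_count U I z))"
        proof -
          have "(\<Sum>z\<in>H. min s (rep_count U I z)) = (\<Sum>z\<in>H. rep_count U I z)"
            using rep_count_le(2)[of U I] sub finite_subset_H
            by (intro sum.cong) (auto simp: s_def)
          then show ?thesis using sum_rep_count_H[of U I] sub by (simp add: s_def)
        qed
        ultimately have "(t - s) * (card (Z - Y) + card (Y - Z) - (t - s)) + s * (card U + card I - s)
            \<le> (\<Sum>z\<in>H. min (t - s) (rep_count (Z - Y) (Y - Z) z) + min s (rep_count U I z))"
          by (simp add: sum.distrib)
        also have "\<dots> \<le> (\<Sum>z\<in>H. min t (rep_count Z Y z))"
          using False by (intro sum_mono) (auto simp: rep)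
        finally have main: "(t - s) * (card (Z - Y) + card (Y - Z) - (t - s)) + s * (card U + card I - s)
            \<le> (\<Sum>z\<in>H. min t (rep_count X Y z))" using shift by simp
        obtain x where x: "card X = t + x" using less.prems le_Suc_ex by blast
        obtain y where y: "card Y = t + y" using less.prems le_Suc_ex by blast
        obtain r where r: "t = s + r" using False le_Suc_ex[of s t] by auto
        have "(t - s) * (card (Z - Y) + card (Y - Z) - (t - s)) + s * (card U + card I - s)
          = t * (card X + card Y - t)"
          unfolding c1 c2 UI x y r by (simp add: algebra_simps)
        then show ?thesis using main by simp
      qed
    qed
  qed
qed

theorem cauchy_davenport:
  assumes "X \<subseteq> H" "Y \<subseteq> H" "X \<noteq> {}" "Y \<noteq> {}"
  shows "min p (card X + card Y - 1) \<le> card {x + y | x y. x \<in> X \<and> y \<in> Y}" (is "_ \<le> card ?S")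
proof -
  have *: "min p (card X + card Y - 1) \<le> card {x + y | x y. x \<in> X \<and> y \<in> Y}" if "X \<subseteq> H" "Y \<subseteq> H" "X \<noteq> {}" "Y \<noteq> {}"
    "card X + card Y \<le> p + 1" for X Y
  proof -
    let ?S = "{x + y | x y. x \<in> X \<and> y \<in> Y}"
    note fin = finite_subset_H[OF that(1)] finite_subset_H[OF that(2)]
    have pos: "1 \<le> card X" "1 \<le> card Y"
      using that fin by (auto simp: Suc_le_eq card_gt_0_iff)
    have "card X + card Y - 1 \<le> (\<Sum>z\<in>H. min 1 (rep_count X Y z))"
      using pollard[of X Y 1] that pos by simp
    also have "\<dots> \<le> (\<Sum>z\<in>H. if z \<in> ?S then 1 else 0)"
    proof (rule sum_mono)
      fix z
      show "min 1 (rep_count X Y z) \<le> (if z \<in> ?S then 1 else 0)"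
      proof (cases "z \<in> ?S")
        case False
        have "{x \<in> X. z - x \<in> Y} = {}"
        proof (rule ccontr)
          assume "{x \<in> X. z - x \<in> Y} \<noteq> {}"
          then obtain x where "x \<in> X" "z - x \<in> Y" "z = x + (z - x)" by auto
          then show False using False by blast
        qed
        then show ?thesis unfolding rep_count_def by (simp del: Collect_empty_eq)
      qed simp
    qed
    also have "\<dots> = card (H \<inter> ?S)" by (simp add: sum.If_cases)
    also have "H \<inter> ?S = ?S" using that by (auto intro: H_add)
    finally show ?thesis by linarith
  qed
  show ?thesis
  proof (cases "card X + card Y \<le> p + 1")
    case True then show ?thesis using * assms by blast
  next
    case False
    note fin = finite_subset_H[OF assms(1)] finite_subset_H[OF assms(2)]
    \<comment> \<open>Shrinking \<open>Y\<close> to this size is the borderline at which the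
      inequality already yields the whole group.\<close>
    have "p + 1 - card X \<le> card Y" "1 \<le> p + 1 - card X" using False card_le_p[OF assms(1)] by auto
    then obtain Y' where Y': "Y' \<subseteq> Y" "card Y' = p + 1 - card X"
      using obtain_subset_with_card_n by metis
    then have "Y' \<noteq> {}" using \<open>1 \<le> p + 1 - card X\<close> by auto
    have "p = min p (card X + card Y' - 1)" using Y' card_le_p[OF assms(1)] by simp
    also have "\<dots> \<le> card {x + y | x y. x \<in> X \<and> y \<in> Y'}"
      using Y' assms \<open>Y' \<noteq> {}\<close> card_le_p[OF assms(1)] by (intro *) auto
    also have "\<dots> \<le> card ?S"
    proof (rule card_mono)
      show "finite ?S" by (rule finite_subset_H) (use assms in \<open>auto intro: H_add\<close>)
    qed (use Y' in blast)
    finally show ?thesis by simp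
  qed
qed

text \<open>In Pollard's sum every element of \<open>S\<close> contributes at most \<open>t\<close>,
  and the elements outside \<open>S\<close> together contribute at most the number of exceptional
  pairs, \<open>card X * E\<close>. After division by \<open>t\<close> the latter is a small
  error.\<close>

lemma robust_cauchy_davenport:
  assumes "X \<subseteq> H" "Y \<subseteq> H" "S \<subseteq> H" "t \<le> card X" "t \<le> card Y" "card X + card Y \<le> p + t"
    and esc: "\<And>x. x \<in> X \<Longrightarrow> real (card {y \<in> Y. x + y \<notin> S}) \<le> E"
  shows "real t * (real (card X) + real (card Y) - real t) \<le> real t * real (card S) + real (card X) * E"
proof -
  note fin = finite_subset_H[OF assms(1)] finite_subset_H[OF assms(2)] finite_subset_H[OF assms(3)]
  have "real t * (real (card X) + real (card Y) - real t) = real (t * (card X + card Y - t))"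
    using assms(4) by simp
  also have "\<dots> \<le> real (\<Sum>z\<in>H. min t (rep_count X Y z))"
    using pollard[OF assms(1,2,4-6)] by (simp only: of_nat_le_iff)
  also have "H = S \<union> (H - S)" using assms by auto
  also have "(\<Sum>z\<in>S \<union> (H - S). min t (rep_count X Y z))
      = (\<Sum>z\<in>S. min t (rep_count X Y z)) + (\<Sum>z\<in>H - S. min t (rep_count X Y z))"
    using fin by (intro sum.union_disjoint) auto
  also have "real \<dots> \<le> real ((\<Sum>z\<in>S. t) + (\<Sum>z\<in>H - S. rep_count X Y z))"
    by (intro of_nat_mono add_mono sum_mono) auto
  also have "(\<Sum>z\<in>H - S. rep_count X Y z) = (\<Sum>x\<in>X. card {y \<in> Y. x + y \<in> H - S})"
    using fin by (intro sum_rep_count) auto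
  also have "real ((\<Sum>z\<in>S. t) + \<dots>) = real t * real (card S) + (\<Sum>x\<in>X. real (card {y \<in> Y. x + y \<in> H - S}))"
    by simp
  also have "(\<Sum>x\<in>X. real (card {y \<in> Y. x + y \<in> H - S})) \<le> (\<Sum>x\<in>X. E)"
  proof (rule sum_mono)
    fix x assume "x \<in> X"
    have "card {y \<in> Y. x + y \<in> H - S} \<le> card {y \<in> Y. x + y \<notin> S}"
      using fin by (intro card_mono) auto
    then show "real (card {y \<in> Y. x + y \<in> H - S}) \<le> E" using esc[OF \<open>x \<in> X\<close>] by linarith
  qed
  finally show ?thesis by simp
qed

end

section \<open>Small critical sets\<close>

lemma sum_squared_le_card_mult:
  fixes f :: "'a \<Rightarrow> real"
  assumes "finite S" shows "(\<Sum>x\<in>S. f x)\<^sup>2 \<le> real (card S) * (\<Sum>x\<in>S. (f x)\<^sup>2)"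
proof (cases "S = {}")
  case False
  let ?c = "real (card S)" and ?F = "\<Sum>x\<in>S. f x" and ?Q = "\<Sum>x\<in>S. (f x)\<^sup>2"
  have c: "?c > 0" using False assms by (simp add: card_gt_0_iff)
  have "0 \<le> (\<Sum>x\<in>S. (?c * f x - ?F)\<^sup>2)" by (intro sum_nonneg) auto
  also have "\<dots> = (\<Sum>x\<in>S. ?c\<^sup>2 * (f x)\<^sup>2 - 2 * ?c * ?F * f x + ?F\<^sup>2)"
    by (intro sum.cong refl) (simp add: power2_eq_square algebra_simps)
  also have "\<dots> = ?c\<^sup>2 * ?Q - 2 * ?c * ?F * ?F + ?c * ?F\<^sup>2"
    by (simp add: sum.distrib sum_subtractf sum_distrib_left[symmetric])
  also have "\<dots> = ?c * (?c * ?Q - ?F\<^sup>2)" by (simp add: power2_eq_square algebra_simps)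
  finally show ?thesis using c by (simp add: zero_le_mult_iff)
qed simp

text \<open>Here \<open>S\<close> stands in for \<open>X + A\<close>: up to errors \<open>\<epsilon> |A|\<close>, equality holds in the Cauchy-Davenport
  inequality for \<open>X\<close> and \<open>A\<close>.\<close>

definition critical :: "'a::ab_group_add set \<Rightarrow> 'a set \<Rightarrow> 'a set \<Rightarrow> real \<Rightarrow> bool" where
  "critical A X S \<epsilon> \<longleftrightarrow>
    (\<forall>x\<in>X. real (card {a \<in> A. x + a \<notin> S}) \<le> \<epsilon> * real (card A)) \<and>
    real (card S) \<le> real (card A) + real (card X) + \<epsilon> * real (card A)"

lemma critical_mono: "critical A X S \<epsilon> \<Longrightarrow> \<epsilon> \<le> \<epsilon>' \<Longrightarrow> critical A X S \<epsilon>'"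
  unfolding critical_def by (meson add_left_mono mult_right_mono of_nat_0_le_iff order_trans)

context prime_cyclic
begin

text \<open>The additive energy in two forms: a coincidence \<open>x + y = x' + y'\<close> is the
  same as an equality of differences \<open>x' - x = y - y'\<close>.\<close>

lemma sum_rep_count_squared:
  assumes "X \<subseteq> H" "Y \<subseteq> H"
  shows "(\<Sum>z\<in>H. (rep_count X Y z)\<^sup>2) = (\<Sum>e\<in>H. autocorr X e * autocorr Y e)"
proof -
  note fin = finite_subset_H[OF assms(1)] finite_subset_H[OF assms(2)]
  have "(\<Sum>z\<in>H. (rep_count X Y z)\<^sup>2) = (\<Sum>z\<in>H. card ({x\<in>X. z - x \<in> Y} \<times> {x\<in>X. z - x \<in> Y}))"
    by (simp add: rep_count_def power2_eq_square card_cartesian_product)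
  also have "\<dots> = card (SIGMA z:H. {x\<in>X. z - x \<in> Y} \<times> {x\<in>X. z - x \<in> Y})"
    using fin by (intro sum_card_eq_card_Sigma) auto
  also have "\<dots> = card (SIGMA e:H. {x\<in>X. x + e \<in> X} \<times> {y\<in>Y. y + e \<in> Y})"
  proof (rule bij_betw_same_card, rule bij_betwI)
    show "(\<lambda>(z, x, x'). (x' - x, x, z - x')) \<in> (SIGMA z:H. {x\<in>X. z - x \<in> Y} \<times> {x\<in>X. z - x \<in> Y})
        \<rightarrow> (SIGMA e:H. {x\<in>X. x + e \<in> X} \<times> {y\<in>Y. y + e \<in> Y})"
      using assms by (auto intro: H_diff)
    show "(\<lambda>(e, x, y). (x + e + y, x, x + e)) \<in> (SIGMA e:H. {x\<in>X. x + e \<in> X} \<times> {y\<in>Y. y + e \<in> Y})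
        \<rightarrow> (SIGMA z:H. {x\<in>X. z - x \<in> Y} \<times> {x\<in>X. z - x \<in> Y})"
      using assms by (auto intro!: H_add simp: algebra_simps)
  qed auto
  also have "\<dots> = (\<Sum>e\<in>H. card ({x\<in>X. x + e \<in> X} \<times> {y\<in>Y. y + e \<in> Y}))"
    using fin by (intro sum_card_eq_card_Sigma[symmetric]) auto
  finally show ?thesis by (simp add: autocorr_def card_cartesian_product)
qed

lemma sum_autocorr:
  assumes "X \<subseteq> H" shows "(\<Sum>e\<in>H. autocorr X e) = (card X)\<^sup>2"
proof -
  note fin = finite_subset_H[OF assms]
  have "(\<Sum>e\<in>H. autocorr X e) = card (SIGMA e:H. {x\<in>X. x + e \<in> X})"
    unfolding autocorr_def using fin by (intro sum_card_eq_card_Sigma) auto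
  also have "\<dots> = card (X \<times> X)"
    by (rule bij_betw_same_card[of "\<lambda>(e, x). (x, x + e)"],
        rule bij_betwI[where g = "\<lambda>(x, y). (y - x, x)"]) (use assms in \<open>auto intro: H_diff\<close>)
  finally show ?thesis by (simp add: card_cartesian_product power2_eq_square)
qed

text \<open>If most sums fall into a small set \<open>S\<close>, Cauchy-Schwarz makes the energy
  large. The shift 0 accounts for only \<open>card X * card Y\<close> of it, and the other shifts
  for at most the maximum of \<open>autocorr X\<close> off 0 times the square of
  \<open>card Y\<close>, so that maximum is large.\<close>

lemma ex_large_autocorr:
  assumes "X \<subseteq> H" "Y \<subseteq> H" "S \<subseteq> H" "Y \<noteq> {}" "\<epsilon> \<le> 1"
    and pop: "(1 - \<epsilon>) * real (card X) * real (card Y) \<le> real (\<Sum>z\<in>S. rep_count X Y z)"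
  shows "\<exists>e\<in>H. e \<noteq> 0 \<and> (1 - \<epsilon>)\<^sup>2 * (real (card X))\<^sup>2 * real (card Y)
    \<le> real (card S) * (real (card X) + real (card Y) * real (autocorr X e))"
proof -
  note fin = finite_subset_H[OF assms(1)] finite_subset_H[OF assms(2)] finite_subset_H[OF assms(3)]
  let ?x = "real (card X)" and ?y = "real (card Y)"
  have y: "?y > 0" using assms fin by (simp add: card_gt_0_iff)
  have "\<iota> 1 \<noteq> 0" using ker prime by (simp add: prime_nat_iff)
  then have ne: "H - {0} \<noteq> {}" using hom_in_H[of 1] by blast
  define M where "M = Max (autocorr X ` (H - {0}))"
  have "M \<in> autocorr X ` (H - {0})" unfolding M_def using ne by (intro Max_in) auto
  then obtain e where e: "e \<in> H" "e \<noteq> 0" "autocorr X e = M" by auto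
  have M: "autocorr X f \<le> M" if "f \<in> H" "f \<noteq> 0" for f
    unfolding M_def using that by (intro Max_ge) auto
  have "((1 - \<epsilon>) * ?x * ?y)\<^sup>2 \<le> (real (\<Sum>z\<in>S. rep_count X Y z))\<^sup>2"
    using pop assms(5) by (intro power_mono) auto
  also have "\<dots> = (\<Sum>z\<in>S. real (rep_count X Y z))\<^sup>2" by simp
  also have "\<dots> \<le> real (card S) * (\<Sum>z\<in>S. (real (rep_count X Y z))\<^sup>2)"
    by (rule sum_squared_le_card_mult) (use fin in auto)
  also have "\<dots> \<le> real (card S) * (?y * (?x + ?y * real M))"
  proof (rule mult_left_mono)
    have "(\<Sum>e\<in>H. autocorr X e * autocorr Y e)
        = autocorr X 0 * autocorr Y 0 + (\<Sum>e\<in>H - {0}. autocorr X e * autocorr Y e)"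
      using H_0 by (intro sum.remove) auto
    also have "\<dots> \<le> card X * card Y + (\<Sum>e\<in>H - {0}. M * autocorr Y e)"
      by (intro add_mono sum_mono mult_right_mono M) (auto simp: autocorr_def)
    also have "\<dots> \<le> card X * card Y + M * (\<Sum>e\<in>H. autocorr Y e)"
      unfolding sum_distrib_left by (intro add_left_mono sum_mono2) auto
    also have "(\<Sum>e\<in>H. autocorr Y e) = (card Y)\<^sup>2" using assms by (intro sum_autocorr)
    finally have nat: "(\<Sum>e\<in>H. autocorr X e * autocorr Y e) \<le> card X * card Y + M * (card Y)\<^sup>2" .
    have "(\<Sum>z\<in>S. (real (rep_count X Y z))\<^sup>2) \<le> (\<Sum>z\<in>H. (real (rep_count X Y z))\<^sup>2)"
      using assms by (intro sum_mono2) auto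
    also have "\<dots> = real (\<Sum>z\<in>H. (rep_count X Y z)\<^sup>2)" by simp
    also have "\<dots> = real (\<Sum>e\<in>H. autocorr X e * autocorr Y e)"
      using sum_rep_count_squared assms by simp
    also have "\<dots> \<le> real (card X * card Y + M * (card Y)\<^sup>2)" using nat by (simp only: of_nat_le_iff)
    also have "\<dots> = ?y * (?x + ?y * real M)" by (simp add: power2_eq_square algebra_simps)
    finally show "(\<Sum>z\<in>S. (real (rep_count X Y z))\<^sup>2) \<le> ?y * (?x + ?y * real M)" .
  qed simp
  finally have "?y * ((1 - \<epsilon>)\<^sup>2 * ?x\<^sup>2 * ?y) \<le> ?y * (real (card S) * (?x + ?y * real M))"
    by (simp add: power2_eq_square algebra_simps)
  then have "(1 - \<epsilon>)\<^sup>2 * ?x\<^sup>2 * ?y \<le> real (card S) * (?x + ?y * real M)"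
    using y by (simp only: mult_le_cancel_left_pos)
  then show ?thesis using e by auto
qed

text \<open>By subadditivity, adding \<open>e\<close> cannot carry \<open>escape X\<close> from
  below \<open>s\<close> past \<open>2 * s\<close>. If no value lies in between, every shift has
  value below \<open>s\<close>; then more than half of \<open>X\<close> returns under every shift,
  against the total of \<open>autocorr X\<close> over the group.\<close>

lemma ex_moderate_escape:
  assumes "X \<subseteq> H" "e \<in> H" "e \<noteq> 0" "escape X e < s" "2 * s \<le> card X" "2 * card X \<le> p"
  shows "\<exists>f\<in>H. s \<le> escape X f \<and> escape X f < 2 * s"
proof (rule ccontr)
  assume contra: "\<not> ?thesis"
  note fin = finite_subset_H[OF assms(1)]
  let ?N = "{f \<in> H. escape X f < s}"
  have "f + e \<in> ?N" if "f \<in> ?N" for f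
  proof -
    have "escape X (f + e) < 2 * s" using escape_add[OF fin, of f e] that assms by auto
    moreover have "f + e \<in> H" using that assms by (auto intro: H_add)
    ultimately show ?thesis using contra by (auto simp: not_le)
  qed
  moreover have "0 \<in> ?N" using assms H_0 by auto
  ultimately have "?N = H" using assms by (intro shift_stable_eq_H[where e = e]) auto
  then have small: "escape X f < s" if "f \<in> H" for f using that by blast
  have "p * (card X - s + 1) = (\<Sum>f\<in>H. card X - s + 1)" by simp
  also have "\<dots> \<le> (\<Sum>f\<in>H. autocorr X f)"
  proof (rule sum_mono)
    fix f assume "f \<in> H"
    then show "card X - s + 1 \<le> autocorr X f"
      using small[of f] autocorr_add_escape[OF fin, of f] assms by linarith
  qed
  also have "\<dots> = card X * card X" using sum_autocorr[OF assms(1)] by (simp add: power2_eq_square)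
  finally have 1: "p * (card X - s + 1) \<le> card X * card X" .
  have "card X * card X < (2 * card X) * (card X - s + 1)"
  proof -
    obtain d where "card X = 2 * s + d" using assms le_Suc_ex by blast
    then have "card X < 2 * (card X - s + 1)" "0 < card X" using assms(4) by auto
    then have "card X * card X < card X * (2 * (card X - s + 1))" by (intro mult_strict_left_mono)
    then show ?thesis by (simp only: mult.assoc mult.left_commute)
  qed
  also have "\<dots> \<le> p * (card X - s + 1)" using assms by (intro mult_right_mono) auto
  finally show False using 1 by simp
qed

text \<open>Applied to \<open>X \<union> (X - e)\<close>, the robust Cauchy-Davenport inequality bounds \<open>S \<union> (S - e)\<close> from below,
  hence \<open>S \<inter> (S - e)\<close> from above.\<close>

lemma critical_shift_step:
  assumes A: "A \<subseteq> H" and X: "X \<subseteq> H" and S: "S \<subseteq> H" and crit: "critical A X S \<epsilon>"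
    and eps: "0 < \<epsilon>" "\<epsilon> \<le> 1" "1 \<le> sqrt \<epsilon> * real (card A)" "2 * sqrt \<epsilon> * real (card A) \<le> real (card X)"
    and XA: "card X \<le> card A" and e: "e \<in> H" "escape X e + card X + card A \<le> p"
  shows "critical A {x \<in> X. x + e \<in> X} {s \<in> S. s + e \<in> S} (6 * sqrt \<epsilon>)"
proof -
  note fin = finite_subset_H[OF A] finite_subset_H[OF X] finite_subset_H[OF S]
  define sh where "sh = (\<lambda>Z. (\<lambda>z. z - e) ` Z)"
  have sh: "z \<in> sh Z \<longleftrightarrow> z + e \<in> Z" for z Z unfolding sh_def
    by (metis (no_types, lifting) add_diff_cancel diff_add_cancel image_iff)
  have csh: "card (sh Z) = card Z" for Z unfolding sh_def by (intro card_image) (auto simp: inj_on_def)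
  have finsh: "finite Z \<Longrightarrow> finite (sh Z)" for Z unfolding sh_def by simp
  let ?n = "real (card A)" and ?x = "real (card X)"
  define X1 S1 X2 S2 where "X1 = {x \<in> X. x + e \<in> X}" and "S1 = {s \<in> S. s + e \<in> S}"
    and "X2 = X \<union> sh X" and "S2 = S \<union> sh S"
  have X1: "X1 = X \<inter> sh X" and S1: "S1 = S \<inter> sh S" by (auto simp: X1_def S1_def sh)
  have cX: "card X2 + card X1 = 2 * card X"
    unfolding X1 X2_def using card_Un_Int[of X "sh X"] fin finsh csh by simp
  have cS: "card S2 + card S1 = 2 * card S"
    unfolding S1 S2_def using card_Un_Int[of S "sh S"] fin finsh csh by simp
  have cX1: "card X1 = autocorr X e" by (simp add: X1_def autocorr_def)
  have sub: "X2 \<subseteq> H" "S2 \<subseteq> H"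
    using X S e by (auto simp: X2_def S2_def sh_def intro: H_diff)
  have esc: "real (card {a \<in> A. x + a \<notin> S}) \<le> \<epsilon> * ?n" if "x \<in> X" for x
    using crit that by (auto simp: critical_def)
  \<comment> \<open>This \<open>t\<close> balances the two errors in Pollard's bound,
    \<open>t\<close> itself and \<open>card X2 * \<epsilon> * ?n / t\<close>: both become
    \<open>O(sqrt \<epsilon> * ?n)\<close>.\<close>
  define t where "t = nat \<lceil>sqrt \<epsilon> * ?n\<rceil>"
  have t1: "sqrt \<epsilon> * ?n \<le> real t" unfolding t_def by linarith
  have t2: "real t \<le> 2 * sqrt \<epsilon> * ?n" unfolding t_def using eps by linarith
  have tpos: "real t > 0" using t1 eps by linarith
  have tx: "t \<le> card X" using t2 eps by linarith
  have X2ge: "card X \<le> card X2" unfolding X2_def using fin finsh by (intro card_mono) auto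
  have "real t * (real (card X2) + ?n - real t) \<le> real t * real (card S2) + real (card X2) * (\<epsilon> * ?n)"
  proof (rule robust_cauchy_davenport[OF sub(1) A sub(2)])
    show "t \<le> card X2" using tx X2ge by simp
    show "t \<le> card A" using tx XA by simp
    show "card X2 + card A \<le> p + t" using e cX cX1 autocorr_add_escape[OF fin(2), of e] by linarith
    fix x assume "x \<in> X2"
    then consider "x \<in> X" | "x + e \<in> X" by (auto simp: X2_def sh)
    then show "real (card {a \<in> A. x + a \<notin> S2}) \<le> \<epsilon> * ?n"
    proof cases
      case 1
      have "card {a \<in> A. x + a \<notin> S2} \<le> card {a \<in> A. x + a \<notin> S}"
        using fin by (intro card_mono) (auto simp: S2_def)
      then show ?thesis using esc[OF 1] by linarith
    next
      case 2
      have "card {a \<in> A. x + a \<notin> S2} \<le> card {a \<in> A. x + e + a \<notin> S}"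
        using fin by (intro card_mono) (auto simp: S2_def sh algebra_simps)
      then show ?thesis using esc[OF 2] by linarith
    qed
  qed
  moreover have "real (card X2) * (\<epsilon> * ?n) \<le> real t * (2 * sqrt \<epsilon> * ?n)"
  proof -
    have "real (card X2) * (\<epsilon> * ?n) \<le> (2 * ?n) * (\<epsilon> * ?n)"
      using cX XA eps by (intro mult_right_mono) auto
    also have "\<dots> = (sqrt \<epsilon> * ?n) * (2 * sqrt \<epsilon> * ?n)"
    proof -
      have "sqrt \<epsilon> * sqrt \<epsilon> = \<epsilon>" using eps by simp
      then have "2 * ?n * (\<epsilon> * ?n) = 2 * ?n * ((sqrt \<epsilon> * sqrt \<epsilon>) * ?n)" by (simp only:)
      then show ?thesis by (simp only: mult.assoc mult.left_commute mult.commute)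
    qed
    also have "\<dots> \<le> real t * (2 * sqrt \<epsilon> * ?n)" using t1 eps by (intro mult_right_mono) auto
    finally show ?thesis .
  qed
  ultimately have "real t * (real (card X2) + ?n - real t) \<le> real t * (real (card S2) + 2 * sqrt \<epsilon> * ?n)"
    by (simp add: algebra_simps)
  then have S2: "real (card X2) + ?n - real t \<le> real (card S2) + 2 * sqrt \<epsilon> * ?n"
    using tpos by (simp only: mult_le_cancel_left_pos)
  have "\<epsilon> \<le> sqrt \<epsilon>" using eps by (intro real_le_rsqrt) (simp add: power2_eq_square mult_left_le)
  then have eps': "\<epsilon> * ?n \<le> sqrt \<epsilon> * ?n" by (intro mult_right_mono) auto
  have "real (card S1) = 2 * real (card S) - real (card S2)" "real (card X2) = 2 * ?x - real (card X1)"
    using cS cX by linarith+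
  moreover have "real (card S) \<le> ?n + ?x + \<epsilon> * ?n" using crit by (simp add: critical_def)
  \<comment> \<open>The factor 6 collects \<open>2 * \<epsilon> * ?n\<close> from doubling the bound
    on \<open>S\<close>, \<open>t \<le> 2 * sqrt \<epsilon> * ?n\<close>, and
    \<open>2 * sqrt \<epsilon> * ?n\<close> from the exceptional pairs.\<close>
  ultimately have "real (card S1) \<le> ?n + real (card X1) + 6 * sqrt \<epsilon> * ?n"
    using S2 t2 eps' by linarith
  moreover have "real (card {a \<in> A. x + a \<notin> S1}) \<le> 6 * sqrt \<epsilon> * ?n" if x: "x \<in> X1" for x
  proof -
    have "{a \<in> A. x + a \<notin> S1} \<subseteq> {a \<in> A. x + a \<notin> S} \<union> {a \<in> A. x + e + a \<notin> S}"
      by (auto simp: S1 sh algebra_simps)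
    then have "card {a \<in> A. x + a \<notin> S1} \<le> card {a \<in> A. x + a \<notin> S} + card {a \<in> A. x + e + a \<notin> S}"
      by (intro order_trans[OF card_mono card_Un_le]) (use fin in auto)
    moreover have "real (card {a \<in> A. x + a \<notin> S}) \<le> \<epsilon> * ?n" "real (card {a \<in> A. x + e + a \<notin> S}) \<le> \<epsilon> * ?n"
      using esc x by (auto simp: X1_def)
    moreover have "0 \<le> sqrt \<epsilon> * ?n" using eps by simp
    ultimately show ?thesis using eps' by linarith
  qed
  ultimately show ?thesis unfolding critical_def X1_def[symmetric] S1_def[symmetric] by blast
qed

text \<open>The descent makes two demands on \<open>e\<close>: \<open>X \<inter> (X - e)\<close>
  must keep a fixed proportion of \<open>card A\<close>, and \<open>X \<union> (X - e)\<close>, of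
  size \<open>card X + escape X e\<close>, must fit into the group together with \<open>A\<close> so
  that Pollard's theorem applies. In the first case the 24 is the product of a 4 from
  \<open>(1 - \<epsilon>)\<^sup>2 \<ge> 1 / 4\<close>, a 3 from
  \<open>card S \<le> 3 * card A\<close> and a 2 that absorbs the trivial shift.\<close>

lemma ex_shift_for_descent:
  fixes \<beta> \<kappa> \<epsilon> :: real
  assumes A: "A \<subseteq> H" and X: "X \<subseteq> H" and S: "S \<subseteq> H" and crit: "critical A X S \<epsilon>"
    and \<beta>: "0 < \<beta>" "\<beta> < 1" and \<kappa>: "0 < \<kappa>" "\<kappa> \<le> 1" and \<epsilon>: "0 < \<epsilon>" "\<epsilon> \<le> \<beta> ^ 3 / 2"
    and n: "24 \<le> \<kappa>\<^sup>2 * real (card A)" "12 / \<beta> \<le> \<kappa>\<^sup>2 * real (card A)" "1 / \<beta> \<le> \<beta>\<^sup>2 * real (card A)"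
    and np: "real (card A) \<le> (1 - \<beta>) * real p / 2"
    and x: "\<kappa> * real (card A) < real (card X)" "card X \<le> card A"
  shows "\<exists>e\<in>H. e \<noteq> 0 \<and> \<kappa>\<^sup>2 / 24 * real (card A) \<le> real (autocorr X e)
    \<and> escape X e + card X + card A \<le> p"
proof -
  note fin = finite_subset_H[OF A] finite_subset_H[OF X] finite_subset_H[OF S]
  let ?n = "real (card A)" and ?x = "real (card X)" and ?p = "real p"
  have npos: "?n > 0" using n \<kappa> by (metis mult_zero_right not_less of_nat_0_le_iff order.antisym zero_less_numeral order_less_le_trans)
  have xn: "?x \<le> ?n" using x by simp
  have p1: "2 * ?n + \<beta> * ?p \<le> ?p" using np by (simp add: algebra_simps)
  have "\<beta> * (2 * ?n) \<le> \<beta> * ?p"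
    using p1 \<beta> by (intro mult_left_mono) (use mult_nonneg_nonneg[of \<beta> ?p] in linarith)+
  then have p2: "2 * ?n + 2 * \<beta> * ?n \<le> ?p" using p1 by linarith
  have \<beta>3: "\<beta> ^ 3 \<le> \<beta>" using \<beta> power_decreasing[of 1 3 \<beta>] by simp
  have \<epsilon>1: "\<epsilon> \<le> 1 / 2" "\<epsilon> \<le> \<beta>" using \<epsilon> \<beta> \<beta>3 by linarith+
  have esc: "real (card {a \<in> A. x + a \<notin> S}) \<le> \<epsilon> * ?n" if "x \<in> X" for x
    using crit that by (auto simp: critical_def)
  have cS: "real (card S) \<le> ?n + ?x + \<epsilon> * ?n" using crit by (simp add: critical_def)
  have \<epsilon>n: "\<epsilon> * ?n \<le> \<beta> * ?n" "\<epsilon> * ?n \<le> ?n" using \<epsilon>1 npos by (auto intro: mult_right_mono)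
  have quarter: "1 / 4 * (\<kappa> * ?n)\<^sup>2 \<le> (1 - \<delta>)\<^sup>2 * ?x\<^sup>2" if "\<delta> \<le> 1 / 2" for \<delta>
  proof (rule mult_mono)
    show "1 / 4 \<le> (1 - \<delta>)\<^sup>2" using power_mono[of "1 / 2" "1 - \<delta>" 2] that by (simp add: power2_eq_square)
    show "(\<kappa> * ?n)\<^sup>2 \<le> ?x\<^sup>2" using x \<kappa> by (intro power_mono) auto
  qed auto
  \<comment> \<open>When \<open>p\<close> is large, the additive energy of \<open>X\<close> and \<open>A\<close> gives a popular difference. Otherwise that
    shift may wrap around the group, and the energy of \<open>X\<close> and the complement of \<open>- S\<close> is used instead;
    this pair is critical as well.\<close>
  show ?thesis
  proof (cases "2 * card A + card X \<le> p")
    case True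
    have "(1 - \<epsilon>) * ?x * ?n \<le> real (\<Sum>z\<in>S. rep_count X A z)"
    proof -
      have "(1 - \<epsilon>) * ?x * ?n = (\<Sum>x\<in>X. ?n - \<epsilon> * ?n)" by (simp add: algebra_simps)
      also have "\<dots> \<le> (\<Sum>x\<in>X. real (card {a \<in> A. x + a \<in> S}))"
      proof (rule sum_mono)
        fix x assume x: "x \<in> X"
        have "card A = card ({a \<in> A. x + a \<in> S} \<union> {a \<in> A. x + a \<notin> S})"
          by (rule arg_cong[of _ _ card]) auto
        also have "\<dots> \<le> card {a \<in> A. x + a \<in> S} + card {a \<in> A. x + a \<notin> S}" by (rule card_Un_le)
        finally show "?n - \<epsilon> * ?n \<le> real (card {a \<in> A. x + a \<in> S})" using esc[OF x] by linarith
      qed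
      also have "\<dots> = real (\<Sum>z\<in>S. rep_count X A z)" using sum_rep_count[OF fin(2,1,3)] by simp
      finally show ?thesis .
    qed
    moreover have "A \<noteq> {}" using npos by auto
    moreover have "\<epsilon> \<le> 1" using \<epsilon>1 by simp
    ultimately obtain e where e: "e \<in> H" "e \<noteq> 0"
      "(1 - \<epsilon>)\<^sup>2 * ?x\<^sup>2 * ?n \<le> real (card S) * (?x + ?n * real (autocorr X e))"
      using ex_large_autocorr[OF X A S, of \<epsilon>] by blast
    have "?n * ((1 - \<epsilon>)\<^sup>2 * ?x\<^sup>2) \<le> real (card S) * (?x + ?n * real (autocorr X e))"
      using e(3) by (simp only: mult.commute)
    also have "\<dots> \<le> (3 * ?n) * (?n + ?n * real (autocorr X e))"
      using cS xn \<epsilon>n by (intro mult_mono) auto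
    also have "\<dots> = ?n * (3 * ?n * (1 + real (autocorr X e)))" by (simp add: algebra_simps)
    finally have "(1 - \<epsilon>)\<^sup>2 * ?x\<^sup>2 \<le> 3 * ?n * (1 + real (autocorr X e))"
      using npos by (simp only: mult_le_cancel_left_pos)
    then have "1 / 4 * (\<kappa> * ?n)\<^sup>2 \<le> 3 * ?n * (1 + real (autocorr X e))"
      using quarter[of \<epsilon>] \<epsilon>1 by linarith
    then have "?n * (\<kappa>\<^sup>2 * ?n) \<le> ?n * (12 * (1 + real (autocorr X e)))"
      by (simp add: power2_eq_square algebra_simps)
    then have "\<kappa>\<^sup>2 * ?n \<le> 12 * (1 + real (autocorr X e))"
      using npos by (simp only: mult_le_cancel_left_pos)
    then have "\<kappa>\<^sup>2 / 24 * ?n \<le> real (autocorr X e)" using n by simp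
    moreover have "escape X e + card X + card A \<le> p"
      using True escape_le_card[OF fin(2), of e] x by linarith
    ultimately show ?thesis using e by blast
  next
    case False
    define Y T where "Y = uminus ` (H - S)" and "T = {z \<in> H. - z \<notin> A}"
    have YH: "Y \<subseteq> H" and TH: "T \<subseteq> H" by (auto simp: Y_def T_def intro: H_uminus)
    have "card Y = card (H - S)" unfolding Y_def by (intro card_image) auto
    then have cY: "card Y = p - card S" using S fin by (simp add: card_Diff_subset)
    have "T = H - uminus ` A" unfolding T_def by (auto, metis add.inverse_inverse image_eqI)
    moreover have "uminus ` A \<subseteq> H" using A by (auto intro: H_uminus)
    moreover have "card (uminus ` A) = card A" by (intro card_image) auto
    ultimately have cT: "card T = p - card A" using fin by (simp add: card_Diff_subset)
    define q m where "q = ?p - ?n" and "m = real (card Y)"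
    have q: "real (card T) = q" unfolding cT q_def using p2 npos \<beta>
      by (subst of_nat_diff) (use mult_pos_pos[of \<beta> ?n] in linarith)+
    have m: "\<beta> * ?n \<le> m"
    proof -
      have "real (card S) + \<beta> * ?n \<le> ?p" using cS xn \<epsilon>n p2 by linarith
      moreover have "card S \<le> p" by (rule card_le_p[OF S])
      ultimately show ?thesis unfolding m_def cY by (simp add: of_nat_diff)
    qed
    have mpos: "m > 0" using m npos \<beta> mult_pos_pos[of \<beta> ?n] by linarith
    \<comment> \<open>\<open>Y\<close> has at least \<open>\<beta> * ?n\<close> elements, so the
      error \<open>\<epsilon> * ?n\<close> is at most the proportion \<open>\<delta>\<close> of it;
      the cube in \<open>\<epsilon> \<le> \<beta> ^ 3 / 2\<close> leaves
      \<open>\<delta> \<le> \<beta>\<^sup>2 / 2\<close>.\<close>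
    define \<delta> where "\<delta> = \<epsilon> / \<beta>"
    have "\<epsilon> / \<beta> \<le> (\<beta> ^ 3 / 2) / \<beta>" using \<epsilon> \<beta> by (intro divide_right_mono) auto
    then have \<delta>: "0 < \<delta>" "\<delta> \<le> \<beta>\<^sup>2 / 2" unfolding \<delta>_def using \<beta> \<epsilon> by (auto simp: power3_eq_cube power2_eq_square)
    have "\<beta>\<^sup>2 \<le> 1" using \<beta> by (simp add: power_le_one)
    then have \<delta>1: "\<delta> \<le> 1 / 2" using \<delta> by linarith
    have "\<epsilon> * ?n = \<delta> * (\<beta> * ?n)" using \<beta> by (simp add: \<delta>_def)
    also have "\<dots> \<le> \<delta> * m" using m \<delta> by (intro mult_left_mono) auto
    finally have \<delta>m: "\<epsilon> * ?n \<le> \<delta> * m" .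
    have "(1 - \<delta>) * ?x * real (card Y) \<le> real (\<Sum>z\<in>T. rep_count X Y z)"
    proof -
      have "(1 - \<delta>) * ?x * real (card Y) = (\<Sum>x\<in>X. m - \<delta> * m)" by (simp add: m_def algebra_simps)
      also have "\<dots> \<le> (\<Sum>x\<in>X. real (card {y \<in> Y. x + y \<in> T}))"
      proof (rule sum_mono)
        fix x assume x: "x \<in> X"
        have "card Y = card ({y \<in> Y. x + y \<in> T} \<union> {y \<in> Y. x + y \<notin> T})"
          by (rule arg_cong[of _ _ card]) auto
        also have "\<dots> \<le> card {y \<in> Y. x + y \<in> T} + card {y \<in> Y. x + y \<notin> T}" by (rule card_Un_le)
        \<comment> \<open>A bad \<open>y\<close> for \<open>x\<close> yields a bad
          \<open>a = - (x + y)\<close>: it lies in \<open>A\<close>, while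
          \<open>x + a = - y\<close> lies outside \<open>S\<close>.\<close>
        also have "card {y \<in> Y. x + y \<notin> T} \<le> card {a \<in> A. x + a \<notin> S}"
        proof (rule card_inj_on_le[where f = "\<lambda>y. - (x + y)"])
          show "(\<lambda>y. - (x + y)) ` {y \<in> Y. x + y \<notin> T} \<subseteq> {a \<in> A. x + a \<notin> S}"
          proof safe
            fix y assume y: "y \<in> Y" "x + y \<notin> T"
            then have "x + y \<in> H" using x X YH by (auto intro: H_add)
            then show "- (x + y) \<in> A" using y by (auto simp: T_def)
            show "x + - (x + y) \<in> S \<Longrightarrow> False" using y by (auto simp: Y_def)
          qed
        qed (use fin in \<open>auto simp: inj_on_def\<close>)
        finally have "m \<le> real (card {y \<in> Y. x + y \<in> T}) + real (card {a \<in> A. x + a \<notin> S})"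
          unfolding m_def by linarith
        then show "m - \<delta> * m \<le> real (card {y \<in> Y. x + y \<in> T})" using esc[OF x] \<delta>m by linarith
      qed
      also have "\<dots> = real (\<Sum>z\<in>T. rep_count X Y z)"
        using sum_rep_count[OF fin(2) finite_subset_H[OF YH] finite_subset_H[OF TH]] by simp
      finally show ?thesis .
    qed
    moreover have "Y \<noteq> {}" using mpos unfolding m_def by auto
    ultimately obtain e where e: "e \<in> H" "e \<noteq> 0"
      "(1 - \<delta>)\<^sup>2 * ?x\<^sup>2 * m \<le> q * (?x + m * real (autocorr X e))"
      using ex_large_autocorr[OF X YH TH, of \<delta>] \<delta>1 by (auto simp: q m_def)
    let ?R = "real (autocorr X e)"
    have q1: "q \<le> 2 * ?n" "0 < q" "?x + 2 * \<beta> * ?n \<le> q"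
      using False xn p2 npos \<beta> mult_pos_pos[of \<beta> ?n] unfolding q_def by linarith+
    have main: "(1 - \<delta>)\<^sup>2 * ?x\<^sup>2 / q \<le> 1 / \<beta> + ?R"
    proof -
      have "(1 - \<delta>)\<^sup>2 * ?x\<^sup>2 / q \<le> ?x / m + ?R"
        using e(3) q1 mpos by (simp add: field_simps)
      moreover have "?x / m \<le> ?n / (\<beta> * ?n)"
        using xn m \<beta> npos by (intro frac_le) auto
      ultimately show ?thesis using npos by simp
    qed
    have "\<kappa>\<^sup>2 * ?n / 8 = (1 / 4 * (\<kappa> * ?n)\<^sup>2) / (2 * ?n)"
      using npos by (simp add: power2_eq_square)
    also have "\<dots> \<le> (1 - \<delta>)\<^sup>2 * ?x\<^sup>2 / q"
      using quarter[OF \<delta>1] q1 npos by (intro frac_le) auto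
    finally have R: "\<kappa>\<^sup>2 / 24 * ?n \<le> ?R" using main n by simp
    \<comment> \<open>This says that \<open>X \<union> (X - e)\<close> has at most \<open>q\<close>
      elements. Without errors the energy gives \<open>?R \<ge> ?x\<^sup>2 / q\<close>, and
      \<open>?x - ?x\<^sup>2 / q = ?x * (q - ?x) / q\<close> is below \<open>q - ?x\<close> by at
      least \<open>2 * \<beta>\<^sup>2 * ?n\<close>. This slack pays
      \<open>\<beta>\<^sup>2 * ?n\<close> for \<open>\<delta>\<close> and as much again for
      \<open>1 / \<beta>\<close>.\<close>
    have "?x - ?R \<le> q - ?x"
    proof -
      have "(1 - \<beta>) * q = ?p - \<beta> * ?p - ?n + \<beta> * ?n" unfolding q_def by (simp add: algebra_simps)
      then have "?n \<le> (1 - \<beta>) * q" using p1 \<beta> npos mult_pos_pos[of \<beta> ?n] by linarith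
      then have xq: "?x \<le> (1 - \<beta>) * q" using xn by linarith
      have "?x * (q - ?x) / q \<le> (1 - \<beta>) * (q - ?x)"
      proof -
        have "?x * (q - ?x) \<le> ((1 - \<beta>) * q) * (q - ?x)"
          using xq q1 \<beta> npos mult_pos_pos[of \<beta> ?n] by (intro mult_right_mono) linarith+
        then show ?thesis using q1 by (simp add: field_simps)
      qed
      moreover have "?x * (q - ?x) / q = ?x - ?x\<^sup>2 / q"
        using q1 by (simp add: field_simps power2_eq_square)
      moreover have "(1 - \<beta>) * (q - ?x) \<le> (q - ?x) - 2 * \<beta>\<^sup>2 * ?n"
      proof -
        have "\<beta> * (2 * \<beta> * ?n) \<le> \<beta> * (q - ?x)" using q1 \<beta> by (intro mult_left_mono) auto
        then show ?thesis by (simp add: algebra_simps power2_eq_square)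
      qed
      moreover have "?x\<^sup>2 / q - \<beta>\<^sup>2 * ?n \<le> (1 - \<delta>)\<^sup>2 * ?x\<^sup>2 / q"
      proof -
        have "?x\<^sup>2 / q \<le> ?n"
        proof -
          have "?x * ?x \<le> ?n * q" using xn q1 npos \<beta> mult_pos_pos[of \<beta> ?n] by (intro mult_mono) linarith+
          then show ?thesis using q1 by (simp add: field_simps power2_eq_square)
        qed
        then have "2 * \<delta> * (?x\<^sup>2 / q) \<le> \<beta>\<^sup>2 * ?n" using \<delta> q1 by (intro mult_mono) auto
        moreover have "(1 - 2 * \<delta>) * (?x\<^sup>2 / q) \<le> (1 - \<delta>)\<^sup>2 * (?x\<^sup>2 / q)"
          using q1 by (intro mult_right_mono) (auto simp: power2_eq_square algebra_simps)
        moreover have "(1 - 2 * \<delta>) * (?x\<^sup>2 / q) = ?x\<^sup>2 / q - 2 * \<delta> * (?x\<^sup>2 / q)"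
          by (simp only: left_diff_distrib mult_1_left)
        moreover have "(1 - \<delta>)\<^sup>2 * ?x\<^sup>2 / q = (1 - \<delta>)\<^sup>2 * (?x\<^sup>2 / q)" by simp
        ultimately show ?thesis by linarith
      qed
      moreover have "a \<le> b \<Longrightarrow> a = x - c \<Longrightarrow> b \<le> d - 2 * w \<Longrightarrow> c - w \<le> f \<Longrightarrow> f \<le> g + R \<Longrightarrow> g \<le> w
        \<Longrightarrow> x - R \<le> d" for a b c d f g w x R :: real by linarith
      ultimately show ?thesis using main n(3) unfolding mult.assoc by blast
    qed
    then have "real (escape X e + card X + card A) \<le> ?p"
      using autocorr_add_escape[OF fin(2), of e] unfolding q_def by linarith
    then have "escape X e + card X + card A \<le> p" by (simp only: of_nat_le_iff)
    then show ?thesis using e R by blast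
  qed
qed

text \<open>The shift found by the energy argument may hardly shrink \<open>X\<close>. In that case
  \<open>ex_moderate_escape\<close> supplies another one with escape between \<open>s\<close> and
  \<open>2 * s\<close>: it removes at least \<open>s\<close> elements, about
  \<open>\<sigma> * card A\<close>, and yet keeps \<open>X\<close> large and meets the size
  condition.\<close>

lemma critical_descent:
  fixes \<beta> \<kappa> \<epsilon> \<sigma> :: real
  assumes A: "A \<subseteq> H" and X: "X \<subseteq> H" and S: "S \<subseteq> H" and crit: "critical A X S \<epsilon>"
    and \<beta>: "0 < \<beta>" "\<beta> < 1" and \<kappa>: "0 < \<kappa>" "\<kappa> \<le> 1" and \<epsilon>: "0 < \<epsilon>" "\<epsilon> \<le> \<beta> ^ 3 / 2" "\<epsilon> \<le> \<kappa>\<^sup>2 / 4"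
    and \<sigma>: "0 < \<sigma>" "\<sigma> \<le> \<kappa> / 4" "\<sigma> \<le> \<beta>"
    and n: "24 \<le> \<kappa>\<^sup>2 * real (card A)" "12 / \<beta> \<le> \<kappa>\<^sup>2 * real (card A)" "1 / \<beta> \<le> \<beta>\<^sup>2 * real (card A)"
      "2 \<le> \<sigma> * real (card A)" "1 \<le> sqrt \<epsilon> * real (card A)"
    and np: "real (card A) \<le> (1 - \<beta>) * real p / 2"
    and x: "\<kappa> * real (card A) < real (card X)" "card X \<le> card A"
  shows "\<exists>X'\<subseteq>H. \<exists>S'\<subseteq>H. critical A X' S' (6 * sqrt \<epsilon>) \<and> card X' \<le> card A \<and>
    \<kappa>\<^sup>2 / 24 * real (card A) \<le> real (card X') \<and> real (card X') \<le> real (card X) - \<sigma> / 2 * real (card A)"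
proof -
  note fin = finite_subset_H[OF A] finite_subset_H[OF X] finite_subset_H[OF S]
  let ?n = "real (card A)" and ?x = "real (card X)" and ?p = "real p"
  have p1: "2 * ?n + \<beta> * ?p \<le> ?p" using np by (simp add: algebra_simps)
  have "\<beta> * (2 * ?n) \<le> \<beta> * ?p"
    using p1 \<beta> by (intro mult_left_mono) (use mult_nonneg_nonneg[of \<beta> ?p] in linarith)+
  then have p2: "2 * ?n + 2 * \<beta> * ?n \<le> ?p" using p1 by linarith
  obtain e where e: "e \<in> H" "e \<noteq> 0" "\<kappa>\<^sup>2 / 24 * ?n \<le> real (autocorr X e)"
    "escape X e + card X + card A \<le> p"
    using ex_shift_for_descent[OF A X S crit \<beta> \<kappa> \<epsilon>(1,2) n(1-3) np x] by blast
  define s where "s = nat \<lfloor>\<sigma> * ?n\<rfloor>"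
  have s: "real s \<le> \<sigma> * ?n" "\<sigma> / 2 * ?n \<le> real s" unfolding s_def using n(4) by linarith+
  have \<sigma>n: "\<sigma> * ?n \<le> \<kappa> / 4 * ?n" "\<sigma> * ?n \<le> \<beta> * ?n"
    using \<sigma> by (intro mult_right_mono; simp)+
  have "\<exists>f\<in>H. s \<le> escape X f \<and> \<kappa>\<^sup>2 / 24 * ?n \<le> real (autocorr X f) \<and> escape X f + card X + card A \<le> p"
  proof (cases "s \<le> escape X e")
    case True then show ?thesis using e by blast
  next
    case False
    have s2: "2 * real s \<le> \<kappa> / 2 * ?n" "2 * real s \<le> 2 * \<beta> * ?n" using s \<sigma>n by auto
    have "2 * real s \<le> ?x" using s2 x by simp
    then have "2 * s \<le> card X" by linarith
    moreover have "2 * card X \<le> p" using x e(4) by linarith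
    ultimately obtain f where f: "f \<in> H" "s \<le> escape X f" "escape X f < 2 * s"
      using ex_moderate_escape[OF X e(1,2), of s] False by auto
    have "\<kappa>\<^sup>2 \<le> \<kappa>" using \<kappa> by (simp add: power2_eq_square mult_left_le)
    then have "\<kappa>\<^sup>2 / 24 * ?n \<le> \<kappa> / 2 * ?n" using \<kappa> by (intro mult_right_mono) auto
    moreover have "\<kappa> * ?n = \<kappa> / 2 * ?n + \<kappa> / 2 * ?n" by simp
    moreover have "real (escape X f) \<le> 2 * real s" using f by linarith
    ultimately have "\<kappa>\<^sup>2 / 24 * ?n \<le> real (autocorr X f)"
      using autocorr_add_escape[OF fin(2), of f] x s2 by linarith
    moreover have "real (escape X f + card X + card A) \<le> ?p"
      using \<open>real (escape X f) \<le> 2 * real s\<close> s2 p2 x by simp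
    ultimately show ?thesis using f by (auto simp only: of_nat_le_iff)
  qed
  then obtain f where f: "f \<in> H" "s \<le> escape X f" "\<kappa>\<^sup>2 / 24 * ?n \<le> real (autocorr X f)"
    "escape X f + card X + card A \<le> p" by blast
  have "sqrt \<epsilon> \<le> \<kappa> / 2" using \<epsilon> \<kappa> by (intro real_le_lsqrt) (auto simp: power_divide)
  then have "2 * sqrt \<epsilon> * ?n \<le> \<kappa> * ?n" by (intro mult_right_mono) auto
  then have 2: "2 * sqrt \<epsilon> * ?n \<le> ?x" using x by linarith
  have "\<epsilon> \<le> 1" using \<epsilon> \<beta> power_le_one[of \<beta> 3] by linarith
  then have "critical A {x \<in> X. x + f \<in> X} {s \<in> S. s + f \<in> S} (6 * sqrt \<epsilon>)"
    using critical_shift_step[OF A X S crit \<epsilon>(1) _ n(5) 2 x(2) f(1,4)] by blast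
  moreover have "card {x \<in> X. x + f \<in> X} = autocorr X f" by (simp add: autocorr_def)
  moreover have "real (autocorr X f) \<le> ?x - \<sigma> / 2 * ?n"
    using autocorr_add_escape[OF fin(2), of f] f s by linarith
  moreover have "autocorr X f \<le> card A" using autocorr_add_escape[OF fin(2), of f] x by linarith
  moreover have "{x \<in> X. x + f \<in> X} \<subseteq> H" "{s \<in> S. s + f \<in> S} \<subseteq> H" using X S by auto
  ultimately show ?thesis using f(3)
    by (intro exI[of _ "{x \<in> X. x + f \<in> X}"] exI[of _ "{s \<in> S. s + f \<in> S}"] conjI) simp_all
qed

end

text \<open>Induction on the number \<open>k\<close> of steps still allowed, each removing
  \<open>\<sigma> / 2 * card A\<close> elements. The error is chosen backwards from the target
  \<open>\<epsilon>'\<close>, before the group and the sets are known; this uniformity dictates the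
  order of the quantifiers.\<close>

lemma ex_small_critical_aux:
  fixes \<beta> \<kappa> :: real
  assumes \<beta>: "0 < \<beta>" "\<beta> < 1" and \<kappa>: "0 < \<kappa>" "\<kappa> \<le> 1" and \<sigma>: "0 < \<sigma>" "\<sigma> \<le> \<kappa> / 4" "\<sigma> \<le> \<beta>"
  shows "\<epsilon>' > 0 \<Longrightarrow> \<exists>\<epsilon>>0. \<exists>N. \<forall>p (\<iota> :: int \<Rightarrow> 'a::ab_group_add) A X S. prime_cyclic p \<iota> \<longrightarrow> A \<subseteq> prime_cyclic.H \<iota> \<longrightarrow>
    X \<subseteq> prime_cyclic.H \<iota> \<longrightarrow> S \<subseteq> prime_cyclic.H \<iota> \<longrightarrow> critical A X S \<epsilon> \<longrightarrow> N \<le> real (card A) \<longrightarrow>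
    real (card A) \<le> (1 - \<beta>) * real p / 2 \<longrightarrow> card X \<le> card A \<longrightarrow> \<kappa>\<^sup>2 / 24 * real (card A) \<le> real (card X) \<longrightarrow>
    real (card X) \<le> \<kappa> * real (card A) + real k * (\<sigma> / 2 * real (card A)) \<longrightarrow>
    (\<exists>X'\<subseteq>prime_cyclic.H \<iota>. \<exists>S'\<subseteq>prime_cyclic.H \<iota>. critical A X' S' \<epsilon>' \<and>
      \<kappa>\<^sup>2 / 24 * real (card A) \<le> real (card X') \<and> real (card X') \<le> \<kappa> * real (card A))"
  (is "_ \<Longrightarrow> \<exists>\<epsilon>>0. \<exists>N. ?P k \<epsilon> N")
proof (induction k)
  case 0
  show ?case
  proof (rule exI[of _ \<epsilon>'], rule conjI, rule 0, rule exI[of _ 0], intro allI impI)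
    fix p and \<iota> :: "int \<Rightarrow> 'a" and A X S
    assume "X \<subseteq> prime_cyclic.H \<iota>" "S \<subseteq> prime_cyclic.H \<iota>" "critical A X S \<epsilon>'"
      "\<kappa>\<^sup>2 / 24 * real (card A) \<le> real (card X)"
      "real (card X) \<le> \<kappa> * real (card A) + real 0 * (\<sigma> / 2 * real (card A))"
    then show "\<exists>X'\<subseteq>prime_cyclic.H \<iota>. \<exists>S'\<subseteq>prime_cyclic.H \<iota>. critical A X' S' \<epsilon>' \<and>
      \<kappa>\<^sup>2 / 24 * real (card A) \<le> real (card X') \<and> real (card X') \<le> \<kappa> * real (card A)"
      by (intro exI[of _ X] exI[of _ S] conjI) simp_all
  qed
next
  case (Suc k)
  obtain \<epsilon>1 N1 where \<epsilon>1: "\<epsilon>1 > 0" and IH: "?P k \<epsilon>1 N1"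
    using Suc.IH[OF Suc.prems] by (elim exE conjE) (rule that)
  \<comment> \<open>The last term inverts the loss \<open>6 * sqrt \<epsilon>\<close> of one step;
    \<open>\<epsilon>'\<close> serves the case in which \<open>X\<close> is already small, and the
    other two are hypotheses of \<open>critical_descent\<close>.\<close>
  define \<epsilon> where "\<epsilon> = min (min \<epsilon>' (\<beta> ^ 3 / 2)) (min (\<kappa>\<^sup>2 / 4) ((\<epsilon>1 / 6)\<^sup>2))"
  have \<epsilon>: "0 < \<epsilon>" "\<epsilon> \<le> \<epsilon>'" "\<epsilon> \<le> \<beta> ^ 3 / 2" "\<epsilon> \<le> \<kappa>\<^sup>2 / 4" "\<epsilon> \<le> (\<epsilon>1 / 6)\<^sup>2"
    using \<beta> \<kappa> \<epsilon>1 Suc.prems by (auto simp: \<epsilon>_def)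
  have "sqrt \<epsilon> \<le> \<epsilon>1 / 6" using \<epsilon> \<epsilon>1 by (intro real_le_lsqrt) auto
  then have \<epsilon>6: "6 * sqrt \<epsilon> \<le> \<epsilon>1" by simp
  have ub: "\<exists>N. a \<le> N \<and> b \<le> N \<and> c \<le> N \<and> d \<le> N \<and> e \<le> N \<and> f \<le> N" for a b c d e f :: real
    by (intro exI[of _ "max a (max b (max c (max d (max e f))))"] conjI; (rule max.cobounded1 order_refl max.coboundedI2)+)
  obtain N where N: "N1 \<le> N" "24 / \<kappa>\<^sup>2 \<le> N" "12 / \<beta> / \<kappa>\<^sup>2 \<le> N" "1 / \<beta> / \<beta>\<^sup>2 \<le> N"
    "2 / \<sigma> \<le> N" "1 / sqrt \<epsilon> \<le> N"
    using ub by blast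
  show ?case
  proof (rule exI[of _ \<epsilon>], rule conjI, rule \<epsilon>(1), rule exI[of _ N], intro allI impI)
    fix p and \<iota> :: "int \<Rightarrow> 'a" and A X S
    assume pc: "prime_cyclic p \<iota>" and A: "A \<subseteq> prime_cyclic.H \<iota>"
      and X: "X \<subseteq> prime_cyclic.H \<iota>" and S: "S \<subseteq> prime_cyclic.H \<iota>" and crit: "critical A X S \<epsilon>" and NA: "N \<le> real (card A)"
      and np: "real (card A) \<le> (1 - \<beta>) * real p / 2" and XA: "card X \<le> card A"
      and Xl: "\<kappa>\<^sup>2 / 24 * real (card A) \<le> real (card X)"
      and Xu: "real (card X) \<le> \<kappa> * real (card A) + real (Suc k) * (\<sigma> / 2 * real (card A))"
    interpret prime_cyclic p \<iota> by fact
    show "\<exists>X'\<subseteq>H. \<exists>S'\<subseteq>H. critical A X' S' \<epsilon>' \<and>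
      \<kappa>\<^sup>2 / 24 * real (card A) \<le> real (card X') \<and> real (card X') \<le> \<kappa> * real (card A)"
    proof (cases "real (card X) \<le> \<kappa> * real (card A)")
      case True
      then show ?thesis using X S Xl critical_mono[OF crit \<epsilon>(2)] by (intro exI[of _ X] exI[of _ S] conjI)
    next
      case False
      have n: "24 \<le> \<kappa>\<^sup>2 * real (card A)" "12 / \<beta> \<le> \<kappa>\<^sup>2 * real (card A)" "1 / \<beta> \<le> \<beta>\<^sup>2 * real (card A)"
        "2 \<le> \<sigma> * real (card A)" "1 \<le> sqrt \<epsilon> * real (card A)"
        using order_trans[OF N(2) NA] order_trans[OF N(3) NA] order_trans[OF N(4) NA]
          order_trans[OF N(5) NA] order_trans[OF N(6) NA] \<beta> \<kappa> \<sigma> \<epsilon>(1)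
        by (simp_all add: pos_divide_le_eq mult.commute del: divide_divide_eq_left)
      obtain X' S' where X': "X' \<subseteq> H" "S' \<subseteq> H" "critical A X' S' (6 * sqrt \<epsilon>)" "card X' \<le> card A"
        "\<kappa>\<^sup>2 / 24 * real (card A) \<le> real (card X')" "real (card X') \<le> real (card X) - \<sigma> / 2 * real (card A)"
        using critical_descent[OF A X S crit \<beta> \<kappa> \<epsilon>(1,3,4) \<sigma> n np _ XA] False unfolding not_le by blast
      have "real (card X') \<le> \<kappa> * real (card A) + real k * (\<sigma> / 2 * real (card A))"
      proof -
        have "real (Suc k) * (\<sigma> / 2 * real (card A)) = real k * (\<sigma> / 2 * real (card A)) + \<sigma> / 2 * real (card A)"
          by (simp only: of_nat_Suc distrib_right mult_1_left add.commute)
        then show "real (card X') \<le> \<kappa> * real (card A) + real k * (\<sigma> / 2 * real (card A))"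
          using X'(6) Xu by linarith
      qed
      then show ?thesis
        by (rule IH[rule_format, OF pc A X'(1,2) critical_mono[OF X'(3) \<epsilon>6] order_trans[OF N(1) NA] np X'(4,5)])
    qed
  qed
qed

lemma ex_small_critical:
  fixes \<beta> \<kappa> \<epsilon>' :: real
  assumes \<beta>: "0 < \<beta>" "\<beta> < 1" and \<kappa>: "0 < \<kappa>" "\<kappa> \<le> 1" and "\<epsilon>' > 0"
  shows "\<exists>\<epsilon>>0. \<exists>N. \<forall>p (\<iota> :: int \<Rightarrow> 'a::ab_group_add) A S. prime_cyclic p \<iota> \<longrightarrow> A \<subseteq> prime_cyclic.H \<iota> \<longrightarrow>
    S \<subseteq> prime_cyclic.H \<iota> \<longrightarrow> critical A A S \<epsilon> \<longrightarrow> N \<le> real (card A) \<longrightarrow>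
    real (card A) \<le> (1 - \<beta>) * real p / 2 \<longrightarrow>
    (\<exists>X'\<subseteq>prime_cyclic.H \<iota>. \<exists>S'\<subseteq>prime_cyclic.H \<iota>. critical A X' S' \<epsilon>' \<and>
      \<kappa>\<^sup>2 / 24 * real (card A) \<le> real (card X') \<and> real (card X') \<le> \<kappa> * real (card A))"
proof -
  define \<sigma> where "\<sigma> = min (\<kappa> / 4) \<beta>"
  have \<sigma>: "0 < \<sigma>" "\<sigma> \<le> \<kappa> / 4" "\<sigma> \<le> \<beta>" using \<beta> \<kappa> by (auto simp: \<sigma>_def)
  \<comment> \<open>Starting from \<open>X = A\<close>, this many steps could remove all of
    \<open>A\<close>, so the size bound of the induction holds at the outset.\<close>
  define k where "k = nat \<lceil>2 / \<sigma>\<rceil>"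
  have "2 / \<sigma> \<le> real k" unfolding k_def by linarith
  then have k: "1 \<le> real k * (\<sigma> / 2)" using \<sigma> by (simp add: pos_divide_le_eq)
  have "\<kappa>\<^sup>2 \<le> 1" using \<kappa> by (simp add: power_le_one)
  then have l: "\<kappa>\<^sup>2 / 24 * real (card A) \<le> real (card A)" for A :: "'a set" by (intro mult_left_le_one_le) auto
  have u: "real (card A) \<le> \<kappa> * real (card A) + real k * (\<sigma> / 2 * real (card A))" for A :: "'a set"
  proof -
    have "1 * real (card A) \<le> (real k * (\<sigma> / 2)) * real (card A)" using k by (intro mult_right_mono) auto
    then have "real (card A) \<le> real k * (\<sigma> / 2 * real (card A))" by (simp only: mult.assoc mult_1)
    moreover have "0 \<le> \<kappa> * real (card A)" using \<kappa> by simp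
    ultimately show ?thesis by linarith
  qed
  obtain \<epsilon> N where \<epsilon>: "\<epsilon> > 0" and N: "\<forall>p (\<iota> :: int \<Rightarrow> 'a) A X S. prime_cyclic p \<iota> \<longrightarrow> A \<subseteq> prime_cyclic.H \<iota> \<longrightarrow>
    X \<subseteq> prime_cyclic.H \<iota> \<longrightarrow> S \<subseteq> prime_cyclic.H \<iota> \<longrightarrow> critical A X S \<epsilon> \<longrightarrow> N \<le> real (card A) \<longrightarrow>
    real (card A) \<le> (1 - \<beta>) * real p / 2 \<longrightarrow> card X \<le> card A \<longrightarrow> \<kappa>\<^sup>2 / 24 * real (card A) \<le> real (card X) \<longrightarrow>
    real (card X) \<le> \<kappa> * real (card A) + real k * (\<sigma> / 2 * real (card A)) \<longrightarrow>
    (\<exists>X'\<subseteq>prime_cyclic.H \<iota>. \<exists>S'\<subseteq>prime_cyclic.H \<iota>. critical A X' S' \<epsilon>' \<and>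
      \<kappa>\<^sup>2 / 24 * real (card A) \<le> real (card X') \<and> real (card X') \<le> \<kappa> * real (card A))"
    using ex_small_critical_aux[OF \<beta> \<kappa> \<sigma> assms(5), of k, where 'a = 'a] by (elim exE conjE) (rule that)
  show ?thesis
    by (rule exI[of _ \<epsilon>], rule conjI, rule \<epsilon>, rule exI[of _ N], intro allI impI, rule N[rule_format])
       (assumption | rule order_refl l u)+
qed

section \<open>Linear growth of the sets of near periods\<close>

context prime_cyclic
begin

definition near_periods :: "'a set \<Rightarrow> nat \<Rightarrow> 'a set" where
  "near_periods A u = {e \<in> H. escape A e \<le> u}"

lemma near_periods_subset_H: "near_periods A u \<subseteq> H"
  by (auto simp: near_periods_def)

lemma near_periods_mono: "u \<le> v \<Longrightarrow> near_periods A u \<subseteq> near_periods A v"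
  by (auto simp: near_periods_def)

lemma zero_in_near_periods: "0 \<in> near_periods A u"
  by (simp add: near_periods_def H_0)

lemma near_periods_add:
  assumes "finite A" "e \<in> near_periods A u" "f \<in> near_periods A v"
  shows "e + f \<in> near_periods A (u + v)"
  using assms escape_add[OF assms(1), of e f] by (auto simp: near_periods_def intro: H_add)

lemma near_periods_uminus:
  assumes "finite A" "e \<in> near_periods A u" shows "- e \<in> near_periods A u"
  using assms by (auto simp: near_periods_def escape_uminus intro: H_uminus)

text \<open>By subadditivity, sums of \<open>j\<close> near periods of level \<open>t\<close> have
  level \<open>j * t\<close>; until the group is full, Cauchy-Davenport adds
  \<open>card (near_periods A t) - 1\<close> elements at each step.\<close>

lemma card_near_periods_mult:
  assumes "finite A" shows "min p (j * (card (near_periods A t) - 1) + 1) \<le> card (near_periods A (j * t))"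
proof (induction j)
  case 0
  have "near_periods A 0 \<noteq> {}" using zero_in_near_periods by auto
  then have "card (near_periods A 0) > 0"
    using finite_subset_H[OF near_periods_subset_H] by (simp add: card_gt_0_iff)
  then show ?case by simp
next
  case (Suc j)
  let ?X = "near_periods A (j * t)" and ?Y = "near_periods A t"
  have ne: "?X \<noteq> {}" "?Y \<noteq> {}" using zero_in_near_periods by auto
  have pos: "card ?Y > 0" using ne finite_subset_H[OF near_periods_subset_H] by (simp add: card_gt_0_iff)
  have "min p (card ?X + card ?Y - 1) \<le> card {x + y | x y. x \<in> ?X \<and> y \<in> ?Y}"
    by (intro cauchy_davenport near_periods_subset_H ne)
  also have "\<dots> \<le> card (near_periods A (j * t + t))"
    by (intro card_mono finite_subset_H[OF near_periods_subset_H])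
       (use near_periods_add[OF assms] in blast)
  finally have "min p (card ?X + card ?Y - 1) \<le> card (near_periods A (Suc j * t))" by (simp add: add.commute)
  moreover have "Suc j * (card ?Y - 1) + 1 = (j * (card ?Y - 1) + 1) + (card ?Y - 1)" by simp
  ultimately show ?case using Suc.IH pos by linarith
qed

text \<open>The total autocorrelation summed by levels: \<open>e\<close> is counted once for each
  \<open>u\<close> with \<open>escape A e \<le> u < card A\<close>, that is,
  \<open>autocorr A e\<close> times.\<close>

lemma sum_card_near_periods:
  assumes "A \<subseteq> H" shows "(\<Sum>u<card A. card (near_periods A u)) = (card A)\<^sup>2"
proof -
  note fin = finite_subset_H[OF assms]
  have "(\<Sum>u<card A. card (near_periods A u)) = card (SIGMA u:{..<card A}. {e \<in> H. escape A e \<le> u})"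
    unfolding near_periods_def by (intro sum_card_eq_card_Sigma) auto
  also have "\<dots> = card (SIGMA e:H. {u \<in> {..<card A}. escape A e \<le> u})"
    by (rule bij_betw_same_card[of "\<lambda>(u, e). (e, u)"], rule bij_betwI[where g = "\<lambda>(e, u). (u, e)"]) auto
  also have "\<dots> = (\<Sum>e\<in>H. card {u \<in> {..<card A}. escape A e \<le> u})"
    by (intro sum_card_eq_card_Sigma[symmetric]) auto
  also have "\<dots> = (\<Sum>e\<in>H. autocorr A e)"
  proof (intro sum.cong refl)
    fix e assume "e \<in> H"
    have "{u \<in> {..<card A}. escape A e \<le> u} = {escape A e..<card A}" by auto
    then show "card {u \<in> {..<card A}. escape A e \<le> u} = autocorr A e"
      using autocorr_add_escape[OF fin, of e] by simp
  qed
  finally show ?thesis using sum_autocorr[OF assms] by simp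
qed

text \<open>The union of \<open>x + A\<close> and \<open>y + A\<close> has
  \<open>card A + escape A (x - y)\<close> elements and lies in \<open>S\<close> up to two errors
  \<open>\<epsilon> * card A\<close>; the third one is the slack in \<open>card S\<close>.\<close>

lemma escape_diff_le:
  assumes A: "A \<subseteq> H" and "S \<subseteq> H" and crit: "critical A X S \<epsilon>" and xy: "x \<in> X" "y \<in> X"
  shows "real (escape A (x - y)) \<le> real (card X) + 3 * \<epsilon> * real (card A)"
proof -
  note fin = finite_subset_H[OF A] finite_subset_H[OF \<open>S \<subseteq> H\<close>]
  define U V where "U = (\<lambda>a. x + a) ` A" and "V = (\<lambda>a. y + a) ` A"
  have c: "card U = card A" "card V = card A" unfolding U_def V_def
    by (intro card_image; simp add: inj_on_def)+
  have finU: "finite U" "finite V" using fin by (auto simp: U_def V_def)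
  have "{a \<in> A. a + (x - y) \<in> A} = (\<lambda>z. z - x) ` (U \<inter> V)"
  proof safe
    fix a assume a: "a \<in> A" "a + (x - y) \<in> A"
    then have "x + a \<in> U" "y + (a + (x - y)) \<in> V" unfolding U_def V_def by (blast intro: imageI)+
    moreover have "y + (a + (x - y)) = x + a" by (simp add: algebra_simps)
    ultimately have "x + a \<in> U \<inter> V" by simp
    then show "a \<in> (\<lambda>z. z - x) ` (U \<inter> V)" by (rule rev_image_eqI) simp
  next
    fix z assume "z \<in> U" "z \<in> V"
    then obtain a b where ab: "z = x + a" "a \<in> A" "z = y + b" "b \<in> A"
      unfolding U_def V_def by (elim imageE) blast
    show "z - x \<in> A" using ab(1,2) by simp
    show "z - x + (x - y) \<in> A" using ab(3,4) by (simp add: algebra_simps)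
  qed
  then have "autocorr A (x - y) = card (U \<inter> V)"
    unfolding autocorr_def by (simp add: card_image inj_on_def)
  then have "escape A (x - y) + card (U \<inter> V) = card A"
    using autocorr_add_escape[OF fin(1), of "x - y"] by linarith
  moreover have "card (U \<union> V) + card (U \<inter> V) = 2 * card A"
    using card_Un_Int[OF finU] c by simp
  ultimately have 1: "escape A (x - y) + card A = card (U \<union> V)" by linarith
  have "U \<union> V \<subseteq> S \<union> ((U - S) \<union> (V - S))" by auto
  then have "card (U \<union> V) \<le> card (S \<union> ((U - S) \<union> (V - S)))" using fin finU by (intro card_mono) auto
  also have "\<dots> \<le> card S + (card (U - S) + card (V - S))"
    by (intro order_trans[OF card_Un_le] add_left_mono card_Un_le)
  finally have 2: "card (U \<union> V) \<le> card S + (card (U - S) + card (V - S))" .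
  have 3: "real (card ((\<lambda>a. w + a) ` A - S)) \<le> \<epsilon> * real (card A)" if "w \<in> X" for w
  proof -
    have "(\<lambda>a. w + a) ` A - S = (\<lambda>a. w + a) ` {a \<in> A. w + a \<notin> S}" by auto
    then have "card ((\<lambda>a. w + a) ` A - S) = card {a \<in> A. w + a \<notin> S}" by (simp add: card_image)
    then show ?thesis using crit that by (simp add: critical_def)
  qed
  have "real (card S) \<le> real (card A) + real (card X) + \<epsilon> * real (card A)"
    using crit by (simp add: critical_def)
  then show ?thesis using 1 2 3[OF xy(1)] 3[OF xy(2)] unfolding U_def V_def by linarith
qed

lemma card_near_periods_ge:
  assumes A: "A \<subseteq> H" and X: "X \<subseteq> H" and S: "S \<subseteq> H" and crit: "critical A X S \<epsilon>"
    and ne: "X \<noteq> {}" and Xp: "2 * card X \<le> p"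
    and t: "real (card X) + 3 * \<epsilon> * real (card A) < real t + 1"
  shows "2 * card X - 1 \<le> card (near_periods A t)"
proof -
  have XH: "uminus ` X \<subseteq> H" using X by (auto intro: H_uminus)
  have "card (uminus ` X) = card X" by (intro card_image) auto
  moreover have "min p (card X + card (uminus ` X) - 1) \<le> card {x + y | x y. x \<in> X \<and> y \<in> uminus ` X}"
    using ne by (intro cauchy_davenport X XH) auto
  ultimately have "2 * card X - 1 \<le> card {x + y | x y. x \<in> X \<and> y \<in> uminus ` X}" using Xp by simp
  also have "\<dots> \<le> card (near_periods A t)"
  proof (rule card_mono)
    show "finite (near_periods A t)" by (rule finite_subset_H[OF near_periods_subset_H])
    show "{x + y | x y. x \<in> X \<and> y \<in> uminus ` X} \<subseteq> near_periods A t"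
    proof safe
      fix x y assume xy: "x \<in> X" "y \<in> X"
      have "real (escape A (x - y)) < real t + 1"
        using escape_diff_le[OF A S crit xy] t by linarith
      then have "escape A (x - y) \<le> t" by linarith
      moreover have "x - y \<in> H" using X xy by (auto intro: H_diff)
      ultimately show "x + - y \<in> near_periods A t" by (simp add: near_periods_def)
    qed
  qed
  finally show ?thesis .
qed

text \<open>\<open>X - X\<close> provides almost \<open>2 * t\<close> near periods at a level
  \<open>t\<close> close to \<open>card X\<close>, and \<open>j = u div t\<close> such blocks reach
  level \<open>u\<close>. Rounding \<open>u\<close> down to a multiple of \<open>t\<close> costs up
  to \<open>2 * t\<close>, which is why \<open>X\<close> must be as small as
  \<open>\<kappa> * card A\<close>; the accumulated errors of the \<open>j\<close> blocks fix
  \<open>\<epsilon>\<close>.\<close>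

lemma near_periods_lower_bound:
  fixes \<mu> \<kappa> \<epsilon> :: real
  assumes A: "A \<subseteq> H" and X: "X \<subseteq> H" and S: "S \<subseteq> H" and crit: "critical A X S \<epsilon>"
    and \<mu>: "0 < \<mu>" "\<mu> \<le> 1" and \<kappa>: "\<kappa> = \<mu> / 8" and \<epsilon>: "\<epsilon> = \<mu> * \<kappa>\<^sup>2 / 576"
    and n: "192 / (\<kappa>\<^sup>2 * \<mu>) \<le> real (card A)" and np: "2 * card A \<le> p"
    and Xl: "\<kappa>\<^sup>2 / 24 * real (card A) \<le> real (card X)" and Xu: "real (card X) \<le> \<kappa> * real (card A)"
    and u: "u < card A"
  shows "2 * real u - \<mu> * real (card A) \<le> real (card (near_periods A u))"
proof -
  note fin = finite_subset_H[OF A] finite_subset_H[OF X]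
  let ?n = "real (card A)" and ?x = "real (card X)"
  have \<kappa>0: "0 < \<kappa>" "\<kappa> \<le> 1" "0 < \<kappa>\<^sup>2" "\<kappa>\<^sup>2 \<le> 1" using \<mu> \<kappa> by (auto simp: power_le_one)
  have n': "192 \<le> \<mu> * (\<kappa>\<^sup>2 * ?n)" using n \<kappa>0 \<mu> by (simp add: pos_divide_le_eq algebra_simps)
  have "\<mu> * (\<kappa>\<^sup>2 * ?n) \<le> 1 * (\<kappa>\<^sup>2 * ?n)" using \<mu> by (intro mult_right_mono) auto
  then have x1: "?x \<ge> 1" using n' Xl by simp
  have \<epsilon>0: "0 < \<epsilon>" unfolding \<epsilon> using \<mu> \<kappa>0 by simp
  define t where "t = nat \<lfloor>?x + 3 * \<epsilon> * ?n\<rfloor>"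
  have \<epsilon>n: "0 \<le> \<epsilon> * ?n" using \<epsilon>0 by simp
  have t: "?x + 3 * \<epsilon> * ?n < real t + 1" "real t \<le> ?x + 3 * \<epsilon> * ?n"
    unfolding t_def using \<epsilon>n by (linarith, simp)
  have "?x < real t + 1" using t \<epsilon>n by linarith
  then have xt: "card X \<le> t" by linarith
  have xn: "?x \<le> ?n" using Xu \<kappa>0 mult_right_mono[of \<kappa> 1 ?n] by simp
  have Nt: "2 * card X - 1 \<le> card (near_periods A t)"
    using x1 xn np by (intro card_near_periods_ge[OF A X S crit _ _ t(1)]) auto
  define j where "j = u div t"
  have tpos: "t > 0" using xt x1 by linarith
  have "u = j * t + u mod t" unfolding j_def by simp
  moreover have "u mod t < t" using tpos by simp
  ultimately have jt: "j * t \<le> u" "u < j * t + t" by linarith+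
  have "j * (2 * card X - 2) + 1 \<le> j * (card (near_periods A t) - 1) + 1" using Nt by (intro add_right_mono mult_left_mono) auto
  moreover have "min p (j * (card (near_periods A t) - 1) + 1) \<le> card (near_periods A (j * t))"
    by (rule card_near_periods_mult[OF fin(1)])
  moreover have "card (near_periods A (j * t)) \<le> card (near_periods A u)"
    by (intro card_mono near_periods_mono jt finite_subset_H[OF near_periods_subset_H])
  ultimately have main: "min p (j * (2 * card X - 2) + 1) \<le> card (near_periods A u)" by linarith
  show ?thesis
  proof (cases "p \<le> j * (2 * card X - 2) + 1")
    case True
    then have "2 * u \<le> card (near_periods A u)" using main u np by linarith
    moreover have "0 \<le> \<mu> * ?n" using \<mu> by simp
    ultimately show ?thesis by linarith
  next
    case False
    then have "j * (2 * card X - 2) + 1 \<le> card (near_periods A u)" using main by simp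
    moreover have "real (j * (2 * card X - 2)) = real j * (2 * ?x - 2)"
      using x1 by (simp add: of_nat_diff)
    ultimately have 1: "real j * (2 * ?x - 2) \<le> real (card (near_periods A u))" by linarith
    \<comment> \<open>The lower bound on \<open>card X\<close> limits the number of blocks, hence
      the accumulated error.\<close>
    have "real j * (\<kappa>\<^sup>2 / 24 * ?n) \<le> real j * real t" using Xl xt by (intro mult_left_mono) auto
    also have "\<dots> \<le> ?n" using jt u by (metis less_imp_le_nat of_nat_le_iff of_nat_mult order_trans)
    finally have "(real j * (\<kappa>\<^sup>2 / 24)) * ?n \<le> 1 * ?n" by (simp only: mult.assoc mult_1)
    moreover have "?n > 0" using u by simp
    ultimately have jk: "real j * (\<kappa>\<^sup>2 / 24) \<le> 1" by (simp only: mult_le_cancel_right_pos)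
    have j24: "real j \<le> 24 / \<kappa>\<^sup>2" using jk \<kappa>0 by (simp add: field_simps)
    have "real j * (2 * (real t - ?x + 1)) \<le> 24 / \<kappa>\<^sup>2 * (2 * (3 * \<epsilon> * ?n + 1))"
      using j24 t \<kappa>0 xt by (intro mult_mono) auto
    also have "\<dots> = (144 * \<epsilon> / \<kappa>\<^sup>2) * ?n + 48 / \<kappa>\<^sup>2" by (simp add: algebra_simps add_divide_distrib)
    also have "144 * \<epsilon> / \<kappa>\<^sup>2 = \<mu> / 4" unfolding \<epsilon> using \<kappa>0 by simp
    also have "48 / \<kappa>\<^sup>2 \<le> \<mu> / 4 * ?n" using n' \<kappa>0 by (simp add: pos_divide_le_eq algebra_simps)
    finally have 2: "real j * (2 * (real t - ?x + 1)) \<le> \<mu> / 2 * ?n" by simp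
    have "real j * (2 * ?x - 2) = 2 * (real j * real t) - real j * (2 * (real t - ?x + 1))"
      by (simp add: algebra_simps)
    moreover have "real u \<le> real j * real t + real t" using jt by (metis less_imp_le_nat of_nat_add of_nat_le_iff of_nat_mult)
    moreover have "2 * real t \<le> \<mu> / 2 * ?n"
    proof -
      have "\<mu> * \<kappa>\<^sup>2 \<le> \<mu> * 1" using \<mu> \<kappa>0 by (intro mult_left_mono) auto
      then have "3 * \<epsilon> \<le> \<mu> / 8" unfolding \<epsilon> using \<mu>(1) by linarith
      then have "3 * \<epsilon> * ?n \<le> \<mu> / 8 * ?n" by (intro mult_right_mono) auto
      then show ?thesis using t(2) Xu \<kappa> by simp
    qed
    moreover have "\<mu> * ?n = \<mu> / 2 * ?n + \<mu> / 2 * ?n" by simp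
    ultimately show ?thesis using 1 2 by linarith
  qed
qed

text \<open>The cardinalities at the levels \<open>u < card A\<close> sum to exactly
  \<open>(card A)\<^sup>2\<close>, which the lower bounds already nearly fill. By monotonicity an
  excess at \<open>T\<close> would persist over many following levels and overfill the
  total.\<close>

lemma near_periods_upper_bound:
  fixes \<mu> \<nu> :: real
  assumes A: "A \<subseteq> H" and low: "\<And>u. u < card A \<Longrightarrow> 2 * real u - \<mu> * real (card A) \<le> real (card (near_periods A u))"
    and \<nu>: "0 < \<nu>" "\<nu> \<le> 1" and \<mu>: "\<mu> = \<nu>\<^sup>2 / 32" and n: "32 / \<nu>\<^sup>2 \<le> real (card A)"
    and T: "2 * T \<le> card A"
  shows "real (card (near_periods A T)) \<le> 2 * real T + \<nu> * real (card A)"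
proof -
  let ?n = "real (card A)"
  \<comment> \<open>Over \<open>w\<close> levels the line \<open>2 * u\<close> climbs by at most
    \<open>\<nu> / 2 * ?n\<close>, half of the excess to be refuted.\<close>
  define w where "w = nat \<lfloor>\<nu> / 4 * ?n\<rfloor>"
  have "\<nu>\<^sup>2 \<le> \<nu>" using \<nu> by (simp add: power2_eq_square mult_left_le)
  have n': "32 \<le> \<nu>\<^sup>2 * ?n" using n \<nu> by (simp add: pos_divide_le_eq mult.commute)
  have "\<nu>\<^sup>2 * ?n \<le> \<nu> * ?n" using \<open>\<nu>\<^sup>2 \<le> \<nu>\<close> by (intro mult_right_mono) auto
  then have n'': "32 \<le> \<nu> * ?n" using n' by linarith
  have w: "real w \<le> \<nu> / 4 * ?n" "\<nu> / 8 * ?n \<le> real w"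
    unfolding w_def using n'' by linarith+
  have "\<nu> * ?n \<le> 1 * ?n" using \<nu> by (intro mult_right_mono) auto
  then have "real w \<le> ?n / 4" using w by linarith
  then have Tw: "T + w \<le> card A" using T by linarith
  let ?g = "\<lambda>u. real (card (near_periods A u)) - 2 * real u + \<mu> * ?n"
  let ?c = "real (card (near_periods A T)) - 2 * real T - 2 * real w"
  have "real w * ?c = (\<Sum>u\<in>{T..<T + w}. ?c)" by simp
  also have "\<dots> \<le> (\<Sum>u\<in>{T..<T + w}. ?g u)"
  proof (rule sum_mono)
    fix u assume u: "u \<in> {T..<T + w}"
    then have "card (near_periods A T) \<le> card (near_periods A u)"
      by (intro card_mono near_periods_mono finite_subset_H[OF near_periods_subset_H]) auto
    moreover have "real u \<le> real T + real w" using u by simp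
    moreover have "0 \<le> \<mu> * ?n" unfolding \<mu> by simp
    ultimately show "?c \<le> ?g u" by linarith
  qed
  also have "\<dots> \<le> (\<Sum>u<card A. ?g u)"
    using low Tw by (intro sum_mono2) (auto simp: algebra_simps)
  also have "\<dots> = real (\<Sum>u<card A. card (near_periods A u)) - 2 * (\<Sum>u<card A. real u) + ?n * (\<mu> * ?n)"
    by (simp add: sum.distrib sum_subtractf sum_distrib_left)
  also have "real (\<Sum>u<card A. card (near_periods A u)) = ?n\<^sup>2"
    using sum_card_near_periods[OF A] by simp
  also have "2 * (\<Sum>u<card A. real u) = ?n * (?n - 1)"
  proof -
    have "2 * (\<Sum>u<m. real u) = real m * (real m - 1)" for m
      by (induction m) (auto simp: algebra_simps)
    then show ?thesis .
  qed
  also have "?n\<^sup>2 - ?n * (?n - 1) + ?n * (\<mu> * ?n) = ?n * (1 + \<mu> * ?n)"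
    by (simp add: power2_eq_square algebra_simps)
  finally have 1: "real w * ?c \<le> ?n * (1 + \<mu> * ?n)" .
  show ?thesis
  proof (rule ccontr)
    assume contra: "\<not> ?thesis"
    have sq: "\<nu> / 8 * ?n * (\<nu> / 2 * ?n) = ?n * (\<nu>\<^sup>2 * ?n / 16)" by (simp add: power2_eq_square)
    have npos: "?n > 0" using n'' by (intro of_nat_0_less_iff[THEN iffD2]) (auto intro!: gr0I)
    have "\<nu> / 8 * ?n * (\<nu> / 2 * ?n) < real w * ?c"
    proof -
      have "\<nu> / 2 * ?n < ?c" using contra w by linarith
      then show ?thesis using w n'' \<nu> by (intro mult_le_less_imp_less) auto
    qed
    then have "?n * (\<nu>\<^sup>2 * ?n / 16) < ?n * (1 + \<mu> * ?n)" using 1 sq by linarith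
    then have "\<nu>\<^sup>2 * ?n / 16 < 1 + \<mu> * ?n" using npos by (simp only: mult_less_cancel_left_pos)
    moreover have "\<mu> * ?n = \<nu>\<^sup>2 * ?n / 32" unfolding \<mu> by simp
    ultimately show False using n' by linarith
  qed
qed

end

theorem near_periods_linear_growth:
  fixes \<beta> \<nu> :: real
  assumes \<beta>: "0 < \<beta>" "\<beta> < 1" and \<nu>: "0 < \<nu>" "\<nu> \<le> 1"
  shows "\<exists>\<epsilon>>0. \<exists>N. \<forall>p (\<iota> :: int \<Rightarrow> 'a::ab_group_add) A S. prime_cyclic p \<iota> \<longrightarrow> A \<subseteq> prime_cyclic.H \<iota> \<longrightarrow>
    S \<subseteq> prime_cyclic.H \<iota> \<longrightarrow> critical A A S \<epsilon> \<longrightarrow> N \<le> real (card A) \<longrightarrow>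
    real (card A) \<le> (1 - \<beta>) * real p / 2 \<longrightarrow>
    (\<forall>T. 2 * T \<le> card A \<longrightarrow> \<bar>real (card (prime_cyclic.near_periods \<iota> A T)) - 2 * real T\<bar> \<le> \<nu> * real (card A))"
proof -
  define \<mu> where "\<mu> = \<nu>\<^sup>2 / 32"
  define \<kappa> where "\<kappa> = \<mu> / 8"
  define \<epsilon>' where "\<epsilon>' = \<mu> * \<kappa>\<^sup>2 / 576"
  have \<nu>2: "\<nu>\<^sup>2 \<le> \<nu>" using \<nu> by (simp add: power2_eq_square mult_left_le)
  have \<mu>: "0 < \<mu>" "\<mu> \<le> 1" "\<mu> \<le> \<nu>" using \<nu> \<nu>2 by (auto simp: \<mu>_def)
  have \<kappa>: "0 < \<kappa>" "\<kappa> \<le> 1" using \<mu> by (auto simp: \<kappa>_def)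
  have \<epsilon>': "0 < \<epsilon>'" using \<mu> \<kappa> by (simp add: \<epsilon>'_def)
  obtain \<epsilon> N where \<epsilon>: "\<epsilon> > 0" and N: "\<forall>p (\<iota> :: int \<Rightarrow> 'a) A S. prime_cyclic p \<iota> \<longrightarrow> A \<subseteq> prime_cyclic.H \<iota> \<longrightarrow>
    S \<subseteq> prime_cyclic.H \<iota> \<longrightarrow> critical A A S \<epsilon> \<longrightarrow> N \<le> real (card A) \<longrightarrow>
    real (card A) \<le> (1 - \<beta>) * real p / 2 \<longrightarrow>
    (\<exists>X'\<subseteq>prime_cyclic.H \<iota>. \<exists>S'\<subseteq>prime_cyclic.H \<iota>. critical A X' S' \<epsilon>' \<and>
      \<kappa>\<^sup>2 / 24 * real (card A) \<le> real (card X') \<and> real (card X') \<le> \<kappa> * real (card A))"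
    using ex_small_critical[OF \<beta> \<kappa> \<epsilon>', where 'a = 'a] by (elim exE conjE) (rule that)
  define M where "M = max N (max (192 / (\<kappa>\<^sup>2 * \<mu>)) (32 / \<nu>\<^sup>2))"
  show ?thesis
  proof (rule exI[of _ \<epsilon>], rule conjI, rule \<epsilon>, rule exI[of _ M], intro allI impI)
    fix p and \<iota> :: "int \<Rightarrow> 'a" and A S T
    assume pc: "prime_cyclic p \<iota>" and A: "A \<subseteq> prime_cyclic.H \<iota>" and S: "S \<subseteq> prime_cyclic.H \<iota>"
      and crit: "critical A A S \<epsilon>" and M: "M \<le> real (card A)"
      and np: "real (card A) \<le> (1 - \<beta>) * real p / 2" and T: "2 * T \<le> card A"
    interpret prime_cyclic p \<iota> by fact
    have n: "N \<le> real (card A)" "192 / (\<kappa>\<^sup>2 * \<mu>) \<le> real (card A)" "32 / \<nu>\<^sup>2 \<le> real (card A)"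
      using M by (simp_all only: M_def max.bounded_iff)
    have "(1 - \<beta>) * real p \<le> 1 * real p" using \<beta> by (intro mult_right_mono) auto
    then have "2 * real (card A) \<le> real p" using np by linarith
    then have np2: "2 * card A \<le> p" by linarith
    obtain X S' where X: "X \<subseteq> H" "S' \<subseteq> H" "critical A X S' \<epsilon>'"
      "\<kappa>\<^sup>2 / 24 * real (card A) \<le> real (card X)" "real (card X) \<le> \<kappa> * real (card A)"
      using N[rule_format, OF pc A S crit n(1) np] by blast
    have low: "2 * real u - \<mu> * real (card A) \<le> real (card (near_periods A u))" if "u < card A" for u
      by (rule near_periods_lower_bound[OF A X(1-3) \<mu>(1,2) \<kappa>_def \<epsilon>'_def n(2) np2 X(4,5) that])
    have "0 < 32 / \<nu>\<^sup>2" using \<nu> by simp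
    then have "card A > 0" using n(3) by linarith
    then have "2 * real T - \<mu> * real (card A) \<le> real (card (near_periods A T))" using T by (intro low) auto
    moreover have "\<mu> * real (card A) \<le> \<nu> * real (card A)" using \<mu> by (intro mult_right_mono) auto
    moreover have "real (card (near_periods A T)) \<le> 2 * real T + \<nu> * real (card A)"
      by (rule near_periods_upper_bound[OF A low \<nu> \<mu>_def n(3) T])
    ultimately show "\<bar>real (card (near_periods A T)) - 2 * real T\<bar> \<le> \<nu> * real (card A)" by linarith
  qed
qed

section \<open>Concentration of the near periods in Fourier space\<close>

text \<open>Orthogonality of characters in real form; cosines suffice because the autocorrelation is
  even.\<close>

lemma sum_cos_orthogonality:
  assumes "p > 0"
  shows "(\<Sum>r<p. cos (2 * pi * real r * real_of_int j / real p)) = (if int p dvd j then real p else 0)"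
proof -
  define w where "w = cis (2 * pi * real_of_int j / real p)"
  have pw: "w ^ r = cis (2 * pi * real r * real_of_int j / real p)" for r
    unfolding w_def Complex.DeMoivre by (simp add: algebra_simps)
  have "(\<Sum>r<p. cos (2 * pi * real r * real_of_int j / real p)) = Re (\<Sum>r<p. w ^ r)"
    by (simp add: pw)
  also have "\<dots> = (if int p dvd j then real p else 0)"
  proof (cases "int p dvd j")
    case True
    then obtain i where "j = int p * i" by auto
    then have "2 * pi * real_of_int j / real p = 2 * pi * real_of_int i" using assms by simp
    then have "w = cis (2 * pi * real_of_int i)" by (simp only: w_def)
    also have "\<dots> = 1" by (rule cis_multiple_2pi) simp
    finally show ?thesis using True by simp
  next
    case False
    have "w \<noteq> 1"
    proof
      assume "w = 1"
      then have "cos (2 * pi * real_of_int j / real p) = 1" by (simp add: w_def complex_eq_iff)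
      then obtain i :: int where "2 * pi * real_of_int j / real p = real_of_int i * 2 * pi"
        by (auto simp: cos_one_2pi_int)
      then have "real_of_int j = real_of_int (i * int p)" using assms by (simp add: field_simps)
      then have "j = i * int p" by (simp only: of_int_eq_iff)
      then show False using False by simp
    qed
    moreover have "w ^ p = 1"
    proof -
      have "2 * pi * real p * real_of_int j / real p = 2 * pi * real_of_int j" using assms by simp
      then show ?thesis by (simp only: pw cis_multiple_2pi Ints_of_int)
    qed
    ultimately have "(\<Sum>r<p. w ^ r) = 0" by (simp add: geometric_sum)
    then show ?thesis using False by simp
  qed
  finally show ?thesis .
qed

lemma cos_le_away_from_0:
  assumes "pi / 4 \<le> x" "x \<le> 2 * pi - pi / 4" shows "cos x \<le> 71 / 100"
proof -
  have "cos (pi / 4) \<le> 71 / 100"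
  proof -
    have "sqrt 2 \<le> 142 / 100" by (rule real_le_lsqrt) (auto simp: power2_eq_square)
    then show ?thesis by (simp add: cos_45)
  qed
  moreover have "cos x \<le> cos (pi / 4)"
  proof (cases "x \<le> pi")
    case True then show ?thesis using assms by (intro cos_monotone_0_pi_le) auto
  next
    case False
    have "cos x = cos (2 * pi - x)" by (simp add: cos_diff)
    also have "\<dots> \<le> cos (pi / 4)" using False assms by (intro cos_monotone_0_pi_le) auto
    finally show ?thesis .
  qed
  ultimately show ?thesis by linarith
qed

context prime_cyclic
begin

lemma rescale:
  assumes "coprime m (int p)"
  shows "prime_cyclic p (\<lambda>k. \<iota> (m * k))" and "prime_cyclic.H (\<lambda>k. \<iota> (m * k)) = H"
proof -
  show *: "prime_cyclic p (\<lambda>k. \<iota> (m * k))"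
  proof
    show "prime p" by (rule prime)
    show "\<iota> (m * (j + k)) = \<iota> (m * j) + \<iota> (m * k)" for j k by (simp add: distrib_left hom_add)
    show "\<iota> (m * k) = 0 \<longleftrightarrow> int p dvd k" for k
      using assms by (simp add: ker coprime_commute coprime_dvd_mult_right_iff)
  qed
  interpret M: prime_cyclic p "\<lambda>k. \<iota> (m * k)" by (rule *)
  have "M.H \<subseteq> H" by (auto simp: M.H_def)
  then show "M.H = H" using card_subset_eq[OF finite_H, of M.H] by simp
qed

lemma residues_inj: "inj_on \<iota> {k \<in> {0..<int p}. P k}"
  by (rule inj_on_hom) auto

lemma residues_image: "X \<subseteq> H \<Longrightarrow> \<iota> ` {k \<in> {0..<int p}. \<iota> k \<in> X} = X"
proof safe
  fix x assume "X \<subseteq> H" "x \<in> X"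
  then obtain k where "x = \<iota> k" by (blast elim: H_cases)
  then have "x = \<iota> (k mod int p)" "k mod int p \<in> {0..<int p}" using p_pos by (auto simp: hom_mod)
  then show "x \<in> \<iota> ` {k \<in> {0..<int p}. \<iota> k \<in> X}" using \<open>x \<in> X\<close> by auto
qed

lemma card_residues: "X \<subseteq> H \<Longrightarrow> card {k \<in> {0..<int p}. \<iota> k \<in> X} = card X"
  using card_image[OF residues_inj[of "\<lambda>k. \<iota> k \<in> X"]] residues_image by metis

text \<open>In the proof \<open>W r\<close> is the squared modulus of the Fourier coefficient of
  \<open>A\<close> at \<open>r\<close>, and \<open>C r\<close> is the cosine sum over
  \<open>M\<close>. The sum of \<open>C r * W r\<close> is \<open>p\<close> times the total
  autocorrelation on \<open>M\<close>, hence at least \<open>p * card M * (card A - T)\<close>. The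
  weights have total \<open>p * card A\<close> with \<open>W 0 = (card A)\<^sup>2\<close>; were
  every other \<open>C r\<close> below the claimed bound,
  \<open>T * (p - 2 * card A) \<le> 0\<close> would follow.\<close>

lemma ex_large_cosine_sum:
  assumes A: "A \<subseteq> H" and n: "2 * card A < p" and M: "M \<subseteq> H" "M \<noteq> {}"
    and esc: "\<And>e. e \<in> M \<Longrightarrow> escape A e \<le> T" and T: "T > 0" and A0: "A \<noteq> {}"
  shows "\<exists>r\<in>{1..<p}. (1 - 2 * real T / real (card A)) * real (card M)
    \<le> (\<Sum>k\<in>{k \<in> {0..<int p}. \<iota> k \<in> M}. cos (2 * pi * real r * real_of_int k / real p))"
proof (rule ccontr)
  assume contra: "\<not> ?thesis"
  note fin = finite_subset_H[OF A] finite_subset_H[OF M(1)]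
  let ?c = "\<lambda>r j. cos (2 * pi * real r * real_of_int j / real p)"
  let ?s = "\<lambda>r j. sin (2 * pi * real r * real_of_int j / real p)"
  define A' M' where "A' = {k \<in> {0..<int p}. \<iota> k \<in> A}" and "M' = {k \<in> {0..<int p}. \<iota> k \<in> M}"
  have cards: "card A' = card A" "card M' = card M"
    unfolding A'_def M'_def using A M card_residues by auto
  have finA': "finite A'" and finM': "finite M'"
    unfolding A'_def M'_def by (rule finite_subset[of _ "{0..<int p}"]; auto)+
  let ?n = "real (card A)" and ?m = "real (card M)" and ?p = "real p"
  have pos: "?n > 0" "?m > 0" using A0 M fin by (auto simp: card_gt_0_iff)
  define W C where "W = (\<lambda>r. \<Sum>a\<in>A'. \<Sum>b\<in>A'. ?c r (a - b))" and "C = (\<lambda>r. \<Sum>k\<in>M'. ?c r k)"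
  have split: "?c r (a - b) = ?c r a * ?c r b + ?s r a * ?s r b" for r a b
    by (simp add: right_diff_distrib diff_divide_distrib cos_diff)
  have W: "W r = (\<Sum>a\<in>A'. ?c r a)\<^sup>2 + (\<Sum>a\<in>A'. ?s r a)\<^sup>2" for r
    unfolding W_def split sum.distrib power2_eq_square sum_product ..
  have W_nonneg: "W r \<ge> 0" for r unfolding W by simp
  have W0: "W 0 = ?n\<^sup>2" and C0: "C 0 = ?m" by (simp_all add: W_def C_def cards power2_eq_square)
  have count: "(\<Sum>a\<in>A'. if int p dvd a - j then real p else 0) = (if \<iota> j \<in> A then ?p else 0)" for j
  proof -
    have "int p dvd a - j \<longleftrightarrow> a = j mod int p" if "a \<in> A'" for a
      using that by (auto simp: A'_def mod_eq_dvd_iff[symmetric])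
    then have "(\<Sum>a\<in>A'. if int p dvd a - j then real p else 0) = (\<Sum>a\<in>A'. if a = j mod int p then real p else 0)"
      by (intro sum.cong) auto
    also have "\<dots> = (if j mod int p \<in> A' then ?p else 0)" using finA' by simp
    also have "j mod int p \<in> A' \<longleftrightarrow> \<iota> j \<in> A" using p_pos by (simp add: A'_def hom_mod)
    finally show ?thesis .
  qed
  have sumW: "(\<Sum>r<p. W r) = ?p * ?n"
  proof -
    have "(\<Sum>r<p. W r) = (\<Sum>b\<in>A'. \<Sum>a\<in>A'. \<Sum>r<p. ?c r (a - b))"
      unfolding W_def by (subst sum.swap, subst sum.swap, intro sum.cong refl, rule sum.swap)
    also have "\<dots> = (\<Sum>b\<in>A'. if \<iota> b \<in> A then ?p else 0)"
      unfolding sum_cos_orthogonality[OF p_pos] count ..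
    also have "\<dots> = (\<Sum>b\<in>A'. ?p)" by (intro sum.cong) (auto simp: A'_def)
    finally show ?thesis using cards by simp
  qed
  have inner: "(\<Sum>r<p. ?c r k * W r) = ?p * real (autocorr A (\<iota> k))" for k
  proof -
    \<comment> \<open>Product-to-sum formula: the two resulting terms count the returns of
      \<open>A\<close> under \<open>k\<close> and \<open>- k\<close>, which agree.\<close>
    have cc: "?c r k * ?c r (a - b) = (?c r (a - (b + k)) + ?c r (a - (b - k))) / 2" for r a b
    proof -
      let ?x = "2 * pi * real r * real_of_int k / ?p" and ?y = "2 * pi * real r * real_of_int (a - b) / ?p"
      have "2 * pi * real r * real_of_int (a - (b + k)) / ?p = ?y - ?x"
        "2 * pi * real r * real_of_int (a - (b - k)) / ?p = ?y + ?x"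
        by (simp_all add: algebra_simps diff_divide_distrib add_divide_distrib)
      then show ?thesis by (simp only: cos_diff cos_add) simp
    qed
    have shift: "(\<Sum>b\<in>A'. if \<iota> (b + j) \<in> A then ?p else 0) = ?p * real (autocorr A (\<iota> j))" for j
    proof -
      have "(\<Sum>b\<in>A'. if \<iota> (b + j) \<in> A then ?p else 0) = ?p * real (card {b \<in> A'. \<iota> (b + j) \<in> A})"
        using finA' by (simp add: sum.If_cases Int_def)
      also have "{b \<in> A'. \<iota> (b + j) \<in> A} = {b \<in> {0..<int p}. \<iota> b \<in> {a \<in> A. a + \<iota> j \<in> A}}"
        by (auto simp: A'_def hom_add)
      also have "card \<dots> = autocorr A (\<iota> j)" unfolding autocorr_def using A by (intro card_residues) auto
      finally show ?thesis .
    qed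
    have "(\<Sum>r<p. ?c r k * W r) = (\<Sum>b\<in>A'. \<Sum>a\<in>A'. \<Sum>r<p. ?c r k * ?c r (a - b))"
      unfolding W_def sum_distrib_left by (subst sum.swap, subst sum.swap, intro sum.cong refl, rule sum.swap)
    also have "\<dots> = (\<Sum>b\<in>A'. ((\<Sum>a\<in>A'. \<Sum>r<p. ?c r (a - (b + k))) + (\<Sum>a\<in>A'. \<Sum>r<p. ?c r (a - (b - k)))) / 2)"
      unfolding cc by (simp only: sum.distrib sum_divide_distrib[symmetric])
    also have "\<dots> = ((\<Sum>b\<in>A'. if \<iota> (b + k) \<in> A then ?p else 0) + (\<Sum>b\<in>A'. if \<iota> (b + - k) \<in> A then ?p else 0)) / 2"
      unfolding sum_cos_orthogonality[OF p_pos] count by (simp only: sum.distrib sum_divide_distrib[symmetric] diff_conv_add_uminus)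
    also have "\<dots> = ?p * real (autocorr A (\<iota> k))"
      unfolding shift by (simp add: hom_uminus autocorr_uminus)
    finally show ?thesis .
  qed
  have "?m * (?p * (?n - real T)) = (\<Sum>k\<in>M'. ?p * (?n - real T))" using cards by simp
  also have "\<dots> \<le> (\<Sum>k\<in>M'. ?p * real (autocorr A (\<iota> k)))"
  proof (intro sum_mono mult_left_mono)
    fix k assume "k \<in> M'"
    then have "escape A (\<iota> k) \<le> T" using esc by (auto simp: M'_def)
    then show "?n - real T \<le> real (autocorr A (\<iota> k))"
      using autocorr_add_escape[OF fin(1), of "\<iota> k"] by linarith
  qed simp
  also have "\<dots> = (\<Sum>r<p. C r * W r)"
    unfolding inner[symmetric] C_def sum_distrib_right by (rule sum.swap)
  also have "\<dots> = C 0 * W 0 + (\<Sum>r\<in>{1..<p}. C r * W r)"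
  proof -
    have "{..<p} = insert 0 {1..<p}" using p_pos by auto
    then show ?thesis by simp
  qed
  also have "\<dots> \<le> C 0 * W 0 + (\<Sum>r\<in>{1..<p}. ((1 - 2 * real T / ?n) * ?m) * W r)"
  proof -
    have "C r \<le> (1 - 2 * real T / ?n) * ?m" if "r \<in> {1..<p}" for r
      using contra that unfolding C_def M'_def by (meson linear)
    then show ?thesis by (intro add_left_mono sum_mono mult_right_mono W_nonneg)
  qed
  also have "(\<Sum>r\<in>{1..<p}. ((1 - 2 * real T / ?n) * ?m) * W r) = ((1 - 2 * real T / ?n) * ?m) * (?p * ?n - ?n\<^sup>2)"
  proof -
    have "{..<p} = insert 0 {1..<p}" using p_pos by auto
    then have "(\<Sum>r\<in>{1..<p}. W r) = ?p * ?n - ?n\<^sup>2" using sumW W0 by simp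
    then show ?thesis unfolding sum_distrib_left[symmetric] by simp
  qed
  also have "C 0 * W 0 + ((1 - 2 * real T / ?n) * ?m) * (?p * ?n - ?n\<^sup>2) = ?m * (?p * ?n - 2 * real T * (?p - ?n))"
    unfolding W0 C0 using pos by (simp add: field_simps power2_eq_square)
  finally have "?p * (?n - real T) \<le> ?p * ?n - 2 * real T * (?p - ?n)"
    using pos by (simp only: mult_le_cancel_left_pos)
  then have "real T * (?p - 2 * ?n) \<le> 0" by (simp add: algebra_simps)
  moreover have "real T * (?p - 2 * ?n) > 0"
  proof (rule mult_pos_pos)
    have "real (2 * card A) < ?p" using n by (simp only: of_nat_less_iff)
    then show "?p - 2 * ?n > 0" by simp
  qed (use T in simp)
  ultimately show False by linarith
qed

text \<open>Dilating by the inverse \<open>m\<close> of the frequency \<open>r\<close> reduces to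
  frequency 1, where a point at distance at least \<open>p / 8\<close> from 0 contributes at most
  71/100 instead of 1. A deficit of \<open>2 * T / card A\<close> therefore allows at most the
  proportion \<open>2 / 0.29 < 7\<close> times \<open>T / card A\<close> of such points.\<close>

lemma ex_concentrated_rescaling:
  assumes A: "A \<subseteq> H" and n: "2 * card A < p" and M: "M \<subseteq> H" "M \<noteq> {}"
    and esc: "\<And>e. e \<in> M \<Longrightarrow> escape A e \<le> T" and T: "T > 0" and A0: "A \<noteq> {}"
  shows "\<exists>m. coprime m (int p) \<and>
    (1 - 7 * real T / real (card A)) * real (card M) \<le> real (card {k. 8 * \<bar>k\<bar> < int p \<and> \<iota> (m * k) \<in> M})"
proof -
  note fin = finite_subset_H[OF A] finite_subset_H[OF M(1)]
  obtain r where r: "1 \<le> r" "r < p" and sum: "(1 - 2 * real T / real (card A)) * real (card M)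
    \<le> (\<Sum>k\<in>{k \<in> {0..<int p}. \<iota> k \<in> M}. cos (2 * pi * real r * real_of_int k / real p))"
    using ex_large_cosine_sum[OF assms] by auto
  have "\<not> int p dvd int r" using r by (auto dest: zdvd_imp_le)
  then have "coprime (int r) (int p)" using prime
    by (metis coprime_commute prime_imp_coprime prime_nat_int_transfer)
  then obtain m where m: "[int r * m = 1] (mod int p)" using cong_solve_coprime_int by blast
  then have cop: "coprime m (int p)"
    by (metis coprime_iff_invertible_int mult.commute)
  define M' where "M' = {k \<in> {0..<int p}. \<iota> k \<in> M}"
  define G where "G = {k \<in> M'. 8 * ((int r * k) mod int p) < int p \<or> 8 * ((int r * k) mod int p) > 7 * int p}"
  define R where "R = {k. 8 * \<bar>k\<bar> < int p \<and> \<iota> (m * k) \<in> M}"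
  have finM': "finite M'" unfolding M'_def by (rule finite_subset[of _ "{0..<int p}"]) auto
  have cM': "card M' = card M" unfolding M'_def by (rule card_residues[OF M(1)])
  have finR: "finite R" by (rule finite_subset[of _ "{- int p..int p}"]) (auto simp: R_def)
  have "G \<subseteq> M'" by (auto simp: G_def)
  have "card G \<le> card R"
  proof (rule card_inj_on_le)
    \<comment> \<open>For \<open>k\<close> in \<open>G\<close> this is the representative of
      \<open>r * k\<close> modulo \<open>p\<close> nearest to 0.\<close>
    let ?f = "\<lambda>k. if 8 * ((int r * k) mod int p) < int p then (int r * k) mod int p else (int r * k) mod int p - int p"
    have f_mod: "[?f k = int r * k] (mod int p)" for k by (simp add: cong_def)
    have f_inv: "\<iota> (m * ?f k) = \<iota> k" for k
    proof -
      have "m * (int r * k) = (int r * m) * k" by (simp only: ac_simps)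
      moreover have "[m * ?f k = m * (int r * k)] (mod int p)" by (rule cong_scalar_left[OF f_mod])
      moreover have "[(int r * m) * k = 1 * k] (mod int p)" by (rule cong_scalar_right[OF m])
      ultimately have "[m * ?f k = k] (mod int p)" using cong_trans by (simp only: mult_1) blast
      then show ?thesis unfolding hom_eq_iff by (simp only: cong_iff_dvd_diff)
    qed
    show "inj_on ?f G"
    proof (rule inj_onI)
      fix j k assume jk: "j \<in> G" "k \<in> G" "?f j = ?f k"
      have "\<iota> j = \<iota> k" using f_inv[of j] f_inv[of k] jk(3) by simp
      then show "j = k" using jk(1,2) residues_inj[of "\<lambda>k. \<iota> k \<in> M"] unfolding G_def M'_def inj_on_def by blast
    qed
    show "?f ` G \<subseteq> R"
    proof (rule image_subsetI)
      fix k assume k: "k \<in> G"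
      have "\<iota> (m * ?f k) \<in> M" using f_inv k by (simp only: G_def M'_def mem_Collect_eq)
      moreover have "8 * \<bar>?f k\<bar> < int p"
      proof -
        have "0 \<le> (int r * k) mod int p" "(int r * k) mod int p < int p" using p_pos by auto
        then show ?thesis using k by (auto simp: G_def)
      qed
      ultimately show "?f k \<in> R" unfolding R_def by blast
    qed
    show "finite R" by (rule finR)
  qed
  have "(\<Sum>k\<in>M'. cos (2 * pi * real r * real_of_int k / real p)) \<le> (\<Sum>k\<in>M'. if k \<in> G then 1 else 71 / 100)"
  proof (rule sum_mono)
    fix k assume "k \<in> M'"
    show "cos (2 * pi * real r * real_of_int k / real p) \<le> (if k \<in> G then 1 else 71 / 100)"
    proof (cases "k \<in> G")
      case False
      let ?j = "(int r * k) mod int p" and ?i = "(int r * k) div int p"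
      have j: "int p \<le> 8 * ?j" "8 * ?j \<le> 7 * int p" using False \<open>k \<in> M'\<close> by (auto simp: G_def)
      then have "real_of_int (int p) \<le> real_of_int (8 * ?j)" "real_of_int (8 * ?j) \<le> real_of_int (7 * int p)"
        by (simp_all only: of_int_le_iff)
      then have jr: "real p \<le> 8 * real_of_int ?j" "8 * real_of_int ?j \<le> 7 * real p" by simp_all
      have "int r * k = int p * ?i + ?j" by simp
      then have "real_of_int (int r * k) = real_of_int (int p * ?i + ?j)" by simp
      then have rk: "real r * real_of_int k = real p * real_of_int ?i + real_of_int ?j"
        by (simp only: of_int_mult of_int_add of_int_of_nat_eq)
      have "2 * pi * real r * real_of_int k / real p = 2 * pi * (real p * real_of_int ?i + real_of_int ?j) / real p"
        unfolding rk[symmetric] by simp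
      also have "\<dots> = 2 * pi * real_of_int ?j / real p + 2 * pi * real_of_int ?i"
        using p_pos by (simp add: field_simps)
      finally have "cos (2 * pi * real r * real_of_int k / real p) = cos (2 * pi * real_of_int ?j / real p)"
        by (simp only: cos_add cos_int_2pin sin_int_2pin mult_1_right mult_zero_right diff_zero)
      also have "\<dots> \<le> 71 / 100"
      proof (rule cos_le_away_from_0)
        have "pi * real p \<le> pi * (8 * real_of_int ?j)" "pi * (8 * real_of_int ?j) \<le> pi * (7 * real p)"
          using jr by (intro mult_left_mono; simp)+
        then show "pi / 4 \<le> 2 * pi * real_of_int ?j / real p"
          "2 * pi * real_of_int ?j / real p \<le> 2 * pi - pi / 4"
          using p_pos by (simp_all add: field_simps)
      qed
      finally show ?thesis using False by simp
    qed simp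
  qed
  also have "\<dots> = real (card G) + 71 / 100 * (real (card M) - real (card G))"
  proof -
    have "M' \<inter> G = G" "M' \<inter> {k. k \<notin> G} = M' - G" using \<open>G \<subseteq> M'\<close> by auto
    moreover have "card G \<le> card M'" using \<open>G \<subseteq> M'\<close> finM' by (rule card_mono[rotated])
    ultimately show ?thesis using finM' finite_subset[OF \<open>G \<subseteq> M'\<close> finM'] cM' \<open>G \<subseteq> M'\<close>
      by (simp add: sum.If_cases card_Diff_subset of_nat_diff Compl_eq Int_def)
  qed
  finally have "(1 - 2 * real T / real (card A)) * real (card M)
      \<le> real (card G) + 71 / 100 * (real (card M) - real (card G))"
    using sum unfolding M'_def by linarith
  then have "real (card M) - 2 * (real T / real (card A) * real (card M))
      \<le> real (card G) + 71 / 100 * (real (card M) - real (card G))"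
    by (simp add: algebra_simps)
  moreover have "0 \<le> real T / real (card A) * real (card M)" by simp
  moreover have "real (card G) \<le> real (card R)" using \<open>card G \<le> card R\<close> by simp
  moreover have "m - 2 * u \<le> g + 71 / 100 * (m - g) \<Longrightarrow> 0 \<le> u \<Longrightarrow> g \<le> r \<Longrightarrow> m - 7 * u \<le> r"
    for m u g r :: real by argo
  ultimately have "real (card M) - 7 * (real T / real (card A) * real (card M)) \<le> real (card R)" by blast
  then have "(1 - 7 * real T / real (card A)) * real (card M) \<le> real (card R)" by (simp add: algebra_simps)
  then show ?thesis using cop unfolding R_def by blast
qed

end

section \<open>Near periods forming a long progression\<close>

text \<open>In each residue class modulo \<open>L\<close> that meets \<open>W\<close>, the largest
  element plus \<open>L\<close> and the smallest minus \<open>L\<close> are new, and all of these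
  are distinct.\<close>

lemma card_Un_shifts_ge:
  fixes W :: "int set"
  assumes fin: "finite W" and L: "L > 0"
  shows "card W + 2 * card ((\<lambda>k. k mod L) ` W) \<le> card (W \<union> (\<lambda>w. w + L) ` W \<union> (\<lambda>w. w - L) ` W)"
proof -
  let ?R = "(\<lambda>k. k mod L) ` W" and ?F = "\<lambda>\<rho>. {w \<in> W. w mod L = \<rho>}"
  define f g where "f = (\<lambda>\<rho>. Max (?F \<rho>) + L)" and "g = (\<lambda>\<rho>. Min (?F \<rho>) - L)"
  have F: "finite (?F \<rho>)" for \<rho> using fin by simp
  have ne: "?F \<rho> \<noteq> {}" if "\<rho> \<in> ?R" for \<rho> using that by auto
  have mx: "Max (?F \<rho>) \<in> W" "Max (?F \<rho>) mod L = \<rho>" if "\<rho> \<in> ?R" for \<rho>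
    using Max_in[OF F ne[OF that]] by auto
  have mn: "Min (?F \<rho>) \<in> W" "Min (?F \<rho>) mod L = \<rho>" if "\<rho> \<in> ?R" for \<rho>
    using Min_in[OF F ne[OF that]] by auto
  have le: "Min (?F \<rho>) \<le> w" "w \<le> Max (?F \<rho>)" if "w \<in> W" "w mod L = \<rho>" for w \<rho>
    using that F by (auto intro!: Min_le Max_ge)
  have fm: "f \<rho> mod L = \<rho>" "g \<rho> mod L = \<rho>" if "\<rho> \<in> ?R" for \<rho>
    using mx[OF that] mn[OF that] by (simp_all add: f_def g_def)
  have inj: "inj_on f ?R" "inj_on g ?R"
    by (rule inj_onI, metis fm(1)) (rule inj_onI, metis fm(2))
  have fW: "f \<rho> \<notin> W" "g \<rho> \<notin> W" if "\<rho> \<in> ?R" for \<rho>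
    using le[of "f \<rho>" \<rho>] le[of "g \<rho>" \<rho>] fm[OF that] L by (auto simp: f_def g_def)
  have fg: "f \<rho> \<noteq> g \<sigma>" if "\<rho> \<in> ?R" "\<sigma> \<in> ?R" for \<rho> \<sigma>
  proof
    assume "f \<rho> = g \<sigma>"
    then have "\<rho> = \<sigma>" using fm that by metis
    then show False using \<open>f \<rho> = g \<sigma>\<close> le(1)[OF mx[OF that(1)]] L by (simp add: f_def g_def)
  qed
  have "card W + 2 * card ?R = card W + (card (f ` ?R) + card (g ` ?R))"
    using inj by (simp add: card_image)
  also have "card (f ` ?R) + card (g ` ?R) = card (f ` ?R \<union> g ` ?R)"
    using fin fg by (intro card_Un_disjoint[symmetric]) auto
  also have "card W + \<dots> = card (W \<union> (f ` ?R \<union> g ` ?R))"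
    using fin fW by (intro card_Un_disjoint[symmetric]) auto
  also have "\<dots> \<le> card (W \<union> (\<lambda>w. w + L) ` W \<union> (\<lambda>w. w - L) ` W)"
  proof (rule card_mono)
    have "f \<rho> \<in> (\<lambda>w. w + L) ` W" "g \<rho> \<in> (\<lambda>w. w - L) ` W" if "\<rho> \<in> ?R" for \<rho>
      using mx(1)[OF that] mn(1)[OF that] unfolding f_def g_def by blast+
    then show "W \<union> (f ` ?R \<union> g ` ?R) \<subseteq> W \<union> (\<lambda>w. w + L) ` W \<union> (\<lambda>w. w - L) ` W" by blast
  qed (use fin in simp)
  finally show ?thesis .
qed

text \<open>Freiman's 3/2 argument modulo \<open>L\<close>. For \<open>d = a + b\<close> the
  translates of \<open>J\<close> by \<open>a\<close> and \<open>- b\<close> both lie in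
  \<open>J + J\<close>, so they overlap in more than half of their residues; hence
  \<open>x + d\<close> is again in \<open>J\<close> for more than half of the residues
  \<open>x\<close> of \<open>J\<close>. Two such \<open>d\<close> and \<open>e\<close> share an
  \<open>x\<close>, and \<open>d - e\<close> is then a difference of elements of \<open>J\<close>,
  by symmetry a sum.\<close>

lemma small_doubling_mod_closed:
  fixes J :: "int set"
  assumes fin: "finite J" and L: "L > 0" and sym: "\<And>j. j \<in> J \<Longrightarrow> - j \<in> J"
    and small: "2 * card ((\<lambda>k. k mod L) ` {a + b | a b. a \<in> J \<and> b \<in> J}) < 3 * card ((\<lambda>k. k mod L) ` J)"
    and d: "d mod L \<in> (\<lambda>k. k mod L) ` {a + b | a b. a \<in> J \<and> b \<in> J}" "e mod L \<in> (\<lambda>k. k mod L) ` {a + b | a b. a \<in> J \<and> b \<in> J}"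
  shows "(d - e) mod L \<in> (\<lambda>k. k mod L) ` {a + b | a b. a \<in> J \<and> b \<in> J}"
proof -
  let ?Q = "(\<lambda>k. k mod L) ` {a + b | a b. a \<in> J \<and> b \<in> J}" and ?R = "(\<lambda>k. k mod L) ` J"
  have "{a + b | a b. a \<in> J \<and> b \<in> J} = (\<lambda>(a, b). a + b) ` (J \<times> J)" by auto
  then have finQ: "finite ?Q" using fin by simp
  have finR: "finite ?R" using fin by simp
  have many: "2 * card {x \<in> ?R. (x + d) mod L \<in> ?R} > card ?R" if dQ: "d mod L \<in> ?Q" for d
  proof -
    obtain a b where ab: "a \<in> J" "b \<in> J" "d mod L = (a + b) mod L" using dQ by auto
    let ?S = "\<lambda>j. (\<lambda>x. (x + j) mod L) ` ?R"
    have "inj_on (\<lambda>x. (x + j) mod L) ?R" for j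
    proof (rule inj_onI)
      fix x y assume xy: "x \<in> ?R" "y \<in> ?R" "(x + j) mod L = (y + j) mod L"
      then have "x mod L = y mod L" by (metis add_diff_cancel mod_diff_left_eq)
      then show "x = y" using xy by auto
    qed
    then have cS: "card (?S j) = card ?R" for j by (simp add: card_image)
    have SQ: "?S j \<subseteq> ?Q" if "j \<in> J" for j
    proof -
      have "(i mod L + j) mod L \<in> ?Q" if "i \<in> J" for i
        using \<open>j \<in> J\<close> that by (auto simp: mod_add_left_eq intro!: image_eqI[of _ _ "i + j"])
      then show ?thesis by blast
    qed
    have "card (?S a) + card (?S (- b)) = card (?S a \<union> ?S (- b)) + card (?S a \<inter> ?S (- b))"
      using finR by (intro card_Un_Int) auto
    also have "card (?S a \<union> ?S (- b)) \<le> card ?Q"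
      using SQ[OF ab(1)] SQ[OF sym[OF ab(2)]] finQ by (intro card_mono) auto
    finally have "2 * card ?R \<le> card ?Q + card (?S a \<inter> ?S (- b))"
      using cS[of a] cS[of "- b"] by linarith
    also have "card (?S a \<inter> ?S (- b)) \<le> card ((\<lambda>x. (x + a) mod L) ` {x \<in> ?R. (x + d) mod L \<in> ?R})"
    proof (rule card_mono)
      show "?S a \<inter> ?S (- b) \<subseteq> (\<lambda>x. (x + a) mod L) ` {x \<in> ?R. (x + d) mod L \<in> ?R}"
      proof
        fix z assume "z \<in> ?S a \<inter> ?S (- b)"
        then obtain x y where xy: "x \<in> ?R" "z = (x + a) mod L" "y \<in> ?R" "z = (y + - b) mod L" by blast
        have "(x + d) mod L = (x + (a + b)) mod L" using ab(3) by (metis mod_add_right_eq)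
        also have "\<dots> = ((x + a) mod L + b) mod L" by (simp add: mod_add_left_eq add.assoc)
        also have "\<dots> = ((y + - b) mod L + b) mod L" using xy by simp
        also have "\<dots> = y mod L" by (simp add: mod_simps)
        also have "\<dots> = y" using xy(3) by auto
        finally show "z \<in> (\<lambda>x. (x + a) mod L) ` {x \<in> ?R. (x + d) mod L \<in> ?R}"
          using xy by blast
      qed
    qed (use finR in simp)
    also have "\<dots> \<le> card {x \<in> ?R. (x + d) mod L \<in> ?R}" using finR by (intro card_image_le) auto
    finally show ?thesis using small by linarith
  qed
  let ?D = "\<lambda>d. {x \<in> ?R. (x + d) mod L \<in> ?R}"
  have "?D d \<inter> ?D e \<noteq> {}"
  proof
    assume "?D d \<inter> ?D e = {}"
    then have "card (?D d) + card (?D e) = card (?D d \<union> ?D e)"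
      using finR by (intro card_Un_disjoint[symmetric]) auto
    also have "\<dots> \<le> card ?R" using finR by (intro card_mono) auto
    finally show False using many[OF d(1)] many[OF d(2)] by linarith
  qed
  then obtain x where "(x + d) mod L \<in> ?R" "(x + e) mod L \<in> ?R" by blast
  then obtain j k where jk: "j \<in> J" "(x + d) mod L = j mod L" "k \<in> J" "(x + e) mod L = k mod L" by auto
  have "(d - e) mod L = ((x + d) mod L - (x + e) mod L) mod L" by (simp add: mod_simps)
  also have "\<dots> = (j + - k) mod L" using jk by (simp add: mod_simps)
  finally show ?thesis using jk(1) sym[OF jk(3)] by blast
qed

lemma int_subgroup_eq_multiples:
  fixes S :: "int set"
  assumes "L \<in> S" "L > 0" and diff: "\<And>a b. a \<in> S \<Longrightarrow> b \<in> S \<Longrightarrow> a - b \<in> S"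
  shows "\<exists>q>0. S = {q * i | i. True}"
proof -
  have 0: "0 \<in> S" using diff[OF assms(1) assms(1)] by simp
  have neg: "- a \<in> S" if "a \<in> S" for a using diff[OF 0 that] by simp
  have add: "a + b \<in> S" if "a \<in> S" "b \<in> S" for a b using diff[OF that(1) neg[OF that(2)]] by simp
  have natmul: "a * int i \<in> S" if "a \<in> S" for a i
    by (induction i) (use 0 add that in \<open>auto simp: algebra_simps\<close>)
  have mul: "a * i \<in> S" if "a \<in> S" for a i
    using natmul[OF that, of "nat i"] neg[OF natmul[OF that, of "nat (- i)"]] by (cases "i \<ge> 0") auto
  define q0 where "q0 = (LEAST k. k > 0 \<and> int k \<in> S)"
  have ex: "nat L > 0 \<and> int (nat L) \<in> S" using assms by simp
  have q: "q0 > 0" "int q0 \<in> S" using LeastI[of "\<lambda>k. k > 0 \<and> int k \<in> S", OF ex] unfolding q0_def by auto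
  have least: "q0 \<le> k" if "k > 0" "int k \<in> S" for k
    unfolding q0_def using that by (intro Least_le) auto
  have "int q0 dvd a" if "a \<in> S" for a
  proof -
    have "a mod int q0 = a - int q0 * (a div int q0)" by (simp add: minus_mult_div_eq_mod)
    then have "a mod int q0 \<in> S" using diff[OF that mul[OF q(2)]] by simp
    moreover have "0 \<le> a mod int q0" "a mod int q0 < int q0" using q by auto
    ultimately have "a mod int q0 = 0"
      using least[of "nat (a mod int q0)"] by (cases "a mod int q0 = 0") (auto simp: le_nat_iff)
    then show ?thesis by auto
  qed
  then have "S = {int q0 * i | i. True}" using mul[OF q(2)] by (auto elim!: dvdE)
  then show ?thesis using q(1) by (intro exI[of _ "int q0"]) simp
qed

context prime_cyclic
begin

text \<open>With \<open>L\<close> the largest element of \<open>J\<close> and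
  \<open>W = J + J\<close>, the set \<open>W\<close> and its shifts by \<open>L\<close> and
  \<open>- L\<close> consist of near periods of level \<open>3 * T\<close>. There are about
  \<open>6 * T\<close> of those; after subtracting \<open>card W \<ge> 2 * card J - 1\<close>, only
  about \<open>T\<close> residues modulo \<open>L\<close> remain for \<open>W\<close>, while
  \<open>J\<close> alone occupies about \<open>T\<close>. So \<open>W\<close> is a subgroup modulo
  \<open>L\<close>, and \<open>J\<close> nearly fills the multiples of some \<open>q\<close> from
  \<open>- L\<close> to \<open>L\<close>. The bound \<open>p / 8\<close> keeps all these sums free
  of wraparound.\<close>

lemma ex_long_near_period_progression:
  assumes A: "A \<subseteq> H" and T: "100 \<le> T"
    and J: "99 / 50 * real T \<le> real (card {k. 8 * \<bar>k\<bar> < int p \<and> \<iota> k \<in> near_periods A T})"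
    and N3: "real (card (near_periods A (3 * T))) \<le> 301 / 50 * real T"
  shows "\<exists>q l. coprime q (int p) \<and> 0 < l \<and> 985 * int T \<le> 1000 * l \<and> 1000 * l \<le> 1035 * int T \<and>
    escape A (\<iota> (q * l)) \<le> T \<and> (\<forall>z\<in>{0..l}. escape A (\<iota> (q * z)) \<le> 2 * T)"
proof -
  note fin = finite_subset_H[OF A]
  define J where "J = {k. 8 * \<bar>k\<bar> < int p \<and> \<iota> k \<in> near_periods A T}"
  have finJ: "finite J" by (rule finite_subset[of _ "{- int p..int p}"]) (auto simp: J_def)
  have J8: "8 * \<bar>k\<bar> < int p" "\<iota> k \<in> near_periods A T" if "k \<in> J" for k using that by (auto simp: J_def)
  have sym: "- j \<in> J" if "j \<in> J" for j
    using J8[OF that] near_periods_uminus[OF fin] by (auto simp: J_def hom_uminus)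
  have J0: "0 \<in> J" using p_pos by (simp add: J_def zero_in_near_periods)
  have cJ: "99 / 50 * real T \<le> real (card J)" using J by (simp add: J_def)
  define L where "L = Max J"
  have LJ: "L \<in> J" unfolding L_def using finJ J0 by (intro Max_in) auto
  have JL: "- L \<le> j \<and> j \<le> L" if "j \<in> J" for j
    using Max_ge[OF finJ that] Max_ge[OF finJ sym[OF that]] unfolding L_def by auto
  have "J \<subseteq> {- L..L}" using JL by auto
  then have "card J \<le> card {- L..L}" by (intro card_mono) auto
  then have cJL: "int (card J) \<le> 2 * L + 1" using JL[OF J0] by simp
  have "1 < card J" using cJ T by linarith
  then have L: "L > 0" using cJL by linarith
  define W where "W = {a + b | a b. a \<in> J \<and> b \<in> J}"
  have W_img: "W = (\<lambda>(a, b). a + b) ` (J \<times> J)" unfolding W_def by auto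
  have finW: "finite W" unfolding W_img using finJ by simp
  let ?X = "(\<lambda>k. k mod L) ` J" and ?Q = "(\<lambda>k. k mod L) ` W"
  have "inj_on \<iota> J"
  proof (rule inj_on_hom)
    fix j k assume "j \<in> J" "k \<in> J"
    then show "\<bar>j - k\<bar> < int p" using J8(1)[of j] J8(1)[of k] by linarith
  qed
  then have cJ': "card (\<iota> ` J) = card J" by (rule card_image)
  have "8 * L < int p" using J8(1)[OF LJ] L by simp
  then have pJ: "2 * card J \<le> p + 1" using cJL by linarith
  have WJ: "2 * card J - 1 \<le> card W"
  proof -
    have "min p (card (\<iota> ` J) + card (\<iota> ` J) - 1) \<le> card {x + y | x y. x \<in> \<iota> ` J \<and> y \<in> \<iota> ` J}"
      using J0 by (intro cauchy_davenport) auto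
    also have "{x + y | x y. x \<in> \<iota> ` J \<and> y \<in> \<iota> ` J} = \<iota> ` W"
    proof
      have "\<iota> j + \<iota> k \<in> \<iota> ` W" if "j \<in> J" "k \<in> J" for j k
        unfolding hom_add[symmetric] W_def using that by (intro imageI) blast
      then show "{x + y | x y. x \<in> \<iota> ` J \<and> y \<in> \<iota> ` J} \<subseteq> \<iota> ` W" by blast
      show "\<iota> ` W \<subseteq> {x + y | x y. x \<in> \<iota> ` J \<and> y \<in> \<iota> ` J}"
        unfolding W_def using hom_add by fast
    qed
    also have "card \<dots> \<le> card W" by (rule card_image_le[OF finW])
    finally show ?thesis using pJ by (simp add: cJ')
  qed
  \<comment> \<open>A residue has at most one representative in \<open>{0..<L}\<close> and one in
    \<open>{- L..<0}\<close>; only \<open>L\<close> itself is left over.\<close>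
  have XJ: "card J \<le> 2 * card ?X + 1"
  proof -
    let ?P = "J \<inter> {0..<L}" and ?N = "J \<inter> {- L..<0}"
    have "inj_on (\<lambda>k. k mod L) ?P" by (rule inj_onI) simp
    then have 1: "card ?P \<le> card ?X" using finJ by (intro card_inj_on_le) auto
    have "inj_on (\<lambda>k. k mod L) ?N"
    proof (rule inj_onI)
      fix x y assume xy: "x \<in> ?N" "y \<in> ?N" "x mod L = y mod L"
      then have "(x + L) mod L = (y + L) mod L" by simp
      moreover have "(x + L) mod L = x + L" "(y + L) mod L = y + L"
        using xy by (intro mod_pos_pos_trivial; simp)+
      ultimately show "x = y" by linarith
    qed
    then have 2: "card ?N \<le> card ?X" using finJ by (intro card_inj_on_le) auto
    have "J = ?P \<union> ?N \<union> {L}" using JL LJ by force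
    then have "card J = card (?P \<union> ?N \<union> {L})" by (rule arg_cong)
    also have "\<dots> \<le> card (?P \<union> ?N) + card {L}" by (rule card_Un_le)
    also have "card (?P \<union> ?N) \<le> card ?P + card ?N" by (rule card_Un_le)
    finally show ?thesis using 1 2 by simp
  qed
  have QN: "card W + 2 * card ?Q \<le> card (near_periods A (3 * T))"
  proof -
    let ?V = "W \<union> (\<lambda>w. w + L) ` W \<union> (\<lambda>w. w - L) ` W"
    have W2: "8 * \<bar>w\<bar> < 2 * int p" "\<iota> w \<in> near_periods A (2 * T)" if w: "w \<in> W" for w
    proof -
      obtain a b where ab: "w = a + b" "a \<in> J" "b \<in> J" using w by (auto simp: W_def)
      show "8 * \<bar>w\<bar> < 2 * int p" using J8(1)[OF ab(2)] J8(1)[OF ab(3)] ab(1) by linarith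
      show "\<iota> w \<in> near_periods A (2 * T)"
        using near_periods_add[OF fin J8(2)[OF ab(2)] J8(2)[OF ab(3)]] ab(1) by (simp add: hom_add mult_2)
    qed
    have V3: "8 * \<bar>v\<bar> < 3 * int p \<and> \<iota> v \<in> near_periods A (3 * T)" if v: "v \<in> ?V" for v
    proof -
      consider "v \<in> W" | w where "w \<in> W" "v = w + L" | w where "w \<in> W" "v = w + - L" using v by auto
      then show ?thesis
      proof cases
        case 1
        then show ?thesis using W2[OF 1] near_periods_mono[of "2 * T" "3 * T" A] by auto
      next
        case 2
        have "8 * \<bar>v\<bar> < 3 * int p" using W2(1)[OF 2(1)] J8(1)[OF LJ] 2(2) by linarith
        moreover have "\<iota> v \<in> near_periods A (3 * T)"
          using near_periods_add[OF fin W2(2)[OF 2(1)] J8(2)[OF LJ]] by (simp add: 2(2) hom_add)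
        ultimately show ?thesis by blast
      next
        case 3
        have "8 * \<bar>v\<bar> < 3 * int p" using W2(1)[OF 3(1)] J8(1)[OF LJ] 3(2) by linarith
        moreover have "\<iota> v \<in> near_periods A (3 * T)"
          using near_periods_add[OF fin W2(2)[OF 3(1)] J8(2)[OF sym[OF LJ]]]
          by (simp add: 3(2) hom_diff hom_uminus)
        ultimately show ?thesis by blast
      qed
    qed
    have "inj_on \<iota> ?V"
    proof (rule inj_on_hom)
      fix j k assume "j \<in> ?V" "k \<in> ?V"
      then show "\<bar>j - k\<bar> < int p" using V3[of j] V3[of k] by linarith
    qed
    then have "card ?V \<le> card (near_periods A (3 * T))"
      using V3 by (intro card_inj_on_le[of \<iota>] finite_subset_H[OF near_periods_subset_H]) auto
    then show ?thesis using card_Un_shifts_ge[OF finW L] by linarith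
  qed
  have "real (2 * card J - 1) = 2 * real (card J) - 1" using \<open>1 < card J\<close> by (simp add: of_nat_diff)
  then have Q1: "2 * real (card ?Q) \<le> 301 / 50 * real T - (2 * real (card J) - 1)"
    using WJ QN N3 by linarith
  then have Qu: "real (card ?Q) \<le> 103 / 100 * real T + 1 / 2" using cJ by argo
  have Xl: "99 / 100 * real T - 1 / 2 \<le> real (card ?X)" using XJ cJ by linarith
  have "2 * card ?Q < 3 * card ?X" using Qu Xl T by linarith
  then have small: "2 * card ((\<lambda>k. k mod L) ` {a + b | a b. a \<in> J \<and> b \<in> J}) < 3 * card ?X"
    by (simp add: W_def)
  define S where "S = {k. k mod L \<in> ?Q}"
  have JS: "j \<in> S" if "j \<in> J" for j
  proof -
    have "j + 0 \<in> W" unfolding W_def using that J0 by blast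
    then show ?thesis by (simp add: S_def)
  qed
  have "\<exists>q>0. S = {q * i | i. True}"
  proof (rule int_subgroup_eq_multiples[OF JS[OF LJ] L])
    fix a b assume "a \<in> S" "b \<in> S"
    then show "a - b \<in> S"
      using small_doubling_mod_closed[OF finJ L sym small] unfolding S_def W_def by simp
  qed
  then obtain q where q: "q > 0" "S = {q * i | i. True}" by blast
  obtain l where l: "L = q * l" using JS[OF LJ] q by auto
  have l0: "l > 0" using l L q by (simp add: zero_less_mult_iff)
  have "?Q = (\<lambda>i. q * i) ` {0..<l}"
  proof
    show "?Q \<subseteq> (\<lambda>i. q * i) ` {0..<l}"
    proof
      fix k assume k: "k \<in> ?Q"
      then have k': "0 \<le> k" "k < L" "k mod L = k" using L by auto
      then have "k \<in> S" using k by (simp add: S_def)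
      then obtain i where i: "k = q * i" using q by auto
      then have "0 \<le> i" "i < l" using k' l q by (simp_all add: zero_le_mult_iff)
      then show "k \<in> (\<lambda>i. q * i) ` {0..<l}" using i by auto
    qed
    show "(\<lambda>i. q * i) ` {0..<l} \<subseteq> ?Q"
    proof (rule image_subsetI)
      fix i assume i: "i \<in> {0..<l}"
      have "q * i \<in> S" using q by auto
      moreover have "0 \<le> q * i" "q * i < L" using i q l by auto
      ultimately show "q * i \<in> ?Q" by (simp add: S_def)
    qed
  qed
  moreover have "inj_on (\<lambda>i. q * i) {0..<l}" using q by (intro inj_onI) simp
  ultimately have "card ?Q = nat l" by (simp add: card_image)
  then have lQ: "real_of_int l = real (card ?Q)" using l0 by simp
  define I where "I = {i. q * i \<in> J}"
  have J_eq: "J = (\<lambda>i. q * i) ` I" using JS q by (auto simp: I_def)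
  moreover have "inj_on (\<lambda>i. q * i) I" using q by (intro inj_onI) simp
  ultimately have cI: "card I = card J" by (simp add: card_image)
  have finI: "finite I" using finJ q unfolding I_def by (intro finite_vimageI[of J "\<lambda>i. q * i", unfolded vimage_def]) (auto simp: inj_on_def)
  have Il: "- l \<le> i \<and> i \<le> l" if "i \<in> I" for i
  proof -
    have "q * (- l) \<le> q * i" "q * i \<le> q * l" using JL[of "q * i"] that l by (auto simp: I_def)
    then show ?thesis using q(1) by (simp only: mult_le_cancel_left_pos)
  qed
  have "I \<subseteq> {- l..l}" using Il by auto
  then have "card I \<le> card {- l..l}" by (intro card_mono) auto
  then have lI: "int (card J) \<le> 2 * l + 1" using l0 cI by simp
  have real_lI: "real (card J) \<le> 2 * real_of_int l + 1"
  proof -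
    have "real_of_int (int (card J)) \<le> real_of_int (2 * l + 1)" using lI by (simp only: of_int_le_iff)
    then show ?thesis by simp
  qed
  have "985 * real T \<le> 1000 * real_of_int l" using real_lI cJ T by linarith
  then have 1: "985 * int T \<le> 1000 * l" by linarith
  have "1000 * real_of_int l \<le> 1035 * real T" using Qu lQ T by linarith
  then have 2: "1000 * l \<le> 1035 * int T" by linarith
  have qL: "q \<le> L" using l l0 q by simp
  have "\<not> int p dvd q" using q(1) qL \<open>8 * L < int p\<close> L by (auto dest: zdvd_imp_le)
  then have cop: "coprime q (int p)" using prime
    by (metis coprime_commute prime_imp_coprime prime_nat_int_transfer)
  have esc: "escape A (\<iota> (q * i)) \<le> T" if "i \<in> I" for i
    using that J8(2) by (auto simp: I_def near_periods_def)
  have "escape A (\<iota> (q * z)) \<le> 2 * T" if z: "0 \<le> z" "z \<le> l" for z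
  proof -
    \<comment> \<open>Pigeonhole: \<open>I\<close> misses so few points of \<open>{- l..l}\<close>
      that it meets its reflection \<open>z - I\<close>. Being a sum of two elements of
      \<open>I\<close>, \<open>z\<close> has level \<open>2 * T\<close>.\<close>
    have "\<exists>i\<in>I. z - i \<in> I"
    proof (rule ccontr)
      assume contra: "\<not> ?thesis"
      let ?P = "I \<inter> {z - l..l}"
      have "I \<subseteq> ?P \<union> {- l..<z - l}" using Il by auto
      then have "card I \<le> card (?P \<union> {- l..<z - l})" by (intro card_mono) (use finI in auto)
      also have "\<dots> \<le> card ?P + card {- l..<z - l}" by (rule card_Un_le)
      finally have cP: "int (card I) \<le> int (card ?P) + z" using z by simp
      have "card ?P + card ((\<lambda>i. z - i) ` ?P) = card (?P \<union> (\<lambda>i. z - i) ` ?P)"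
        using finI contra by (intro card_Un_disjoint[symmetric]) auto
      also have "\<dots> \<le> card {z - l..l}" by (intro card_mono) auto
      also have "card ((\<lambda>i. z - i) ` ?P) = card ?P" by (intro card_image inj_onI) simp
      finally have "2 * int (card ?P) \<le> 2 * l - z + 1" using z by simp
      then have "2 * int (card J) \<le> 3 * l + 1" using cP cI z by linarith
      then have "real_of_int (2 * int (card J)) \<le> real_of_int (3 * l + 1)" by (simp only: of_int_le_iff)
      then have "2 * real (card J) \<le> 3 * real_of_int l + 1" by simp
      then show False using cJ Qu lQ T by linarith
    qed
    then obtain i where i: "i \<in> I" "z - i \<in> I" by blast
    have "q * z = q * i + q * (z - i)" by (simp add: algebra_simps)
    then have "\<iota> (q * z) = \<iota> (q * i) + \<iota> (q * (z - i))" by (simp only: hom_add)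
    then have "escape A (\<iota> (q * z)) \<le> escape A (\<iota> (q * i)) + escape A (\<iota> (q * (z - i)))"
      using escape_add[OF fin] by simp
    then show ?thesis using esc[OF i(1)] esc[OF i(2)] by linarith
  qed
  moreover have "l \<in> I" using LJ l by (simp add: I_def)
  ultimately show ?thesis using cop l0 1 2 esc by (intro exI[of _ q] exI[of _ l]) auto
qed

end

section \<open>Sets with nearly minimal variation are arcs\<close>

lemma abs_diff_le_variation:
  fixes f :: "int \<Rightarrow> real"
  assumes "a \<le> b" shows "\<bar>f b - f a\<bar> \<le> (\<Sum>y\<in>{a..<b}. \<bar>f (y + 1) - f y\<bar>)"
  using assms
proof (induction b rule: int_ge_induct)
  case (step b)
  have "{a..<b + 1} = insert b {a..<b}" using step by auto
  then have "(\<Sum>y\<in>{a..<b + 1}. \<bar>f (y + 1) - f y\<bar>) = \<bar>f (b + 1) - f b\<bar> + (\<Sum>y\<in>{a..<b}. \<bar>f (y + 1) - f y\<bar>)"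
    by simp
  then show ?case using step.IH by linarith
qed simp

text \<open>Going once around the circle through a minimum and a maximum already uses up almost the
  whole variation, so the function cannot oscillate in between.\<close>

lemma ex_superlevel_arc:
  fixes f :: "int \<Rightarrow> real"
  assumes per: "f (z + p) = f z" and y0: "z \<le> y0" "y0 < z + p" and h: "f z \<le> h" "h < f y0"
    and V: "(\<Sum>y\<in>{z..<z + p}. \<bar>f (y + 1) - f y\<bar>) \<le> V"
  shows "\<exists>u v. z \<le> u \<and> u \<le> v \<and> v < z + p \<and> (\<forall>y\<in>{u..v}. h + f y0 - f z - V / 2 \<le> f y) \<and>
    (\<forall>y\<in>{z..<z + p} - {u..v}. f y \<le> h)"
proof -
  define P where "P = {y \<in> {z..<z + p}. h < f y}"
  have finP: "finite P" unfolding P_def by (rule finite_subset[of _ "{z..<z + p}"]) auto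
  have y0P: "y0 \<in> P" using y0 h by (simp add: P_def)
  define u v where "u = Min P" and "v = Max P"
  have uP: "u \<in> P" and vP: "v \<in> P" unfolding u_def v_def using finP y0P by (auto intro: Min_in Max_in)
  have uy0: "u \<le> y0" "y0 \<le> v" unfolding u_def v_def using finP y0P by auto
  have out: "f y \<le> h" if "y \<in> {z..<z + p} - {u..v}" for y
  proof (rule ccontr)
    assume "\<not> f y \<le> h"
    then have "y \<in> P" using that by (auto simp: P_def)
    then show False using that finP unfolding u_def v_def by auto
  qed
  let ?g = "\<lambda>y. \<bar>f (y + 1) - f y\<bar>"
  have split4: "\<bar>f a - f z\<bar> + \<bar>f b - f a\<bar> + \<bar>f c - f b\<bar> + \<bar>f (z + p) - f c\<bar> \<le> V"
    if "z \<le> a" "a \<le> b" "b \<le> c" "c \<le> z + p" for a b c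
  proof -
    have sp: "sum ?g {i..<k} = sum ?g {i..<j} + sum ?g {j..<k}" if "i \<le> j" "j \<le> k" for i j k
    proof -
      have "{i..<k} = {i..<j} \<union> {j..<k}" using that by auto
      then show ?thesis by (simp add: sum.union_disjoint)
    qed
    have "sum ?g {z..<z + p} = sum ?g {z..<a} + sum ?g {a..<b} + sum ?g {b..<c} + sum ?g {c..<z + p}"
      using sp[of z a "z + p"] sp[of a b "z + p"] sp[of b c "z + p"] that by linarith
    then show ?thesis
      using V abs_diff_le_variation[OF that(1), of f] abs_diff_le_variation[OF that(2), of f]
        abs_diff_le_variation[OF that(3), of f] abs_diff_le_variation[OF that(4), of f] by linarith
  qed
  have ins: "h + f y0 - f z - V / 2 \<le> f y" if y: "y \<in> {u..v}" for y
  proof (cases "y \<le> y0")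
    case True
    \<comment> \<open>Climbing to \<open>f u\<close>, dipping to \<open>f y\<close>, climbing to
      \<open>f y0\<close> and returning uses variation at least
      \<open>2 * (f u + f y0 - f z - f y)\<close>.\<close>
    then have "\<bar>f u - f z\<bar> + \<bar>f y - f u\<bar> + \<bar>f y0 - f y\<bar> + \<bar>f (z + p) - f y0\<bar> \<le> V"
      using y uP y0 by (intro split4) (auto simp: P_def)
    moreover have "h < f u" using uP by (simp add: P_def)
    ultimately show ?thesis unfolding per by (simp add: abs_if split: if_splits)
  next
    case False
    then have "\<bar>f y0 - f z\<bar> + \<bar>f y - f y0\<bar> + \<bar>f v - f y\<bar> + \<bar>f (z + p) - f v\<bar> \<le> V"
      using y vP y0 by (intro split4) (auto simp: P_def)
    moreover have "h < f v" using vP by (simp add: P_def)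
    ultimately show ?thesis unfolding per by (simp add: abs_if split: if_splits)
  qed
  show ?thesis
    using uP uy0 vP out ins by (intro exI[of _ u] exI[of _ v]) (auto simp: P_def)
qed

context prime_cyclic
begin

lemma bij_betw_hom_window: "bij_betw \<iota> {c..<c + int p} H"
proof -
  have "inj_on \<iota> {c..<c + int p}" by (rule inj_on_hom) auto
  then have "card (\<iota> ` {c..<c + int p}) = card H" by (simp add: card_image)
  moreover have "\<iota> ` {c..<c + int p} \<subseteq> H" by auto
  ultimately have "\<iota> ` {c..<c + int p} = H" by (intro card_subset_eq) auto
  then show ?thesis using \<open>inj_on \<iota> {c..<c + int p}\<close> by (simp add: bij_betw_def)
qed

lemma sum_window: "(\<Sum>y\<in>{c..<c + int p}. g (\<iota> y)) = (\<Sum>e\<in>H. g e)"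
  by (rule sum.reindex_bij_betw[OF bij_betw_hom_window])

lemma card_window:
  assumes "X \<subseteq> H" shows "card {y \<in> {c..<c + int p}. \<iota> y \<in> X} = card X"
proof -
  have "card X = (\<Sum>e\<in>H. if e \<in> X then 1 else 0)"
    using assms by (simp add: sum.If_cases Int_absorb1)
  also have "\<dots> = (\<Sum>y\<in>{c..<c + int p}. if \<iota> y \<in> X then 1 else 0)" by (rule sum_window[symmetric])
  also have "\<dots> = card {y \<in> {c..<c + int p}. \<iota> y \<in> X}" by (simp add: sum.If_cases Int_def)
  finally show ?thesis by simp
qed

lemma sum_abs_indicator_diff:
  assumes A: "A \<subseteq> H" and x: "x \<in> H"
  shows "(\<Sum>e\<in>H. \<bar>of_bool (e + x \<in> A) - of_bool (e \<in> A)\<bar>) = 2 * real (escape A x)"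
proof -
  note fin = finite_subset_H[OF A]
  have "(\<Sum>e\<in>H. \<bar>of_bool (e + x \<in> A) - of_bool (e \<in> A)\<bar>)
      = (\<Sum>e\<in>H. of_bool (e \<in> A \<and> e + x \<notin> A) + of_bool (e \<notin> A \<and> e + x \<in> A) :: real)"
    by (intro sum.cong) auto
  also have "\<dots> = real (card {e \<in> H. e \<in> A \<and> e + x \<notin> A}) + real (card {e \<in> H. e \<notin> A \<and> e + x \<in> A})"
    by (simp add: sum.distrib of_bool_def sum.If_cases Int_def)
  also have "{e \<in> H. e \<in> A \<and> e + x \<notin> A} = {e \<in> A. e + x \<notin> A}" using A by auto
  also have "card {e \<in> H. e \<notin> A \<and> e + x \<in> A} = card {e \<in> A. e + - x \<notin> A}"
  proof (rule bij_betw_same_card)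
    show "bij_betw (\<lambda>e. e + x) {e \<in> H. e \<notin> A \<and> e + x \<in> A} {e \<in> A. e + - x \<notin> A}"
      by (rule bij_betwI[where g = "\<lambda>e. e - x"]) (use A x in \<open>auto intro: H_diff\<close>)
  qed
  finally show ?thesis using escape_uminus[OF fin, of x] by (simp add: escape_def)
qed

text \<open>The function \<open>f\<close> is \<open>w\<close> times the average of the indicator
  \<open>a\<close> over a window of length \<open>w\<close>. Its steps are
  \<open>a (y + w) - a y\<close>, so its variation around the circle is
  \<open>2 * escape A (\<iota> w) \<le> 2 * T\<close>, barely more than the \<open>2 * w\<close>
  needed to rise from 0 to \<open>w\<close> and return. The bounds for shorter shifts make
  \<open>f\<close> close to \<open>w * a\<close> on average, so it does come near both values, and
  one superlevel arc approximates \<open>A\<close>.\<close>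

lemma ex_dominant_arc:
  assumes A: "A \<subseteq> H" and n: "2 * card A \<le> p" "1000 * T \<le> card A" and T: "0 < T"
    and w: "0 < w" "985 * int T \<le> 1000 * w" and escw: "escape A (\<iota> w) \<le> T"
    and esc: "\<And>z. z \<in> {0..w} \<Longrightarrow> escape A (\<iota> z) \<le> 2 * T"
  shows "\<exists>u v. u \<le> v \<and> v < u + int p \<and> card {y \<in> {u..v}. \<iota> y \<notin> A} \<le> 16 * T \<and>
    card (A - \<iota> ` {u..v}) \<le> 8 * T"
proof -
  note fin = finite_subset_H[OF A]
  define a where "a = (\<lambda>y. of_bool (\<iota> y \<in> A) :: real)"
  define f where "f = (\<lambda>y. \<Sum>z\<in>{0..<w}. a (y + z))"
  let ?w = "real_of_int w"
  have a_per: "a (y + int p) = a y" for y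
    unfolding a_def using hom_mod[of "y + int p"] hom_mod[of y] by simp
  have f_per: "f (y + int p) = f y" for y
    unfolding f_def using a_per[of "y + _"] by (intro sum.cong refl) (metis add.assoc add.commute)
  have shift: "(\<Sum>y\<in>{c..<c + int p}. \<bar>a (y + z) - a y\<bar>) = 2 * real (escape A (\<iota> z))" for c z
    unfolding a_def hom_add using sum_window[of "\<lambda>e. \<bar>of_bool (e + \<iota> z \<in> A) - of_bool (e \<in> A) :: real\<bar>" c]
      sum_abs_indicator_diff[OF A, of "\<iota> z"] by simp
  have f_step: "f (y + 1) - f y = a (y + w) - a y" for y
  proof -
    have "f (y + 1) = (\<Sum>z\<in>{1..<w + 1}. a (y + z))"
      unfolding f_def by (rule sum.reindex_bij_witness[of _ "\<lambda>z. z - 1" "\<lambda>z. z + 1"]) (auto simp: algebra_simps)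
    also have "\<dots> + a y = (\<Sum>z\<in>insert 0 {1..<w + 1}. a (y + z))" by simp
    also have "insert 0 {1..<w + 1} = insert w {0..<w}" using w by auto
    also have "(\<Sum>z\<in>insert w {0..<w}. a (y + z)) = a (y + w) + f y" unfolding f_def by simp
    finally show ?thesis by simp
  qed
  have V: "(\<Sum>y\<in>{c..<c + int p}. \<bar>f (y + 1) - f y\<bar>) \<le> 2 * real T" for c
    unfolding f_step shift using escw by simp
  have L1: "(\<Sum>y\<in>{c..<c + int p}. \<bar>f y - ?w * a y\<bar>) \<le> 4 * real T * ?w" for c
  proof -
    have "(\<Sum>y\<in>{c..<c + int p}. \<bar>f y - ?w * a y\<bar>) \<le> (\<Sum>y\<in>{c..<c + int p}. \<Sum>z\<in>{0..<w}. \<bar>a (y + z) - a y\<bar>)"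
    proof (rule sum_mono)
      fix y
      have "f y - ?w * a y = (\<Sum>z\<in>{0..<w}. a (y + z) - a y)"
        unfolding f_def using w by (simp add: sum_subtractf)
      then show "\<bar>f y - ?w * a y\<bar> \<le> (\<Sum>z\<in>{0..<w}. \<bar>a (y + z) - a y\<bar>)" by (simp only: sum_abs)
    qed
    also have "\<dots> = (\<Sum>z\<in>{0..<w}. \<Sum>y\<in>{c..<c + int p}. \<bar>a (y + z) - a y\<bar>)" by (rule sum.swap)
    also have "\<dots> \<le> (\<Sum>z\<in>{0..<w}. 4 * real T)"
    proof (rule sum_mono)
      fix z assume "z \<in> {0..<w}"
      then have "escape A (\<iota> z) \<le> 2 * T" by (intro esc) auto
      then show "(\<Sum>y\<in>{c..<c + int p}. \<bar>a (y + z) - a y\<bar>) \<le> 4 * real T" unfolding shift by simp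
    qed
    finally show ?thesis using w by (simp add: mult.commute)
  qed
  \<comment> \<open>Markov's inequality for the mean distance between \<open>f\<close> and
    \<open>w * a\<close>.\<close>
  have mass: "real (card Y) * \<delta> \<le> 4 * real T * ?w"
    if "Y \<subseteq> {c..<c + int p}" "\<And>y. y \<in> Y \<Longrightarrow> \<delta> \<le> \<bar>f y - ?w * a y\<bar>" for Y c \<delta>
  proof -
    have "real (card Y) * \<delta> = (\<Sum>y\<in>Y. \<delta>)" by simp
    also have "\<dots> \<le> (\<Sum>y\<in>Y. \<bar>f y - ?w * a y\<bar>)" using that by (intro sum_mono)
    also have "\<dots> \<le> (\<Sum>y\<in>{c..<c + int p}. \<bar>f y - ?w * a y\<bar>)" using that by (intro sum_mono2) auto
    finally show ?thesis using L1[of c] by linarith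
  qed
  have wpos: "?w > 0" using w by simp
  have close: "\<exists>y\<in>Y. \<bar>f y - ?w * a y\<bar> < ?w / 100" if Y: "Y \<subseteq> {c..<c + int p}" "card A \<le> card Y" for Y c
  proof (rule ccontr)
    assume "\<not> ?thesis"
    then have "real (card Y) * (?w / 100) \<le> 4 * real T * ?w"
      using Y by (intro mass[of Y c]) (auto simp: not_less)
    moreover have "real (1000 * T) \<le> real (card Y)" using n Y by (simp only: of_nat_le_iff) 
    then have "1000 * real T * (?w / 100) \<le> real (card Y) * (?w / 100)"
      using wpos by (intro mult_right_mono) auto
    moreover have "0 < real T * ?w" using wpos T by simp
    ultimately show False by simp
  qed
  have "card {y \<in> {0..<0 + int p}. \<iota> y \<in> H - A} = card (H - A)" by (rule card_window) auto
  then have "card {y \<in> {0..<0 + int p}. \<iota> y \<in> H - A} = p - card A" using A fin by (simp add: card_Diff_subset)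
  then have "\<exists>y\<in>{y \<in> {0..<0 + int p}. \<iota> y \<in> H - A}. \<bar>f y - ?w * a y\<bar> < ?w / 100"
    using n by (intro close[of _ 0]) auto
  then obtain z where z: "\<iota> z \<notin> A" "\<bar>f z - ?w * a z\<bar> < ?w / 100" by auto
  then have fz: "f z < ?w / 100" by (simp add: a_def)
  have "card {y \<in> {z..<z + int p}. \<iota> y \<in> A} = card A" by (rule card_window[OF A])
  then have "\<exists>y\<in>{y \<in> {z..<z + int p}. \<iota> y \<in> A}. \<bar>f y - ?w * a y\<bar> < ?w / 100"
    by (intro close[of _ z]) auto
  then obtain y0 where y0: "z \<le> y0" "y0 < z + int p" "\<iota> y0 \<in> A" "\<bar>f y0 - ?w * a y0\<bar> < ?w / 100" by auto
  have "?w * a y0 = ?w" using y0(3) by (simp add: a_def)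
  then have "\<bar>f y0 - ?w\<bar> < ?w / 100" using y0(4) by (simp only:)
  then have fy0: "?w - ?w / 100 < f y0" by linarith
  have Tw: "985 * real T \<le> 1000 * ?w"
  proof -
    have "real_of_int (985 * int T) \<le> real_of_int (1000 * w)" using w(2) by (simp only: of_int_le_iff)
    then show ?thesis by simp
  qed
  \<comment> \<open>With threshold \<open>w / 2\<close>, \<open>f\<close> stays on the arc above
    \<open>w / 2 + 98 / 100 * w - T\<close>, and \<open>T \<le> 1000 / 985 * w\<close> leaves more
    than \<open>w / 4\<close>. Points of the arc outside \<open>A\<close> then deviate by
    \<open>w / 4\<close> and points of \<open>A\<close> off the arc by \<open>w / 2\<close>, whence
    \<open>16 * T\<close> and \<open>8 * T\<close>.\<close>
  obtain u v where uv: "z \<le> u" "u \<le> v" "v < z + int p"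
    "\<And>y. y \<in> {u..v} \<Longrightarrow> ?w / 2 + f y0 - f z - 2 * real T / 2 \<le> f y"
    "\<And>y. y \<in> {z..<z + int p} - {u..v} \<Longrightarrow> f y \<le> ?w / 2"
    using ex_superlevel_arc[OF f_per y0(1,2) _ _ V[of z], of "?w / 2"] fz fy0 wpos by force
  have inside: "?w / 4 \<le> f y" if "y \<in> {u..v}" for y
    using uv(4)[OF that] fz fy0 Tw wpos by argo
  have "real (card {y \<in> {u..v}. \<iota> y \<notin> A}) * (?w / 4) \<le> 4 * real T * ?w"
  proof (rule mass[of _ z])
    fix y assume y: "y \<in> {y \<in> {u..v}. \<iota> y \<notin> A}"
    then show "?w / 4 \<le> \<bar>f y - ?w * a y\<bar>" using inside[of y] by (simp add: a_def)
  qed (use uv(1,3) in auto)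
  then have "real (card {y \<in> {u..v}. \<iota> y \<notin> A}) \<le> 16 * real T" using wpos by (simp add: field_simps)
  then have 1: "card {y \<in> {u..v}. \<iota> y \<notin> A} \<le> 16 * T" by linarith
  define Out where "Out = {y \<in> {z..<z + int p}. y \<notin> {u..v} \<and> \<iota> y \<in> A}"
  have finOut: "finite Out" unfolding Out_def by (rule finite_subset[of _ "{z..<z + int p}"]) auto
  have "real (card Out) * (?w / 2) \<le> 4 * real T * ?w"
  proof (rule mass[of _ z])
    fix y assume y: "y \<in> Out"
    then have "f y \<le> ?w / 2" by (intro uv(5)) (auto simp: Out_def)
    then have "?w / 2 \<le> \<bar>f y - ?w\<bar>" by linarith
    moreover have "?w * a y = ?w" using y by (simp add: a_def Out_def)
    ultimately show "?w / 2 \<le> \<bar>f y - ?w * a y\<bar>" by (simp only:)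
  qed (auto simp: Out_def)
  then have "real (card Out) \<le> 8 * real T" using wpos by (simp add: field_simps)
  moreover have "card (A - \<iota> ` {u..v}) \<le> card Out"
  proof -
    have "A - \<iota> ` {u..v} \<subseteq> \<iota> ` Out"
    proof
      fix e assume e: "e \<in> A - \<iota> ` {u..v}"
      then have "e \<in> \<iota> ` {z..<z + int p}" using A bij_betw_hom_window[of z] by (auto simp: bij_betw_def)
      then show "e \<in> \<iota> ` Out" using e by (auto simp: Out_def)
    qed
    then have "card (A - \<iota> ` {u..v}) \<le> card (\<iota> ` Out)" by (intro card_mono finite_imageI finOut)
    also have "\<dots> \<le> card Out" by (intro card_image_le finOut)
    finally show ?thesis .
  qed
  ultimately have 2: "card (A - \<iota> ` {u..v}) \<le> 8 * T" by linarith
  show ?thesis using uv(1-3) 1 2 by (intro exI[of _ u] exI[of _ v]) auto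
qed

text \<open>Sums of two points of the arc already take up nearly all of \<open>S\<close>. A point of
  \<open>A\<close> at distance \<open>\<xi>\<close> from the arc would add a translate of the arc
  with at least \<open>\<xi>\<close> new points, almost all of them in \<open>S\<close>.\<close>

lemma subset_short_arc:
  assumes A: "A \<subseteq> H" and S: "S \<subseteq> H" and T: "2 \<le> T" "1000 * T \<le> card A" "2 * card A + 1000 * T \<le> p"
    and crit: "critical A A S \<epsilon>" and \<epsilon>: "\<epsilon> * real (card A) \<le> real T"
    and uv: "u \<le> v" "v < u + int p" "card {y \<in> {u..v}. \<iota> y \<notin> A} \<le> 16 * T"
      "card (A - \<iota> ` {u..v}) \<le> 8 * T"
  shows "\<exists>c h. A \<subseteq> \<iota> ` {c..c + h} \<and> 2 * h < int p"
proof -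
  note fin = finite_subset_H[OF A] finite_subset_H[OF S]
  define l where "l = v - u + 1"
  let ?n = "int (card A)" and ?B = "{y \<in> {u..v}. \<iota> y \<notin> A}"
  have finB: "finite ?B" by (rule finite_subset[of _ "{u..v}"]) auto
  have "A \<subseteq> \<iota> ` {u..v} \<union> (A - \<iota> ` {u..v})" by auto
  then have "card A \<le> card (\<iota> ` {u..v} \<union> (A - \<iota> ` {u..v}))" using fin by (intro card_mono) auto
  also have "\<dots> \<le> card (\<iota> ` {u..v}) + card (A - \<iota> ` {u..v})" by (rule card_Un_le)
  also have "card (\<iota> ` {u..v}) \<le> card {u..v}" by (rule card_image_le) simp
  finally have l1: "?n - 8 * int T \<le> l" using uv by (simp add: l_def)
  have inj: "inj_on \<iota> {u..v}" by (rule inj_on_hom) (use uv in auto)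
  have "{u..v} = ?B \<union> {y \<in> {u..v}. \<iota> y \<in> A}" by auto
  then have "card {u..v} = card (?B \<union> {y \<in> {u..v}. \<iota> y \<in> A})" by (rule arg_cong)
  also have "\<dots> \<le> card ?B + card {y \<in> {u..v}. \<iota> y \<in> A}" by (rule card_Un_le)
  also have "card {y \<in> {u..v}. \<iota> y \<in> A} \<le> card A"
    using fin by (intro card_inj_on_le[of \<iota>] inj_on_subset[OF inj]) auto
  finally have l2: "l \<le> ?n + 16 * int T" using uv by (simp add: l_def)
  have sizes: "2 \<le> int T" "1000 * int T \<le> ?n" "2 * ?n + 1000 * int T \<le> int p" using T by linarith+
  have bad: "card (\<iota> ` {x + u..x + v} - S) \<le> 17 * T" if x: "\<iota> x \<in> A" for x
  proof -
    have "\<iota> ` {x + u..x + v} - S \<subseteq> (\<lambda>y. \<iota> (x + y)) ` ?B \<union> (\<lambda>a. \<iota> x + a) ` {a \<in> A. \<iota> x + a \<notin> S}"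
    proof
      fix e assume "e \<in> \<iota> ` {x + u..x + v} - S"
      then obtain k where k: "e = \<iota> k" "x + u \<le> k" "k \<le> x + v" "e \<notin> S" by auto
      define y where "y = k - x"
      have y: "e = \<iota> (x + y)" "y \<in> {u..v}" using k by (auto simp: y_def)
      show "e \<in> (\<lambda>y. \<iota> (x + y)) ` ?B \<union> (\<lambda>a. \<iota> x + a) ` {a \<in> A. \<iota> x + a \<notin> S}"
      proof (cases "\<iota> y \<in> A")
        case True
        then have "\<iota> y \<in> {a \<in> A. \<iota> x + a \<notin> S}" using y k(4) by (simp add: hom_add)
        then show ?thesis using y(1) by (simp add: hom_add)
      next
        case False
        then show ?thesis using y by blast
      qed
    qed
    then have "card (\<iota> ` {x + u..x + v} - S)
        \<le> card ((\<lambda>y. \<iota> (x + y)) ` ?B \<union> (\<lambda>a. \<iota> x + a) ` {a \<in> A. \<iota> x + a \<notin> S})"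
      using fin finB by (intro card_mono finite_UnI finite_imageI) auto
    also have "\<dots> \<le> card ((\<lambda>y. \<iota> (x + y)) ` ?B) + card ((\<lambda>a. \<iota> x + a) ` {a \<in> A. \<iota> x + a \<notin> S})"
      by (rule card_Un_le)
    also have "\<dots> \<le> card ?B + card {a \<in> A. \<iota> x + a \<notin> S}"
      using fin finB by (intro add_mono card_image_le) auto
    finally have "card (\<iota> ` {x + u..x + v} - S) \<le> card ?B + card {a \<in> A. \<iota> x + a \<notin> S}" .
    moreover have "real (card {a \<in> A. \<iota> x + a \<notin> S}) \<le> real T"
      using crit x \<epsilon> unfolding critical_def by fastforce
    ultimately show ?thesis using uv(3) by linarith
  qed
  have hit: "\<exists>x\<in>K. \<iota> x \<in> A" if "K \<subseteq> {u..v}" "16 * T < card K" for K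
  proof (rule ccontr)
    assume "\<not> ?thesis"
    then have "K \<subseteq> ?B" using that by auto
    then have "card K \<le> card ?B" by (intro card_mono finB)
    then show False using that uv by linarith
  qed
  \<comment> \<open>Any \<open>16 * T + 1\<close> points of the arc include one of \<open>A\<close>.
    Two such points near the ends have translates of the arc that together cover \<open>Q\<close>,
    the doubled arc cut by \<open>16 * T\<close> at each end.\<close>
  have "16 * T < card {u..u + 16 * int T}" "16 * T < card {v - 16 * int T..v}" by simp_all
  moreover have "{u..u + 16 * int T} \<subseteq> {u..v}" "{v - 16 * int T..v} \<subseteq> {u..v}"
    using l1 sizes T by (auto simp: l_def)
  ultimately obtain x1 x2 where x1: "x1 \<in> {u..u + 16 * int T}" "\<iota> x1 \<in> A"
    and x2: "x2 \<in> {v - 16 * int T..v}" "\<iota> x2 \<in> A" using hit by meson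
  \<comment> \<open>\<open>Q\<close> has \<open>2 * l - 1 - 32 * T\<close> points with
    \<open>l \<ge> ?n - 8 * T\<close>, the three translates miss \<open>S\<close> in at most
    \<open>51 * T\<close> points, and \<open>S\<close> has at most \<open>2 * ?n + T\<close>. A
    contradiction thus needs \<open>\<xi> > 100 * T + 1\<close>.\<close>
  define \<xi> where "\<xi> = 102 * int T"
  have arc: "s < l + \<xi> \<or> int p - \<xi> < s" if s: "0 \<le> s" "s < int p" "\<iota> (u + s) \<in> A" for s
  proof (rule ccontr)
    assume "\<not> ?thesis"
    then have s': "l + \<xi> \<le> s" "s \<le> int p - \<xi>" by auto
    define Q where "Q = {2 * u + 16 * int T..2 * v - 16 * int T}"
    \<comment> \<open>The part of the translate by \<open>u + s\<close> past the doubled arc, cut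
      off where the circle closes up at \<open>2 * u + p\<close>.\<close>
    define R where "R = {max (2 * u + s) (2 * v + 1)..min (u + s + v) (2 * u + int p - 1)}"
    have Q: "Q \<subseteq> {x1 + u..x1 + v} \<union> {x2 + u..x2 + v}"
      using x1(1) x2(1) unfolding Q_def by auto
    have R: "R \<subseteq> {(u + s) + u..(u + s) + v}" unfolding R_def by auto
    have cQ: "int (card Q) = 2 * l - 1 - 32 * int T"
      using l1 sizes unfolding Q_def l_def by simp
    have cR: "\<xi> \<le> int (card R)"
      using l1 l2 sizes s' unfolding R_def \<xi>_def l_def by (simp add: max_def min_def)
    have QR: "Q \<inter> R = {}" unfolding Q_def R_def by auto
    have "inj_on \<iota> (Q \<union> R)"
    proof (rule inj_on_hom)
      fix j k assume jk: "j \<in> Q \<union> R" "k \<in> Q \<union> R"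
      have "Q \<union> R \<subseteq> {2 * u..<2 * u + int p}"
        using l2 sizes s unfolding Q_def R_def l_def by auto
      then have "j \<in> {2 * u..<2 * u + int p}" "k \<in> {2 * u..<2 * u + int p}" using jk by blast+
      then show "\<bar>j - k\<bar> < int p" by auto
    qed
    then have "card (\<iota> ` (Q \<union> R)) = card (Q \<union> R)" by (rule card_image)
    also have "\<dots> = card Q + card R" using QR by (intro card_Un_disjoint) (auto simp: Q_def R_def)
    finally have c: "card Q + card R = card (\<iota> ` (Q \<union> R))" by simp
    let ?P = "\<lambda>x. \<iota> ` {x + u..x + v} - S"
    have "\<iota> ` (Q \<union> R) \<subseteq> S \<union> (?P x1 \<union> (?P x2 \<union> ?P (u + s)))" using Q R by blast
    then have "card (\<iota> ` (Q \<union> R)) \<le> card (S \<union> (?P x1 \<union> (?P x2 \<union> ?P (u + s))))"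
      using fin by (intro card_mono) auto
    also have "\<dots> \<le> card S + (card (?P x1) + (card (?P x2) + card (?P (u + s))))"
      by (intro order_trans[OF card_Un_le] add_left_mono card_Un_le)
    also have "\<dots> \<le> card S + 51 * T" using bad[OF x1(2)] bad[OF x2(2)] bad[OF s(3)] by linarith
    finally have "card Q + card R \<le> card S + 51 * T" using c by simp
    moreover have "real (card S) \<le> 2 * real (card A) + real T" using crit \<epsilon> by (simp add: critical_def)
    then have "card S \<le> 2 * card A + T" by linarith
    ultimately show False using cQ cR l1 T(1) \<xi>_def by linarith
  qed
  define c h where "c = u - \<xi>" and "h = l + 2 * \<xi>"
  have "A \<subseteq> \<iota> ` {c..c + h}"
  proof
    fix e assume e: "e \<in> A"
    then have "e \<in> \<iota> ` {u..<u + int p}" using A bij_betw_hom_window[of u] by (auto simp: bij_betw_def)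
    then obtain y where y: "e = \<iota> y" "u \<le> y" "y < u + int p" by auto
    have "y - u < l + \<xi> \<or> int p - \<xi> < y - u" using y e by (intro arc) auto
    then show "e \<in> \<iota> ` {c..c + h}"
    proof
      assume "y - u < l + \<xi>"
      then have "y \<in> {c..c + h}" using y l1 sizes unfolding c_def h_def \<xi>_def by auto
      then show ?thesis using y by blast
    next
      assume "int p - \<xi> < y - u"
      then have "y - int p \<in> {c..c + h}" using y l1 sizes T unfolding c_def h_def \<xi>_def by auto
      moreover have "\<iota> (y - int p) = \<iota> y" by (simp add: hom_eq_iff)
      ultimately show ?thesis using y by (metis imageI)
    qed
  qed
  moreover have "2 * h < int p" using l2 sizes h_def \<xi>_def by linarith
  ultimately show ?thesis by blast
qed

end

section \<open>Critical sets lie in short arcs\<close>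

text \<open>Two dilations are composed: one concentrates the near periods around 0, the other turns
  the step \<open>q\<close> of the progression they form into 1.\<close>

theorem critical_in_short_arc:
  fixes \<beta> :: real
  assumes \<beta>: "0 < \<beta>" "\<beta> < 1"
  shows "\<exists>\<epsilon>>0. \<exists>N. \<forall>p (\<iota> :: int \<Rightarrow> 'a::ab_group_add) A S. prime_cyclic p \<iota> \<longrightarrow> A \<subseteq> prime_cyclic.H \<iota> \<longrightarrow>
    S \<subseteq> prime_cyclic.H \<iota> \<longrightarrow> critical A A S \<epsilon> \<longrightarrow> N \<le> real (card A) \<longrightarrow>
    real (card A) \<le> (1 - \<beta>) * real p / 2 \<longrightarrow>
    (\<exists>m c h. coprime m (int p) \<and> A \<subseteq> (\<lambda>k. \<iota> (m * k)) ` {c..c + h} \<and> 2 * h < int p)"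
proof -
  \<comment> \<open>\<open>\<tau>\<close> sets the level \<open>T\<close>, about
    \<open>\<tau> * card A\<close>, so that \<open>1000 * T\<close> is at most both
    \<open>card A\<close> and \<open>p - 2 * card A\<close>. \<open>\<nu>\<close> brings the growth
    error down to \<open>T / 500\<close>, which the numerical bounds of the progression argument
    tolerate.\<close>
  define \<tau> where "\<tau> = \<beta> / 1000"
  define \<nu> where "\<nu> = \<tau> / 1000"
  have \<tau>: "0 < \<tau>" "\<tau> \<le> 1 / 1000" using \<beta> by (auto simp: \<tau>_def)
  have \<nu>: "0 < \<nu>" "\<nu> \<le> 1" using \<tau> by (auto simp: \<nu>_def)
  obtain \<epsilon>1 N1 where \<epsilon>1: "\<epsilon>1 > 0" and growth: "\<forall>p (\<iota> :: int \<Rightarrow> 'a) A S. prime_cyclic p \<iota> \<longrightarrow> A \<subseteq> prime_cyclic.H \<iota> \<longrightarrow>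
    S \<subseteq> prime_cyclic.H \<iota> \<longrightarrow> critical A A S \<epsilon>1 \<longrightarrow> N1 \<le> real (card A) \<longrightarrow>
    real (card A) \<le> (1 - \<beta>) * real p / 2 \<longrightarrow>
    (\<forall>T. 2 * T \<le> card A \<longrightarrow> \<bar>real (card (prime_cyclic.near_periods \<iota> A T)) - 2 * real T\<bar> \<le> \<nu> * real (card A))"
    using near_periods_linear_growth[OF \<beta> \<nu>, where 'a = 'a] by (elim exE conjE) (rule that)
  define \<epsilon> where "\<epsilon> = min \<epsilon>1 (\<tau> / 2)"
  have \<epsilon>: "0 < \<epsilon>" "\<epsilon> \<le> \<epsilon>1" "\<epsilon> \<le> \<tau> / 2" using \<epsilon>1 \<tau> by (auto simp: \<epsilon>_def)
  define N where "N = max N1 (200 / \<tau>)"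
  show ?thesis
  proof (rule exI[of _ \<epsilon>], rule conjI, rule \<epsilon>(1), rule exI[of _ N], intro allI impI)
    fix p and \<iota> :: "int \<Rightarrow> 'a" and A S
    assume pc: "prime_cyclic p \<iota>" and A: "A \<subseteq> prime_cyclic.H \<iota>" and S: "S \<subseteq> prime_cyclic.H \<iota>"
      and crit: "critical A A S \<epsilon>" and N: "N \<le> real (card A)"
      and np: "real (card A) \<le> (1 - \<beta>) * real p / 2"
    interpret prime_cyclic p \<iota> by fact
    note fin = finite_subset_H[OF A]
    let ?n = "real (card A)"
    define T where "T = nat \<lfloor>\<tau> * ?n\<rfloor>"
    have n: "N1 \<le> ?n" "200 / \<tau> \<le> ?n" using N by (simp_all only: N_def max.bounded_iff)
    then have \<tau>n: "200 \<le> \<tau> * ?n" using \<tau> by (simp add: pos_divide_le_eq mult.commute)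
    have T: "real T \<le> \<tau> * ?n" "\<tau> * ?n < real T + 1" unfolding T_def using \<tau>n by linarith+
    have T100: "100 \<le> T" using T \<tau>n by linarith
    have "\<tau> * ?n \<le> 1 / 1000 * ?n" using \<tau> by (intro mult_right_mono) auto
    then have "1000 * real T \<le> ?n" using T by linarith
    then have Tn: "1000 * T \<le> card A" by linarith
    have p1: "2 * ?n + \<beta> * real p \<le> real p" using np by (simp add: algebra_simps)
    have "0 \<le> \<beta> * real p" using \<beta> by simp
    then have "?n \<le> real p" using p1 by linarith
    then have "\<beta> * ?n \<le> \<beta> * real p" using \<beta> by (intro mult_left_mono) auto
    moreover have "\<beta> * ?n = 1000 * (\<tau> * ?n)" by (simp add: \<tau>_def)
    ultimately have "2 * ?n + 1000 * real T \<le> real p" using p1 T by linarith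
    then have pT: "2 * card A + 1000 * T \<le> p" by linarith
    have "\<nu> * ?n = (\<tau> * ?n) / 1000" by (simp add: \<nu>_def)
    then have \<nu>T: "\<nu> * ?n \<le> real T / 500" using T T100 by linarith
    have gr: "\<bar>real (card (near_periods A t)) - 2 * real t\<bar> \<le> real T / 500" if "2 * t \<le> card A" for t
      using growth[rule_format, OF pc A S critical_mono[OF crit \<epsilon>(2)] n(1) np that] \<nu>T by linarith
    have c1: "1998 / 1000 * real T \<le> real (card (near_periods A T))"
    proof -
      have "2 * T \<le> card A" using Tn by linarith
      from gr[OF this] show ?thesis by linarith
    qed
    have "\<bar>real (card (near_periods A (3 * T))) - 2 * real (3 * T)\<bar> \<le> real T / 500"
      using Tn by (intro gr) linarith
    moreover have "2 * real (3 * T) = 6 * real T" by simp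
    ultimately have "\<bar>real (card (near_periods A (3 * T))) - 6 * real T\<bar> \<le> real T / 500" by (simp only:)
    then have c3: "real (card (near_periods A (3 * T))) \<le> 301 / 50 * real T" using T100 by linarith
    have A0: "A \<noteq> {}" using Tn T100 by auto
    have "\<exists>m. coprime m (int p) \<and> (1 - 7 * real T / ?n) * real (card (near_periods A T))
      \<le> real (card {k. 8 * \<bar>k\<bar> < int p \<and> \<iota> (m * k) \<in> near_periods A T})"
    proof (rule ex_concentrated_rescaling[OF A])
      show "2 * card A < p" using pT T100 by linarith
      show "near_periods A T \<noteq> {}" using zero_in_near_periods by auto
      show "T > 0" using T100 by simp
    qed (use near_periods_subset_H A0 in \<open>auto simp: near_periods_def\<close>)
    then obtain m where m: "coprime m (int p)" and conc: "(1 - 7 * real T / ?n) * real (card (near_periods A T))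
      \<le> real (card {k. 8 * \<bar>k\<bar> < int p \<and> \<iota> (m * k) \<in> near_periods A T})" by blast
    interpret M: prime_cyclic p "\<lambda>k. \<iota> (m * k)" by (rule rescale[OF m])
    have MH: "M.H = H" by (rule rescale[OF m])
    have Mnp: "M.near_periods A t = near_periods A t" for t
      unfolding M.near_periods_def near_periods_def MH ..
    have "7 * real T / ?n \<le> 7 / 1000"
    proof -
      have "?n > 0" using A0 fin by (simp add: card_gt_0_iff)
      then show ?thesis using \<open>1000 * real T \<le> ?n\<close> by (simp add: field_simps)
    qed
    then have "993 / 1000 * (1998 / 1000 * real T) \<le> (1 - 7 * real T / ?n) * real (card (near_periods A T))"
      using c1 by (intro mult_mono) auto
    then have J: "99 / 50 * real T \<le> real (card {k. 8 * \<bar>k\<bar> < int p \<and> \<iota> (m * k) \<in> M.near_periods A T})"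
      using conc unfolding Mnp by simp
    obtain q l where q: "coprime q (int p)" and l: "0 < l" "985 * int T \<le> 1000 * l"
      "escape A (\<iota> (m * (q * l))) \<le> T" "\<forall>z\<in>{0..l}. escape A (\<iota> (m * (q * z))) \<le> 2 * T"
      using M.ex_long_near_period_progression[OF A[folded MH] T100 J] c3 unfolding Mnp by blast
    have mq: "coprime (m * q) (int p)" using m q by simp
    interpret Q: prime_cyclic p "\<lambda>k. \<iota> (m * q * k)" by (rule rescale[OF mq])
    have QH: "Q.H = H" by (rule rescale[OF mq])
    have "\<exists>u v. u \<le> v \<and> v < u + int p \<and> card {y \<in> {u..v}. \<iota> (m * q * y) \<notin> A} \<le> 16 * T \<and>
        card (A - (\<lambda>k. \<iota> (m * q * k)) ` {u..v}) \<le> 8 * T"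
    proof (rule Q.ex_dominant_arc[OF A[folded QH] _ Tn _ l(1,2)])
      show "2 * card A \<le> p" "0 < T" using pT T100 by linarith+
      show "escape A (\<iota> (m * q * l)) \<le> T" using l(3) by (simp only: mult.assoc)
      show "escape A (\<iota> (m * q * z)) \<le> 2 * T" if "z \<in> {0..l}" for z
        using l(4) that unfolding mult.assoc by blast
    qed
    then obtain u v where uv: "u \<le> v" "v < u + int p" "card {y \<in> {u..v}. \<iota> (m * q * y) \<notin> A} \<le> 16 * T"
      "card (A - (\<lambda>k. \<iota> (m * q * k)) ` {u..v}) \<le> 8 * T" by blast
    have "\<epsilon> * ?n \<le> \<tau> / 2 * ?n" using \<epsilon> by (intro mult_right_mono) auto
    then have \<epsilon>T: "\<epsilon> * ?n \<le> real T" using T T100 by linarith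
    have "2 \<le> T" using T100 by simp
    from Q.subset_short_arc[OF A[folded QH] S[folded QH] this Tn pT crit \<epsilon>T uv]
    show "\<exists>m c h. coprime m (int p) \<and> A \<subseteq> (\<lambda>k. \<iota> (m * k)) ` {c..c + h} \<and> 2 * h < int p"
      using mq by blast
  qed
qed

section \<open>Two translates in a short arc, and the greedy choice of summands\<close>

context prime_cyclic
begin

text \<open>The translates of \<open>A\<close> by its two extreme elements share at most the sum of
  the extremes, and both come from an interval of length less than \<open>p\<close>, where
  \<open>\<iota>\<close> is injective.\<close>

lemma short_arc_two_translates:
  assumes A: "A \<subseteq> \<iota> ` {c..c + h}" and h: "2 * h < int p" and ne: "A \<noteq> {}"
  shows "\<exists>a\<in>A. \<exists>b\<in>A. 2 * card A - 1 \<le> card ((\<lambda>x. x + a) ` A \<union> (\<lambda>x. x + b) ` A)"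
proof -
  define K where "K = {k \<in> {c..c + h}. \<iota> k \<in> A}"
  have finK: "finite K" unfolding K_def by (rule finite_subset[of _ "{c..c + h}"]) auto
  have AK: "A = \<iota> ` K" using A by (auto simp: K_def)
  have K0: "K \<noteq> {}" using ne AK by auto
  define i j where "i = Min K" and "j = Max K"
  have ij: "i \<in> K" "j \<in> K" unfolding i_def j_def using finK K0 by (auto intro: Min_in Max_in)
  have K: "i \<le> k \<and> k \<le> j" if "k \<in> K" for k using that finK unfolding i_def j_def by auto
  have range: "c \<le> i" "j \<le> c + h" using ij by (auto simp: K_def)
  let ?U = "(\<lambda>k. k + i) ` K" and ?V = "(\<lambda>k. k + j) ` K"
  have inj: "inj_on \<iota> (?U \<union> ?V)"
  proof (rule inj_on_hom)
    have "x \<in> {2 * i..2 * j}" if "x \<in> ?U \<union> ?V" for x using that K K[OF ij(1)] by force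
    then show "\<bar>x - y\<bar> < int p" if "x \<in> ?U \<union> ?V" "y \<in> ?U \<union> ?V" for x y
      using that[THEN \<open>\<And>x. x \<in> ?U \<union> ?V \<Longrightarrow> x \<in> {2 * i..2 * j}\<close>] range h by auto
  qed
  have "?U \<inter> ?V \<subseteq> {i + j}"
  proof
    fix x assume "x \<in> ?U \<inter> ?V"
    then obtain k k' where "x = k + i" "k \<in> K" "x = k' + j" "k' \<in> K" by (elim IntE imageE) (rule that)
    then show "x \<in> {i + j}" using K[of k] K[of k'] by auto
  qed
  then have "card (?U \<inter> ?V) \<le> card {i + j}" by (intro card_mono) auto
  moreover have "card ?U + card ?V = card (?U \<union> ?V) + card (?U \<inter> ?V)"
    using finK by (intro card_Un_Int) auto
  moreover have "card ?U = card K" "card ?V = card K" by (simp_all add: card_image inj_on_def)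
  moreover have "card A \<le> card K" unfolding AK by (rule card_image_le[OF finK])
  ultimately have "2 * card A - 1 \<le> card (?U \<union> ?V)" by simp
  also have "\<dots> = card (\<iota> ` (?U \<union> ?V))" using inj by (simp add: card_image)
  also have "\<iota> ` (?U \<union> ?V) = (\<lambda>x. x + \<iota> i) ` A \<union> (\<lambda>x. x + \<iota> j) ` A"
    unfolding AK by (simp add: image_Un image_image hom_add)
  finally show ?thesis using ij AK by blast
qed

end

text \<open>Take a largest \<open>B\<close> that gains on average at least \<open>\<delta>\<close>
  sums per element. Either it has all \<open>c\<close> elements, or no further \<open>b\<close>
  gains more than \<open>\<delta>\<close>, since adding such a \<open>b\<close> would keep the
  average.\<close>

lemma ex_saturating_subset:
  fixes A :: "'a::ab_group_add set"
  assumes fin: "finite A"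
  shows "\<exists>B\<subseteq>A. card B \<le> c \<and> (real c * \<delta> \<le> real (card {a + b | a b. a \<in> A \<and> b \<in> B}) \<or>
    (\<forall>b\<in>A. real (card {a \<in> A. b + a \<notin> {a + b | a b. a \<in> A \<and> b \<in> B}}) \<le> \<delta>))"
proof (cases "\<delta> > 0")
  case False
  then have "real c * \<delta> \<le> 0" by (simp add: mult_nonneg_nonpos)
  then show ?thesis by (intro exI[of _ "{}"]) simp
next
  case \<delta>: True
  let ?S = "\<lambda>B. {a + b | a b. a \<in> A \<and> b \<in> B}"
  have finS: "finite (?S B)" if "B \<subseteq> A" for B
  proof -
    have "?S B = (\<lambda>(a, b). a + b) ` (A \<times> B)" by auto
    moreover have "finite B" using that fin by (rule finite_subset)
    ultimately show ?thesis using fin by simp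
  qed
  let ?P = "\<lambda>B. B \<subseteq> A \<and> card B \<le> c \<and> real (card B) * \<delta> \<le> real (card (?S B))"
  have P0: "?P {}" by simp
  have bnd: "\<forall>C. ?P C \<longrightarrow> card C < Suc c" by (simp add: less_Suc_eq_le)
  obtain B where B: "?P B" and mx: "\<And>C. ?P C \<Longrightarrow> card C \<le> card B"
    using ex_has_greatest_nat[of ?P "{}" card "Suc c", OF P0 bnd] by blast
  have "real (card {a \<in> A. b + a \<notin> ?S B}) \<le> \<delta>" if b: "b \<in> A" and Bc: "card B \<noteq> c" for b
  proof (rule ccontr)
    assume contra: "\<not> ?thesis"
    let ?N = "{a \<in> A. b + a \<notin> ?S B}"
    have SI: "b + a \<in> ?S C" if "b \<in> C" "a \<in> A" for a C using that add.commute[of b a] by blast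
    have "?N \<noteq> {}"
    proof
      assume "?N = {}"
      then have "card ?N = 0" by (simp only: card.empty)
      then show False using contra \<delta> by simp
    qed
    then have bB: "b \<notin> B" using SI by blast
    have "?S B \<union> (\<lambda>a. b + a) ` ?N \<subseteq> ?S (insert b B)" using SI[of "insert b B"] by blast
    then have "card (?S B \<union> (\<lambda>a. b + a) ` ?N) \<le> card (?S (insert b B))"
      using B b by (intro card_mono finS) auto
    moreover have "card (?S B \<union> (\<lambda>a. b + a) ` ?N) = card (?S B) + card ((\<lambda>a. b + a) ` ?N)"
      using B fin by (intro card_Un_disjoint finS) auto
    moreover have "card ((\<lambda>a. b + a) ` ?N) = card ?N" by (simp add: card_image)
    ultimately have 1: "card (?S B) + card ?N \<le> card (?S (insert b B))" by simp
    have finB: "finite B" using B fin by (meson finite_subset)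
    have cI: "card (insert b B) = Suc (card B)" using bB finB by simp
    have "real (card (insert b B)) * \<delta> = real (card B) * \<delta> + \<delta>" unfolding cI by (simp add: algebra_simps)
    moreover have "real (card (?S B)) + real (card ?N) \<le> real (card (?S (insert b B)))" using 1 by linarith
    ultimately have "?P (insert b B)" using contra B b Bc cI by auto
    from mx[OF this] show False using cI by simp
  qed
  then show ?thesis using B by blast
qed

section \<open>The groups of prime order inside the circle\<close>

text \<open>A single type containing a group of every prime order: the prime is quantified inside the
  theorem, so it cannot be fixed by a type.\<close>

typedef circle = "{0..<1::real}" by (intro exI[of _ 0]) simp

definition circle_of :: "real \<Rightarrow> circle" where
  "circle_of r = Abs_circle (frac r)"

lemma Rep_circle_of: "Rep_circle (circle_of r) = frac r"
  unfolding circle_of_def by (rule Abs_circle_inverse) (simp add: frac_ge_0 frac_lt_1)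

lemma circle_of_Rep: "circle_of (Rep_circle a) = a"
proof -
  have "frac (Rep_circle a) = Rep_circle a" using Rep_circle[of a] by (simp add: frac_eq)
  then show ?thesis by (simp add: circle_of_def Rep_circle_inverse)
qed

lemma frac_eq_iff: "frac x = frac y \<longleftrightarrow> x - y \<in> \<int>" for x y :: real
proof
  assume "frac x = frac y"
  then have "x - y = real_of_int (\<lfloor>x\<rfloor> - \<lfloor>y\<rfloor>)" by (simp add: frac_def)
  then show "x - y \<in> \<int>" by (metis Ints_of_int)
next
  assume "x - y \<in> \<int>"
  then obtain k where "x - y = real_of_int k" by (auto elim: Ints_cases)
  then have "x = y + real_of_int k" by simp
  then show "frac x = frac y" by (simp add: frac_def)
qed

lemma circle_of_eq_iff: "circle_of x = circle_of y \<longleftrightarrow> x - y \<in> \<int>"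
  using Rep_circle_of[of x] Rep_circle_of[of y] frac_eq_iff[of x y] by (metis circle_of_def)

instantiation circle :: ab_group_add
begin

definition "0 = circle_of 0"
definition "a + b = circle_of (Rep_circle a + Rep_circle b)"
definition "- a = circle_of (- Rep_circle a)"
definition "a - b = circle_of (Rep_circle a - Rep_circle b)" for a b :: circle

instance
proof
  fix a b c :: circle
  show "a + b + c = a + (b + c)"
    by (simp add: plus_circle_def Rep_circle_of circle_of_eq_iff frac_def)
  show "a + b = b + a" by (simp add: plus_circle_def add.commute)
  have "circle_of (0 + Rep_circle a) = a" by (simp add: circle_of_Rep)
  then show "0 + a = a" by (simp add: plus_circle_def zero_circle_def Rep_circle_of)
  show "- a + a = 0"
    by (simp add: plus_circle_def zero_circle_def uminus_circle_def Rep_circle_of circle_of_eq_iff frac_def)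
  show "a - b = a + - b"
    by (simp add: plus_circle_def minus_circle_def uminus_circle_def Rep_circle_of circle_of_eq_iff frac_def)
qed

end

lemma circle_of_add: "circle_of (x + y) = circle_of x + circle_of y"
  by (simp add: plus_circle_def Rep_circle_of circle_of_eq_iff frac_def)

lemma prime_cyclic_circle:
  assumes "prime p" shows "prime_cyclic p (\<lambda>k. circle_of (real_of_int k / real p))"
proof
  have p: "p > 0" using assms by (simp add: prime_gt_0_nat)
  show "prime p" by fact
  show "circle_of (real_of_int (j + k) / real p) = circle_of (real_of_int j / real p) + circle_of (real_of_int k / real p)" for j k
    by (simp add: add_divide_distrib circle_of_add)
  show "circle_of (real_of_int k / real p) = 0 \<longleftrightarrow> int p dvd k" for k
  proof -
    have "circle_of (real_of_int k / real p) = 0 \<longleftrightarrow> real_of_int k / real p \<in> \<int>"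
      by (simp add: zero_circle_def circle_of_eq_iff)
    also have "\<dots> \<longleftrightarrow> int p dvd k"
    proof
      assume "real_of_int k / real p \<in> \<int>"
      then obtain i where "real_of_int k / real p = real_of_int i" by (auto elim: Ints_cases)
      then have "real_of_int k = real_of_int (i * int p)" using p by (simp add: field_simps)
      then have "k = i * int p" by (simp only: of_int_eq_iff)
      then show "int p dvd k" by simp
    next
      assume "int p dvd k"
      then obtain i where "k = int p * i" by auto
      then show "real_of_int k / real p \<in> \<int>" using p by simp
    qed
    finally show ?thesis .
  qed
qed

section \<open>Transfer to residues and the loss from forbidden pairs\<close>

context prime_cyclic
begin

text \<open>Reduction modulo \<open>p\<close> is invisible to \<open>\<iota>\<close>, so only the
  forbidden pairs, at most \<open>d\<close> for each \<open>b\<close>, separate the two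
  cardinalities.\<close>

lemma card_sumset_le_restricted_sum:
  assumes A: "A \<subseteq> {0..<int p}" and B: "B \<subseteq> A" and d: "\<And>b. b \<in> B \<Longrightarrow> card {a \<in> A. (a, b) \<in> F} \<le> d"
  shows "card {x + y | x y. x \<in> \<iota> ` A \<and> y \<in> \<iota> ` B}
    \<le> card (restricted_sum (residue_ring (int p)) F A B) + card B * d"
proof -
  let ?R = "restricted_sum (residue_ring (int p)) F A B"
  have finA: "finite A" using A by (rule finite_subset) simp
  have finB: "finite B" using B finA by (rule finite_subset)
  have R: "?R = {(a + b) mod int p | a b. a \<in> A \<and> b \<in> B \<and> (a, b) \<notin> F}"
    unfolding restricted_sum_def residue_ring_def by simp
  have "?R \<subseteq> {0..<int p}" unfolding R using p_pos by auto
  then have finR: "finite ?R" by (rule finite_subset) simp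
  have "{x + y | x y. x \<in> \<iota> ` A \<and> y \<in> \<iota> ` B}
      \<subseteq> \<iota> ` ?R \<union> (\<Union>b\<in>B. (\<lambda>a. \<iota> a + \<iota> b) ` {a \<in> A. (a, b) \<in> F})"
  proof
    fix z assume "z \<in> {x + y | x y. x \<in> \<iota> ` A \<and> y \<in> \<iota> ` B}"
    then obtain a b where ab: "z = \<iota> a + \<iota> b" "a \<in> A" "b \<in> B" by blast
    show "z \<in> \<iota> ` ?R \<union> (\<Union>b\<in>B. (\<lambda>a. \<iota> a + \<iota> b) ` {a \<in> A. (a, b) \<in> F})"
    proof (cases "(a, b) \<in> F")
      case True
      then show ?thesis using ab by blast
    next
      case False
      then have "(a + b) mod int p \<in> ?R" using ab unfolding R by blast
      moreover have "z = \<iota> ((a + b) mod int p)" by (simp add: ab hom_mod hom_add)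
      ultimately show ?thesis by blast
    qed
  qed
  then have "card {x + y | x y. x \<in> \<iota> ` A \<and> y \<in> \<iota> ` B}
      \<le> card (\<iota> ` ?R \<union> (\<Union>b\<in>B. (\<lambda>a. \<iota> a + \<iota> b) ` {a \<in> A. (a, b) \<in> F}))"
    using finA finB finR by (intro card_mono) auto
  also have "\<dots> \<le> card (\<iota> ` ?R) + card (\<Union>b\<in>B. (\<lambda>a. \<iota> a + \<iota> b) ` {a \<in> A. (a, b) \<in> F})"
    by (rule card_Un_le)
  also have "card (\<iota> ` ?R) \<le> card ?R" by (rule card_image_le[OF finR])
  also have "card (\<Union>b\<in>B. (\<lambda>a. \<iota> a + \<iota> b) ` {a \<in> A. (a, b) \<in> F})
      \<le> (\<Sum>b\<in>B. card ((\<lambda>a. \<iota> a + \<iota> b) ` {a \<in> A. (a, b) \<in> F}))"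
    by (rule card_UN_le[OF finB])
  also have "\<dots> \<le> (\<Sum>b\<in>B. d)"
  proof (rule sum_mono)
    fix b assume "b \<in> B"
    have "card ((\<lambda>a. \<iota> a + \<iota> b) ` {a \<in> A. (a, b) \<in> F}) \<le> card {a \<in> A. (a, b) \<in> F}"
      using finA by (intro card_image_le) simp
    then show "card ((\<lambda>a. \<iota> a + \<iota> b) ` {a \<in> A. (a, b) \<in> F}) \<le> d" using d[OF \<open>b \<in> B\<close>] by linarith
  qed
  finally show ?thesis by simp
qed

end

theorem theorem35:
  fixes d :: "nat \<Rightarrow> nat" and \<beta> :: real
  assumes "(\<lambda>n. real (d n)) \<in> o(\<lambda>n. real n)" and "\<beta> > 0"
  shows "\<exists>c n\<^sub>0 :: nat. \<forall>(p :: nat) (A :: int set) (F :: (int \<times> int) set) (n :: nat).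
    prime p \<longrightarrow> A \<subseteq> carrier (residue_ring (int p)) \<longrightarrow> card A = n \<longrightarrow>
    n\<^sub>0 \<le> n \<longrightarrow> real n \<le> (1 - \<beta>) * real p / 2 \<longrightarrow>
    F \<subseteq> A \<times> A \<longrightarrow> forbidden_degree A F = d n \<longrightarrow>
    (\<exists>B' \<subseteq> A. card B' \<le> c \<and>
      int (card (restricted_sum (residue_ring (int p)) F A B')) \<ge> 2 * int n - 1 - 2 * int (d n))"
proof -
  \<comment> \<open>Lowering \<open>\<beta>\<close> only relaxes the bound on \<open>n\<close>, and
    the structural theorem is stated for values below 1.\<close>
  define \<gamma> where "\<gamma> = min \<beta> (1 / 2)"
  have \<gamma>: "0 < \<gamma>" "\<gamma> < 1" "\<gamma> \<le> \<beta>" using assms(2) by (auto simp: \<gamma>_def)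
  obtain \<epsilon> N where \<epsilon>: "\<epsilon> > 0" and struct: "\<forall>p (\<iota> :: int \<Rightarrow> circle) A S. prime_cyclic p \<iota> \<longrightarrow> A \<subseteq> prime_cyclic.H \<iota> \<longrightarrow>
    S \<subseteq> prime_cyclic.H \<iota> \<longrightarrow> critical A A S \<epsilon> \<longrightarrow> N \<le> real (card A) \<longrightarrow>
    real (card A) \<le> (1 - \<gamma>) * real p / 2 \<longrightarrow>
    (\<exists>m c h. coprime m (int p) \<and> A \<subseteq> (\<lambda>k. \<iota> (m * k)) ` {c..c + h} \<and> 2 * h < int p)"
    using critical_in_short_arc[OF \<gamma>(1,2), where 'a = circle] by (elim exE conjE) (rule that)
  \<comment> \<open>Chosen so that \<open>c\<close> gains of \<open>\<epsilon> * n\<close> sums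
    reach \<open>(2 + \<epsilon>) * n\<close>; the summand 2 also leaves room for the two translates
    of the structured case.\<close>
  define c where "c = nat \<lceil>2 / \<epsilon>\<rceil> + 2"
  have "2 / \<epsilon> + 1 \<le> real c" unfolding c_def by linarith
  then have "(2 / \<epsilon> + 1) * \<epsilon> \<le> real c * \<epsilon>" using \<epsilon> by (intro mult_right_mono) auto
  moreover have "(2 / \<epsilon> + 1) * \<epsilon> = 2 + \<epsilon>" using \<epsilon> by (simp add: distrib_right)
  ultimately have c: "2 + \<epsilon> \<le> real c * \<epsilon>" by linarith
  have c2: "2 \<le> c" by (simp add: c_def)
  \<comment> \<open>With at most \<open>c\<close> summands the forbidden pairs cost at most
    \<open>c * d n \<le> \<epsilon> * n\<close>, which brings \<open>(2 + \<epsilon>) * n\<close>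
    down to \<open>2 * n\<close>.\<close>
  have "eventually (\<lambda>n. norm (real (d n)) \<le> \<epsilon> / real c * norm (real n)) sequentially"
    using assms(1) \<epsilon> c2 by (intro landau_o.smallD) auto
  then obtain n1 where n1: "\<And>n. n1 \<le> n \<Longrightarrow> real (d n) \<le> \<epsilon> / real c * real n"
    by (auto simp: eventually_sequentially)
  define n0 where "n0 = max (max n1 (nat \<lceil>N\<rceil>)) 1"
  show ?thesis
  proof (rule exI[of _ c], rule exI[of _ n0], intro allI impI)
    fix p :: nat and A :: "int set" and F :: "(int \<times> int) set" and n :: nat
    assume p: "prime p" and A: "A \<subseteq> carrier (residue_ring (int p))" and n: "card A = n" and n0: "n0 \<le> n"
      and np: "real n \<le> (1 - \<beta>) * real p / 2" and F: "F \<subseteq> A \<times> A" and deg: "forbidden_degree A F = d n"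
    define \<iota> where "\<iota> = (\<lambda>k. circle_of (real_of_int k / real p))"
    interpret prime_cyclic p \<iota> unfolding \<iota>_def by (rule prime_cyclic_circle[OF p])
    have A': "A \<subseteq> {0..<int p}" using A by (auto simp: residue_ring_def)
    have finA: "finite A" using A' by (rule finite_subset) simp
    have nn: "n1 \<le> n" "N \<le> real n" "1 \<le> n" using n0 unfolding n0_def by linarith+
    have A0: "A \<noteq> {}" using n nn by auto
    have np': "real n \<le> (1 - \<gamma>) * real p / 2"
    proof -
      have "(1 - \<beta>) * real p \<le> (1 - \<gamma>) * real p" using \<gamma> by (intro mult_right_mono) auto
      then show ?thesis using np by linarith
    qed
    have dd: "card {a \<in> A. (a, b) \<in> F} \<le> d n" if "b \<in> A" for b
    proof -
      have "forbidden_vertex_degree A F b \<le> forbidden_degree A F"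
        unfolding forbidden_degree_def using that finA by (intro Max_ge) auto
      then show ?thesis by (simp add: forbidden_vertex_degree_def deg)
    qed
    define X where "X = \<iota> ` A"
    have XH: "X \<subseteq> H" by (auto simp: X_def)
    have "inj_on \<iota> A"
    proof (rule inj_on_hom)
      fix j k assume "j \<in> A" "k \<in> A"
      then have "j \<in> {0..<int p}" "k \<in> {0..<int p}" using A' by blast+
      then show "\<bar>j - k\<bar> < int p" by auto
    qed
    then have cX: "card X = n" unfolding X_def using n by (simp add: card_image)
    have lower: "\<exists>B' \<subseteq> A. card B' \<le> card Y \<and> \<iota> ` B' = Y \<and>
        int (card {x + y | x y. x \<in> X \<and> y \<in> Y}) - int (card Y) * int (d n)
        \<le> int (card (restricted_sum (residue_ring (int p)) F A B'))" if "Y \<subseteq> X" for Y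
    proof -
      have "\<exists>U\<subseteq>A. inj_on \<iota> U \<and> Y = \<iota> ` U" using that unfolding X_def by (simp only: subset_image_inj)
      then obtain B' where B': "B' \<subseteq> A" "Y = \<iota> ` B'" "inj_on \<iota> B'" by (elim exE conjE) (rule that)
      have cB: "card B' = card Y" using B' by (simp add: card_image)
      have "card {x + y | x y. x \<in> \<iota> ` A \<and> y \<in> \<iota> ` B'}
          \<le> card (restricted_sum (residue_ring (int p)) F A B') + card B' * d n"
        using B' by (intro card_sumset_le_restricted_sum A' dd) auto
      then have "int (card {x + y | x y. x \<in> X \<and> y \<in> Y})
          \<le> int (card (restricted_sum (residue_ring (int p)) F A B') + card B' * d n)"
        unfolding X_def B'(2) by (simp only: of_nat_le_iff)
      then show ?thesis using B' cB by (intro exI[of _ B']) auto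
    qed
    obtain B where B: "B \<subseteq> X" "card B \<le> c" and sat: "real c * (\<epsilon> * real n) \<le> real (card {a + b | a b. a \<in> X \<and> b \<in> B}) \<or>
        (\<forall>b\<in>X. real (card {a \<in> X. b + a \<notin> {a + b | a b. a \<in> X \<and> b \<in> B}}) \<le> \<epsilon> * real n)"
      using ex_saturating_subset[OF finite_subset_H[OF XH], of c "\<epsilon> * real n"] by blast
    define S where "S = {a + b | a b. a \<in> X \<and> b \<in> B}"
    show "\<exists>B' \<subseteq> A. card B' \<le> c \<and>
      int (card (restricted_sum (residue_ring (int p)) F A B')) \<ge> 2 * int n - 1 - 2 * int (d n)"
    proof (cases "(2 + \<epsilon>) * real n \<le> real (card S)")
      case True
      obtain B' where B': "B' \<subseteq> A" "card B' \<le> card B"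
        "int (card S) - int (card B) * int (d n) \<le> int (card (restricted_sum (residue_ring (int p)) F A B'))"
        using lower[OF B(1)] unfolding S_def by blast
      have "real (card B) * real (d n) \<le> real c * (\<epsilon> / real c * real n)"
        using B(2) n1[OF nn(1)] by (intro mult_mono) auto
      also have "\<dots> = \<epsilon> * real n" using c2 by simp
      finally have "2 * real n \<le> real (card S) - real (card B) * real (d n)" using True by (simp add: algebra_simps)
      then have "real_of_int (2 * int n) \<le> real_of_int (int (card S) - int (card B) * int (d n))" by simp
      then have "2 * int n \<le> int (card S) - int (card B) * int (d n)" by (simp only: of_int_le_iff)
      then show ?thesis using B' B(2) by (intro exI[of _ B']) auto
    next
      case False
      \<comment> \<open>So few sums exclude the first alternative of \<open>sat\<close>; the second,
        with the bound on \<open>card S\<close>, is criticality of \<open>X\<close> with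
        itself.\<close>
      have "(2 + \<epsilon>) * real n \<le> real c * (\<epsilon> * real n)"
        using mult_right_mono[OF c, of "real n"] by (simp add: mult.assoc)
      then have "critical X X S \<epsilon>"
        using sat False unfolding critical_def cX S_def[symmetric] by (auto simp: algebra_simps)
      moreover have "S \<subseteq> H" unfolding S_def using XH B by (auto intro: H_add)
      ultimately obtain m u h where m: "coprime m (int p)" and arc: "X \<subseteq> (\<lambda>k. \<iota> (m * k)) ` {u..u + h}" "2 * h < int p"
        using struct[rule_format, OF prime_cyclic_axioms XH, of S] nn np' cX by auto
      interpret M: prime_cyclic p "\<lambda>k. \<iota> (m * k)" by (rule rescale[OF m])
      obtain a b where ab: "a \<in> X" "b \<in> X" "2 * card X - 1 \<le> card ((\<lambda>x. x + a) ` X \<union> (\<lambda>x. x + b) ` X)"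
        using M.short_arc_two_translates[OF arc] A0 by (auto simp: X_def)
      have "(\<lambda>x. x + a) ` X \<union> (\<lambda>x. x + b) ` X = {x + y | x y. x \<in> X \<and> y \<in> {a, b}}" by auto
      then have big: "2 * card X - 1 \<le> card {x + y | x y. x \<in> X \<and> y \<in> {a, b}}" using ab(3) by simp
      obtain B' where B': "B' \<subseteq> A" "card B' \<le> card {a, b}"
        "int (card {x + y | x y. x \<in> X \<and> y \<in> {a, b}}) - int (card {a, b}) * int (d n)
          \<le> int (card (restricted_sum (residue_ring (int p)) F A B'))"
        using lower[of "{a, b}"] ab(1,2) by blast
      have cab: "card {a, b} \<le> 2" by (simp add: card_insert_if)
      then have "int (card {a, b}) * int (d n) \<le> 2 * int (d n)" by (intro mult_right_mono) auto
      moreover have "2 * int n - 1 \<le> int (card {x + y | x y. x \<in> X \<and> y \<in> {a, b}})" using big cX by linarith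
      ultimately show ?thesis using B' cab c2 by (intro exI[of _ B']) auto
    qed
  qed
qed

end
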